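(* Let $\beta\in(1/3,1/2)$ be given and let $f(u)=u(1-u)(u-\beta)$. There exists $\gamma_1>0$ (depending on $\beta$) such that for any $\gamma\in(0,\gamma_1]$ there is a $d_1=d_1(\gamma)>0$ with the following property: whenever $0<\gamma<\gamma_1$ and $0<d<d_1(\gamma)$, the system $$d\,u_{xx}+f(u)-v=0,\qquad v_{xx}-\gamma v-v^3+u=0\qquad\text{on }(-\infty,\infty)$$ has a solution $(u_0,v_0)$ with $u_0,v_0\in C^\infty(0,\infty)$ and with $u_0,v_0$ exponentially decaying to $0$ as $x\to\infty$; that is, the system possesses a standing pulse solution.
   Context: A standing pulse solution of the system is a non-constant solution $(u,v)$ on $(-\infty,\infty)$ that is even in $x$ and satisfies $\lim_{|x|\to\infty}(u,v)=(0,0)$. *)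

theory Defs
  imports "HOL-Analysis.Analysis" "HOL-Library.Landau_Symbols"
begin

definition cubic :: "real \<Rightarrow> real \<Rightarrow> real" where
  "cubic \<beta> u = u * (1 - u) * (u - \<beta>)"

text \<open>Since \<^const>\<open>deriv\<close> is total, differentiability has to be required explicitly.\<close>

definition twice_differentiable :: "(real \<Rightarrow> real) \<Rightarrow> bool" where
  "twice_differentiable w \<longleftrightarrow>
     (\<forall>x. w field_differentiable (at x) \<and> deriv w field_differentiable (at x))"

definition is_solution ::
  "real \<Rightarrow> real \<Rightarrow> real \<Rightarrow> (real \<Rightarrow> real) \<Rightarrow> (real \<Rightarrow> real) \<Rightarrow> bool" where
  "is_solution \<beta> \<gamma> d u v \<longleftrightarrow>
     twice_differentiable u \<and> twice_differentiable v \<and>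
     (\<forall>x. d * deriv (deriv u) x + cubic \<beta> (u x) - v x = 0) \<and>
     (\<forall>x. deriv (deriv v) x - \<gamma> * v x - v x ^ 3 + u x = 0)"

text \<open>On \<^typ>\<open>real\<close>, the filter \<^const>\<open>at_infinity\<close> expresses \<open>\<bar>x\<bar> \<rightarrow> \<infinity>\<close>.\<close>

definition standing_pulse ::
  "real \<Rightarrow> real \<Rightarrow> real \<Rightarrow> (real \<Rightarrow> real) \<Rightarrow> (real \<Rightarrow> real) \<Rightarrow> bool" where
  "standing_pulse \<beta> \<gamma> d u v \<longleftrightarrow>
     is_solution \<beta> \<gamma> d u v \<and>
     \<not> (\<lambda>x. (u x, v x)) constant_on UNIV \<and>
     (\<forall>x. u (- x) = u x \<and> v (- x) = v x) \<and>
     ((\<lambda>x. (u x, v x)) \<longlongrightarrow> (0, 0)) at_infinity"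

definition smooth_on_pos :: "(real \<Rightarrow> real) \<Rightarrow> bool" where
  "smooth_on_pos w \<longleftrightarrow> (\<forall>n. \<forall>x>0. (deriv ^^ n) w field_differentiable (at x))"

definition exp_decaying :: "(real \<Rightarrow> real) \<Rightarrow> bool" where
  "exp_decaying w \<longleftrightarrow> (\<exists>c>0. w \<in> O[at_top](\<lambda>x. exp (- c * x)))"

end

theory Submission
  imports Defs
begin

text \<open>Let \<open>\<epsilon> = sqrt d\<close> and let \<open>f\<close> be the cubic. For small \<open>\<epsilon>\<close> a pulse consists of a core around its centre, on
  which \<open>u\<close> mostly follows the right decreasing branch of \<open>v = f u\<close>, of tails on which it follows the left
  one, and between them of layers of width \<open>O(\<epsilon>)\<close> in which \<open>u\<close> moves from \<open>2 * mid\<close> to \<open>0\<close> while \<open>v\<close>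
  hardly changes. Here \<open>mid = (1 + \<beta>) / 3\<close> is the inflection point of \<open>f\<close>; with \<open>jump = f mid\<close> the
  graph is symmetric under \<open>(u, v) \<mapsto> (2 * mid - u, 2 * jump - v)\<close>. By the equal area rule a layer
  requires \<open>v\<close> to be close to \<open>jump\<close>, and \<open>\<beta> < 1/2\<close> makes this number positive. On the half line
  \<open>x \<ge> 0\<close> the three pieces are constructed separately and then matched; even reflection gives the pulse.

  Core and tail. The symmetry turns the core into a problem of the same form as the tail: a second order
  system with \<open>u = 0\<close> and \<open>v = q\<close> prescribed at one end, and a Neumann condition or boundedness at the
  other. The cubic is replaced by a function of slope between \<open>- 3/5\<close> and \<open>- 3/10\<close>; the maximum
  principle shows afterwards that the solutions stay where nothing was changed. Existence is a Banach
  fixed point in the variables \<open>u + 20/9 * v\<close> and \<open>v\<close> (\<open>half_problem_exists\<close>). The coupling of the two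
  equations is skew, so a weighted sum of \<open>u\<^sup>2\<close> and \<open>v\<^sup>2\<close> has positive second derivative. Applied to a
  difference of solutions this gives continuous dependence (\<open>difference_bound\<close>), applied to a solution
  exponential decay of the tail (\<open>energy_decay\<close>).

  Layer. In the variable \<open>x / \<epsilon>\<close> the layer is a regular initial value problem in which \<open>v\<close> and \<open>v'\<close> are
  slow and \<open>(\<epsilon> * u')\<^sup>2 / 2 + F u - u * v\<close>, with \<open>F' = f\<close>, is almost conserved; so \<open>u\<close> runs from \<open>2 * mid\<close> down
  through \<open>0\<close> (\<open>layer_properties\<close>).

  Matching. Start the layer with the data of a core of half length \<open>l\<close> with \<open>v = q\<close> at its end, and stop it
  after the time \<open>S\<close>. For the data to be those of a tail, \<open>u\<close> has to vanish, the conserved quantity has to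
  agree and \<open>v'\<close> has to agree. These three quantities change sign in \<open>S\<close>, in \<open>q\<close> near \<open>jump\<close> and in \<open>l\<close>
  respectively, and the Poincare--Miranda theorem yields a solution (\<open>matching\<close>). For the conserved
  quantity this rests on a comparison of the slopes \<open>\<epsilon> * u'\<close> of core and tail
  (\<open>outer_inner_comparison\<close>), which by symmetry solve the same equation near the layer and thus differ, up
  to \<open>O(\<epsilon>)\<close>, only through their values of \<open>v\<close>. The slope of \<open>v\<close> in the tail is only known
  to be at least of the order \<open>sqrt \<gamma>\<close>, and \<open>\<epsilon>\<close> has to be small against it; so the bound for \<open>d\<close> depends
  on \<open>\<gamma>\<close>.\<close>


section \<open>Antiderivatives and the maximum principle\<close>

lemma antiderivative_UNIV:
  fixes g :: "real \<Rightarrow> 'a::banach"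
  assumes "continuous_on UNIV g"
  obtains G where "G 0 = 0" "\<And>x. (G has_vector_derivative g x) (at x)"
proof -
  define G where "G = (\<lambda>x. integral {0..x} g - integral {x..0} g)"
  have int: "g integrable_on {a..b}" for a b
    by (rule integrable_continuous_interval) (rule continuous_on_subset[OF assms], simp)
  have eq: "G x = integral {-n..x} g - integral {-n..0} g" if "-n < x" "x < n" for x n
  proof (cases "0 \<le> x")
    case True
    have "integral {-n..0} g + integral {0..x} g = integral {-n..x} g"
      using that True by (intro Henstock_Kurzweil_Integration.integral_combine int) auto
    moreover have "integral {x..0} g = 0"
      using True by (cases "x = 0") auto
    ultimately show ?thesis by (simp add: G_def algebra_simps)
  next
    case False
    have "integral {-n..x} g + integral {x..0} g = integral {-n..0} g"
      using that False by (intro Henstock_Kurzweil_Integration.integral_combine int) auto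
    moreover have "integral {0..x} g = 0"
      using False by auto
    ultimately show ?thesis by (simp add: G_def algebra_simps)
  qed
  have "(G has_vector_derivative g x) (at x)" for x
  proof -
    define n where "n = \<bar>x\<bar> + 1"
    have x: "-n < x" "x < n" by (auto simp: n_def)
    have "((\<lambda>u. integral {-n..u} g) has_vector_derivative g x) (at x within {-n..n})"
      using x by (intro integral_has_vector_derivative continuous_on_subset[OF assms]) auto
    hence "((\<lambda>u. integral {-n..u} g) has_vector_derivative g x) (at x)"
      using x by (metis at_within_Icc_at)
    hence "((\<lambda>u. integral {-n..u} g - integral {-n..0} g) has_vector_derivative g x) (at x)"
      by (auto intro!: derivative_eq_intros)
    thus ?thesis
      using x eq by (elim has_vector_derivative_transform_within_open[where S="{-n<..<n}"]) auto
  qed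
  moreover have "G 0 = 0" by (simp add: G_def)
  ultimately show ?thesis using that by blast
qed

text \<open>A critical point with positive second derivative is not a maximum even from the left, so the
  test also applies at a right end point with vanishing derivative.\<close>

lemma second_derivative_left_increase:
  fixes z z1 :: "real \<Rightarrow> real"
  assumes lt: "a < x"
    and z: "\<And>t. a \<le> t \<Longrightarrow> t \<le> x \<Longrightarrow> (z has_real_derivative z1 t) (at t)"
    and z1: "(z1 has_real_derivative l) (at x)" and "z1 x = 0" "l > 0"
  shows "\<exists>t. a < t \<and> t < x \<and> z t > z x"
proof -
  obtain e where e: "e > 0" "\<And>h. 0 < h \<Longrightarrow> h < e \<Longrightarrow> z1 (x - h) < z1 x"
    using DERIV_pos_inc_left[OF z1 \<open>l > 0\<close>] by blast
  define h where "h = min (e / 2) ((x - a) / 2)"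
  have h: "h > 0" "h < e" "x - h > a" using e lt by (auto simp: h_def min_def field_simps)
  have "\<exists>s. x - h < s \<and> s < x \<and> z x - z (x - h) = (x - (x - h)) * z1 s"
    using h by (intro MVT2) (auto intro!: z)
  then obtain s where s: "x - h < s" "s < x" "z x - z (x - h) = h * z1 s" by auto
  have "z1 s < 0" using e(2)[of "x - s"] s h \<open>z1 x = 0\<close> by auto
  hence "z x - z (x - h) < 0" using s h by (simp add: mult_pos_neg)
  thus ?thesis using h by (intro exI[of _ "x - h"]) auto
qed

text \<open>The right end point may carry a Neumann condition instead of a bound: a maximum there would still
  have vanishing derivative, and \<open>z\<close> would be larger slightly to the left of it.\<close>

lemma interior_max_principle:
  fixes z z1 z2 :: "real \<Rightarrow> real"
  assumes z: "\<And>x. 0 \<le> x \<Longrightarrow> x \<le> b \<Longrightarrow> (z has_real_derivative z1 x) (at x)"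
    and z1: "\<And>x. 0 \<le> x \<Longrightarrow> x \<le> b \<Longrightarrow> (z1 has_real_derivative z2 x) (at x)"
    and M: "z 0 \<le> M" "z b \<le> M \<or> z1 b = 0"
    and pos: "\<And>x. 0 < x \<Longrightarrow> x \<le> b \<Longrightarrow> z x > M \<Longrightarrow> z2 x > 0"
    and x: "0 \<le> x" "x \<le> b"
  shows "z x \<le> M"
proof (rule ccontr)
  assume "\<not> z x \<le> M"
  have "continuous_on {0..b} z"
    by (intro continuous_at_imp_continuous_on ballI DERIV_isCont[OF z]) auto
  then obtain m where m: "0 \<le> m" "m \<le> b" "\<And>t. 0 \<le> t \<Longrightarrow> t \<le> b \<Longrightarrow> z t \<le> z m"
    using continuous_attains_sup[of "{0..b}" z] x by auto
  have "z m > M" using m(3)[of x] x \<open>\<not> z x \<le> M\<close> by auto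
  hence m0: "m > 0" using m M by (cases "m = 0") auto
  have "z1 m = 0"
  proof (cases "m = b")
    case True
    then show ?thesis using M \<open>z m > M\<close> by auto
  next
    case False
    define e where "e = min m (b - m)"
    show ?thesis
      using DERIV_local_max[OF z[OF m(1,2)], of e] False m m0
      by (auto simp: e_def abs_if split: if_splits)
  qed
  with second_derivative_left_increase[of 0 m z z1 "z2 m"] m0 m z z1 pos \<open>z m > M\<close>
  obtain t where "0 < t" "t < m" "z t > z m" by force
  thus False using m(2) m(3)[of t] by linarith
qed

text \<open>The tail and the core of a pulse are both pinned at \<open>0\<close>. The tail extends to infinity, where mere
  boundedness selects the decaying solutions; the core is scaled to length one and meets its mirror image at
  \<open>1\<close>.\<close>

datatype far_end = Unbounded | Reflecting

fun domain :: "far_end \<Rightarrow> real set" where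
  "domain Unbounded = {0..}"
| "domain Reflecting = {0..1}"

fun far_cond :: "far_end \<Rightarrow> (real \<Rightarrow> real) \<Rightarrow> (real \<Rightarrow> real) \<Rightarrow> bool" where
  "far_cond Unbounded z z1 \<longleftrightarrow> (\<exists>C. \<forall>x\<ge>0. \<bar>z x\<bar> \<le> C)"
| "far_cond Reflecting z z1 \<longleftrightarrow> z1 1 = 0"

definition deriv2_on :: "real set \<Rightarrow> (real \<Rightarrow> real) \<Rightarrow> (real \<Rightarrow> real) \<Rightarrow> (real \<Rightarrow> real) \<Rightarrow> bool" where
  "deriv2_on D z z1 z2 \<longleftrightarrow> (\<forall>x\<in>D. (z has_real_derivative z1 x) (at x) \<and>
     (z1 has_real_derivative z2 x) (at x))"

lemma unit_subset_domain: "0 \<le> x \<Longrightarrow> x \<le> 1 \<Longrightarrow> x \<in> domain e"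
  by (cases e) auto

theorem max_principle:
  assumes d: "deriv2_on (domain e) z z1 z2"
    and M: "z 0 \<le> M" and far: "far_cond e z z1"
    and pos: "\<And>x. x \<in> domain e \<Longrightarrow> 0 < x \<Longrightarrow> z x > M \<Longrightarrow> z2 x > 0"
    and x: "x \<in> domain e"
  shows "z x \<le> M"
proof (cases e)
  case Reflecting
  show ?thesis
    by (rule interior_max_principle[where b=1 and ?z1.0=z1 and ?z2.0=z2])
       (use d M far pos x Reflecting in \<open>auto simp: deriv2_on_def\<close>)
next
  case Unbounded
  then obtain C where C: "\<And>x. x \<ge> 0 \<Longrightarrow> \<bar>z x\<bar> \<le> C" using far by auto
  \<comment> \<open>Subtracting a small multiple of \<open>x\<close> makes the bounded function \<open>z\<close> negative far out without
    changing its second derivative.\<close>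
  have "z x \<le> M + \<delta> * x" if "\<delta> > 0" for \<delta>
  proof -
    define b where "b = max x ((\<bar>C\<bar> + \<bar>M\<bar>) / \<delta>)"
    have b: "b \<ge> x" "\<delta> * b \<ge> \<bar>C\<bar> + \<bar>M\<bar>"
      using that by (auto simp: b_def max_def field_simps)
    have x0: "x \<ge> 0" using x Unbounded by auto
    have "z x - \<delta> * x \<le> M"
    proof (rule interior_max_principle[where b=b and z="\<lambda>x. z x - \<delta> * x" and ?z1.0="\<lambda>x. z1 x - \<delta>" and ?z2.0=z2])
      show "z b - \<delta> * b \<le> M \<or> z1 b - \<delta> = 0"
        using C[of b] b x0 by (auto simp: abs_if split: if_splits)
      fix y assume y: "0 < y" "y \<le> b" "M < z y - \<delta> * y"
      then have "0 < \<delta> * y" using that by simp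
      then show "z2 y > 0" using y pos[of y] Unbounded by auto
    qed (use d M Unbounded x0 b in \<open>auto simp: deriv2_on_def intro!: derivative_eq_intros\<close>)
    thus ?thesis by simp
  qed
  hence "z x \<le> M + \<eta>" if "\<eta> > 0" for \<eta>
    using that x Unbounded M \<open>\<And>\<delta>. \<delta> > 0 \<Longrightarrow> z x \<le> M + \<delta> * x\<close>[of "\<eta> / x"] by (cases "x = 0") auto
  thus ?thesis using field_le_epsilon by blast
qed

lemma deriv2_on_neg: "deriv2_on D z z1 z2 \<Longrightarrow> deriv2_on D (\<lambda>x. - z x) (\<lambda>x. - z1 x) (\<lambda>x. - z2 x)"
  by (auto simp: deriv2_on_def intro!: derivative_eq_intros)

lemma deriv2_on_diff:
  "deriv2_on D z z1 z2 \<Longrightarrow> deriv2_on D w w1 w2 \<Longrightarrow>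
   deriv2_on D (\<lambda>x. z x - w x) (\<lambda>x. z1 x - w1 x) (\<lambda>x. z2 x - w2 x)"
  by (auto simp: deriv2_on_def intro!: derivative_eq_intros)

lemma far_cond_neg: "far_cond e z z1 \<Longrightarrow> far_cond e (\<lambda>x. - z x) (\<lambda>x. - z1 x)"
  by (cases e) auto

lemma far_cond_diff:
  assumes "far_cond e z z1" "far_cond e w w1"
  shows "far_cond e (\<lambda>x. z x - w x) (\<lambda>x. z1 x - w1 x)"
proof (cases e)
  case Unbounded
  then obtain C C' where "\<forall>x\<ge>0. \<bar>z x\<bar> \<le> C" "\<forall>x\<ge>0. \<bar>w x\<bar> \<le> C'" using assms by auto
  then have "\<forall>x\<ge>0. \<bar>z x - w x\<bar> \<le> C + C'" by (smt (verit))
  then show ?thesis using Unbounded by auto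
qed (use assms in auto)

lemma min_principle:
  assumes "deriv2_on (domain e) z z1 z2" "z 0 \<ge> M" "far_cond e z z1"
    and "\<And>x. x \<in> domain e \<Longrightarrow> 0 < x \<Longrightarrow> z x < M \<Longrightarrow> z2 x < 0"
    and "x \<in> domain e"
  shows "z x \<ge> M"
  using max_principle[OF deriv2_on_neg[OF assms(1)], of "-M"] far_cond_neg[OF assms(3)] assms by force

lemma abs_max_principle:
  assumes "deriv2_on (domain e) z z1 z2" "\<bar>z 0\<bar> \<le> M" "far_cond e z z1"
    and "\<And>x. x \<in> domain e \<Longrightarrow> 0 < x \<Longrightarrow> z x > M \<Longrightarrow> z2 x > 0"
    and "\<And>x. x \<in> domain e \<Longrightarrow> 0 < x \<Longrightarrow> z x < - M \<Longrightarrow> z2 x < 0"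
    and "x \<in> domain e"
  shows "\<bar>z x\<bar> \<le> M"
  using max_principle[OF assms(1), of M] min_principle[OF assms(1), of "-M"] assms by (simp add: abs_le_iff) (meson minus_le_iff)

section \<open>The scalar linear problem\<close>

text \<open>Adding \<open>C / k * exp (- k * x)\<close> to \<open>G\<close> gives a decreasing function and subtracting it an increasing
  one, so the limit of \<open>G\<close> is squeezed between them.\<close>

lemma bounded_antiderivative_limit:
  fixes G :: "real \<Rightarrow> real"
  assumes G: "\<And>x. (G has_real_derivative exp (- k * x) * g x) (at x)"
    and g: "\<And>x. \<bar>g x\<bar> \<le> C" and k: "k > 0"
  obtains J where "\<And>x. x \<ge> 0 \<Longrightarrow> \<bar>J - G x\<bar> \<le> C / k * exp (- k * x)"
proof -
  define l where "l = (\<lambda>x. G x - C / k * exp (- k * x))"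
  define r where "r = (\<lambda>x. G x + C / k * exp (- k * x))"
  have C: "C \<ge> 0" using g[of 0] by auto
  have dl: "(l has_real_derivative exp (- k * x) * (g x + C)) (at x)" for x
    unfolding l_def using G[of x] k by (auto intro!: derivative_eq_intros simp: field_simps)
  have dr: "(r has_real_derivative exp (- k * x) * (g x - C)) (at x)" for x
    unfolding r_def using G[of x] k by (auto intro!: derivative_eq_intros simp: field_simps)
  have ml: "l x \<le> l y" if "x \<le> y" for x y
  proof (rule DERIV_nonneg_imp_nondecreasing[OF that])
    fix t show "\<exists>D. (l has_real_derivative D) (at t) \<and> 0 \<le> D"
      using dl[of t] g[of t] by (intro exI conjI) (auto simp: abs_le_iff)
  qed
  have mr: "r y \<le> r x" if "x \<le> y" for x y
  proof (rule DERIV_nonpos_imp_nonincreasing[OF that])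
    fix t show "\<exists>D. (r has_real_derivative D) (at t) \<and> D \<le> 0"
      using dr[of t] g[of t] by (intro exI conjI) (auto simp: abs_le_iff mult_le_0_iff)
  qed
  have lr: "l x \<le> r y" for x y
  proof -
    have "l (max x y) \<le> r (max x y)" using C k by (simp add: l_def r_def)
    thus ?thesis using ml[of x "max x y"] mr[of y "max x y"] by simp
  qed
  define J where "J = Sup (range l)"
  have "l x \<le> J" for x unfolding J_def by (rule cSup_upper) (auto intro!: bdd_aboveI lr)
  moreover have "J \<le> r x" for x unfolding J_def by (rule cSup_least) (auto intro!: lr)
  ultimately have "\<bar>J - G x\<bar> \<le> C / k * exp (- k * x)" for x
    by (smt (verit) l_def r_def)
  thus ?thesis using that by blast
qed

text \<open>Of the two free constants in the general solution one is fixed by the value at \<open>0\<close> and the other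
  by the far condition: on the half line the coefficient of \<open>exp (k * x)\<close> has to cancel the limit of
  the integral \<open>P\<close> that multiplies the same exponential.\<close>

lemma linear_problem_solution:
  assumes k: "\<kappa> > 0" and g: "continuous_on UNIV g" "\<And>x. \<bar>g x\<bar> \<le> C"
  shows "\<exists>z z1. deriv2_on UNIV z z1 (\<lambda>x. \<kappa> * z x + g x) \<and> z 0 = p \<and> far_cond e z z1"
proof -
  define k where "k = sqrt \<kappa>"
  have kk: "k > 0" "\<kappa> = k * k" using k by (auto simp: k_def)
  have "continuous_on UNIV (\<lambda>x. exp (- k * x) * g x)" by (intro continuous_intros g(1))
  then obtain P where P: "\<And>x. (P has_real_derivative exp (- k * x) * g x) (at x)" "P 0 = 0"
    using antiderivative_UNIV unfolding has_real_derivative_iff_has_vector_derivative by blast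
  have "continuous_on UNIV (\<lambda>x. exp (k * x) * g x)" by (intro continuous_intros g(1))
  then obtain Q where Q: "\<And>x. (Q has_real_derivative exp (k * x) * g x) (at x)" "Q 0 = 0"
    using antiderivative_UNIV unfolding has_real_derivative_iff_has_vector_derivative by blast
  \<comment> \<open>Variation of constants; \<open>A\<close> and \<open>B\<close> are free.\<close>
  define z where "z = (\<lambda>A B x. exp (k * x) * (A + P x / (2 * k)) + exp (- k * x) * (B - Q x / (2 * k)))"
  define z1 where "z1 = (\<lambda>A B x. k * exp (k * x) * (A + P x / (2 * k)) - k * exp (- k * x) * (B - Q x / (2 * k)))"
  have e1: "exp (k * x) * exp (- (k * x)) = 1" for x by (simp add: exp_minus)
  have dz: "(z A B has_real_derivative z1 A B x) (at x)" for A B x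
    unfolding z_def z1_def using kk
    by (auto intro!: derivative_eq_intros P Q)
  have dz1: "(z1 A B has_real_derivative \<kappa> * z A B x + g x) (at x)" for A B x
    unfolding z_def z1_def using kk
    by (auto intro!: derivative_eq_intros P Q) (use e1[of x] in \<open>simp_all add: field_simps\<close>)
  have z0: "z A B 0 = A + B" for A B by (simp add: z_def P Q)
  show ?thesis
  proof (cases e)
    case Unbounded
    obtain J where J: "\<And>x. x \<ge> 0 \<Longrightarrow> \<bar>J - P x\<bar> \<le> C / k * exp (- k * x)"
      using bounded_antiderivative_limit[OF P(1) g(2) kk(1)] by blast
    have C: "C \<ge> 0" using g(2)[of 0] by auto
    have Qb: "\<bar>Q x\<bar> \<le> C / k * exp (k * x)" if "x \<ge> 0" for x
    proof -
      have "C / k * exp (k * 0) - Q 0 \<le> C / k * exp (k * x) - Q x"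
      proof (rule DERIV_nonneg_imp_nondecreasing[OF that])
        fix t
        have "((\<lambda>x. C / k * exp (k * x) - Q x) has_real_derivative exp (k * t) * (C - g t)) (at t)"
          using kk by (auto intro!: derivative_eq_intros Q simp: field_simps)
        moreover have "0 \<le> exp (k * t) * (C - g t)" using g(2)[of t] by (simp add: abs_le_iff)
        ultimately show "\<exists>D. ((\<lambda>x. C / k * exp (k * x) - Q x) has_real_derivative D) (at t) \<and> 0 \<le> D" by blast
      qed
      moreover have "C / k * exp (k * 0) + Q 0 \<le> C / k * exp (k * x) + Q x"
      proof (rule DERIV_nonneg_imp_nondecreasing[OF that])
        fix t
        have "((\<lambda>x. C / k * exp (k * x) + Q x) has_real_derivative exp (k * t) * (C + g t)) (at t)"
          using kk by (auto intro!: derivative_eq_intros Q simp: field_simps)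
        moreover have "0 \<le> exp (k * t) * (C + g t)" using g(2)[of t] by (simp add: abs_le_iff)
        ultimately show "\<exists>D. ((\<lambda>x. C / k * exp (k * x) + Q x) has_real_derivative D) (at t) \<and> 0 \<le> D" by blast
      qed
      moreover have "C / k \<ge> 0" using C kk by simp
      ultimately show ?thesis using Q(2) by (simp add: abs_le_iff)
    qed
    define A where "A = - J / (2 * k)"
    define B where "B = p - A"
    have "\<bar>z A B x\<bar> \<le> C / (2 * k * k) + \<bar>B\<bar> + C / (2 * k * k)" if x: "x \<ge> 0" for x
    proof -
      have "\<bar>exp (k * x) * (A + P x / (2 * k))\<bar> = exp (k * x) * (\<bar>J - P x\<bar> / (2 * k))"
      proof -
        have "A + P x / (2 * k) = - ((J - P x) / (2 * k))" using kk by (simp add: A_def diff_divide_distrib)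
        thus ?thesis using kk by (simp add: abs_mult)
      qed
      also have "\<dots> \<le> exp (k * x) * (C / k * exp (- k * x) / (2 * k))"
        using J[OF x] kk by (intro mult_left_mono divide_right_mono) auto
      also have "\<dots> = C / (2 * k * k)" using e1[of x] kk by (simp add: field_simps)
      finally have 1: "\<bar>exp (k * x) * (A + P x / (2 * k))\<bar> \<le> C / (2 * k * k)" .
      have "\<bar>exp (- k * x) * (B - Q x / (2 * k))\<bar> \<le> exp (- k * x) * \<bar>B\<bar> + exp (- k * x) * (\<bar>Q x\<bar> / (2 * k))"
        unfolding abs_mult abs_exp_cancel distrib_left[symmetric]
        using abs_triangle_ineq4[of B "Q x / (2 * k)"] kk by (intro mult_left_mono) auto
      also have "exp (- k * x) * \<bar>B\<bar> \<le> \<bar>B\<bar>" using x kk by (simp add: mult_left_le_one_le)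
      also have "exp (- k * x) * (\<bar>Q x\<bar> / (2 * k)) \<le> exp (- k * x) * (C / k * exp (k * x) / (2 * k))"
        using Qb[OF x] kk by (intro mult_left_mono divide_right_mono) auto
      also have "\<dots> = C / (2 * k * k)" using e1[of x] kk by (simp add: field_simps)
      finally have 2: "\<bar>exp (- k * x) * (B - Q x / (2 * k))\<bar> \<le> \<bar>B\<bar> + C / (2 * k * k)" by simp
      show ?thesis unfolding z_def by (rule order_trans[OF abs_triangle_ineq]) (use 1 2 in linarith)
    qed
    hence "far_cond e (z A B) (z1 A B)" using Unbounded by auto
    moreover have "z A B 0 = p" by (simp add: z0 B_def)
    ultimately show ?thesis using dz dz1 unfolding deriv2_on_def by blast
  next
    case Reflecting
    define a where "a = k * exp k * (P 1 / (2 * k)) + k * exp (- k) * (Q 1 / (2 * k))"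
    define s where "s = k * (exp k + exp (- k))"
    have s: "s > 0" using kk by (simp add: s_def add_pos_pos)
    define A where "A = (k * exp (- k) * p - a) / s"
    define B where "B = p - A"
    have "z1 A B 1 = A * s + a - k * exp (- k) * p"
      by (simp add: z1_def B_def a_def s_def algebra_simps)
    also have "\<dots> = 0" using s by (simp add: A_def)
    finally have "far_cond e (z A B) (z1 A B)" using Reflecting by simp
    moreover have "z A B 0 = p" by (simp add: z0 B_def)
    ultimately show ?thesis using dz dz1 unfolding deriv2_on_def by blast
  qed
qed

text \<open>Where \<open>z\<close> exceeds \<open>C\<close> in modulus, the term \<open>\<kappa> * z\<close> decides the sign of the second derivative. The bound
  does not depend on \<open>\<kappa>\<close>, and this makes the contraction below uniform in the stiffness of the
  equation.\<close>

lemma linear_problem_bound: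
  assumes k: "\<kappa> > 0" and d: "deriv2_on (domain e) z z1 (\<lambda>x. \<kappa> * z x + g x)"
    and z: "z 0 = 0" "far_cond e z z1" and g: "\<And>x. x \<in> domain e \<Longrightarrow> \<bar>g x\<bar> \<le> \<kappa> * C" and x: "x \<in> domain e"
  shows "\<bar>z x\<bar> \<le> C"
proof (rule abs_max_principle[OF d _ z(2) _ _ x])
  have "0 \<le> \<kappa> * C" using g[OF x] by linarith
  thus "\<bar>z 0\<bar> \<le> C" using z k by (simp add: zero_le_mult_iff)
  fix y assume y: "y \<in> domain e"
  show "\<kappa> * z y + g y > 0" if "z y > C"
    using that g[OF y] k mult_strict_left_mono[OF that k] by linarith
  show "\<kappa> * z y + g y < 0" if "z y < - C"
    using that g[OF y] k mult_strict_left_mono[OF that k] by (simp add: abs_le_iff)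
qed

section \<open>Existence for the half problems\<close>

text \<open>Composing with this retraction represents functions on the domain by bounded continuous functions
  on the whole line.\<close>

fun proj :: "far_end \<Rightarrow> real \<Rightarrow> real" where
  "proj Unbounded x = max 0 x"
| "proj Reflecting x = max 0 (min 1 x)"

lemma proj_in: "proj e x \<in> domain e"
  by (cases e) auto

lemma proj_id: "x \<in> domain e \<Longrightarrow> proj e x = x"
  by (cases e) auto

lemma continuous_on_proj: "continuous_on S (proj e)"
  by (cases e) (auto intro!: continuous_intros)

lemma deriv2_on_cong:
  "deriv2_on D z z1 z2 \<Longrightarrow> (\<And>x. x \<in> D \<Longrightarrow> z2 x = z2' x) \<Longrightarrow> deriv2_on D z z1 z2'"
  by (simp add: deriv2_on_def)

lemma far_cond_bounded:
  assumes d: "deriv2_on (domain e) z z1 z2" and far: "far_cond e z z1"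
  shows "\<exists>C. \<forall>x\<in>domain e. \<bar>z x\<bar> \<le> C"
proof (cases e)
  case Reflecting
  have "continuous_on {0..1} z"
    using d Reflecting by (intro continuous_at_imp_continuous_on ballI DERIV_isCont) (auto simp: deriv2_on_def)
  hence "bounded (z ` {0..1})" by (intro compact_imp_bounded compact_continuous_image) auto
  thus ?thesis using Reflecting by (auto simp: bounded_iff)
qed (use far in auto)

lemma far_cond_bcontfun:
  assumes d: "deriv2_on UNIV z z1 z2" and far: "far_cond e z z1"
  shows "(\<lambda>x. z (proj e x)) \<in> bcontfun"
proof -
  have "continuous_on UNIV z"
    using d by (intro continuous_at_imp_continuous_on ballI DERIV_isCont) (auto simp: deriv2_on_def)
  hence "continuous_on UNIV (\<lambda>x. z (proj e x))"
    by (rule continuous_on_compose2) (auto intro: continuous_on_proj)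
  moreover obtain C where "\<forall>x\<in>domain e. \<bar>z x\<bar> \<le> C"
    using far_cond_bounded[of e z z1 z2] d far by (auto simp: deriv2_on_def)
  hence "bounded (range (\<lambda>x. z (proj e x)))" by (auto simp: bounded_iff intro!: exI[of _ C] proj_in)
  ultimately show ?thesis by (simp add: bcontfun_def)
qed

lemma lipschitz_continuous_real:
  fixes n :: "real \<Rightarrow> real"
  assumes "\<And>x y. \<bar>n x - n y\<bar> \<le> L * \<bar>x - y\<bar>"
  shows "continuous_on S n"
proof (rule continuous_on_subset[OF _ subset_UNIV])
  have "L * 1 \<ge> 0" using assms[of 1 0] by (simp add: order_trans[OF abs_ge_zero])
  hence "L-lipschitz_on UNIV n" using assms by (intro lipschitz_onI) (auto simp: dist_real_def)
  thus "continuous_on UNIV n" by (rule lipschitz_on_continuous_on)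
qed

lemma abs_linear_combination_le:
  fixes K c X Y :: real
  assumes "0 \<le> K" "0 \<le> c"
  shows "\<bar>- K * X + c * Y\<bar> \<le> K * \<bar>X\<bar> + c * \<bar>Y\<bar>"
  using abs_triangle_ineq[of "- K * X" "c * Y"] assms by (simp add: abs_mult)

text \<open>The matrix with rows \<open>(0.34, 0.57)\<close> and \<open>(0.60, 0.018)\<close> has Euclidean norm below \<open>9/10\<close>. It bounds the
  change of the fixed point map below in its two components.\<close>

lemma contraction_matrix:
  fixes A B a c :: real
  assumes "0 \<le> A" "0 \<le> B" "0 \<le> a" "0 \<le> c" "a \<le> 34/100 * A + 57/100 * B" "c \<le> 60/100 * A + 18/1000 * B"
  shows "sqrt (a\<^sup>2 + c\<^sup>2) \<le> 9/10 * sqrt (A\<^sup>2 + B\<^sup>2)"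
proof -
  have "a\<^sup>2 \<le> (34/100 * A + 57/100 * B)\<^sup>2" "c\<^sup>2 \<le> (60/100 * A + 18/1000 * B)\<^sup>2"
    using assms by (auto intro!: power_mono)
  moreover have "81/100 * (A\<^sup>2 + B\<^sup>2) - ((34/100 * A + 57/100 * B)\<^sup>2 + (60/100 * A + 18/1000 * B)\<^sup>2) =
      2046/10000 * (A - B)\<^sup>2 + 1298/10000 * A\<^sup>2 + 280176/1000000 * B\<^sup>2"
    by (simp add: power2_eq_square field_simps)
  hence "(34/100 * A + 57/100 * B)\<^sup>2 + (60/100 * A + 18/1000 * B)\<^sup>2 \<le> 81/100 * (A\<^sup>2 + B\<^sup>2)"
    using zero_le_power2[of "A - B"] zero_le_power2[of A] zero_le_power2[of B] by linarith
  ultimately have "a\<^sup>2 + c\<^sup>2 \<le> (9/10)\<^sup>2 * (A\<^sup>2 + B\<^sup>2)" by (simp add: power2_eq_square)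
  hence "sqrt (a\<^sup>2 + c\<^sup>2) \<le> sqrt ((9/10)\<^sup>2 * (A\<^sup>2 + B\<^sup>2))" by (rule real_sqrt_le_mono)
  thus ?thesis by (simp add: real_sqrt_mult)
qed

text \<open>The activator equation has the linear part \<open>u'' = K1 * (9/20 * u + v)\<close>, in which the coupling to \<open>v\<close> is too
  strong for an iteration in \<open>(u, v)\<close> to contract. In the variables \<open>z = u + 20/9 * v\<close> and \<open>v\<close> the
  system is nearly triangular: the equation of \<open>z\<close> has the linear part \<open>9/20 * K1 * z\<close> and small
  remainders, because \<open>F\<close> stays close to the slope \<open>- 9/20\<close> and \<open>K2\<close> is small against \<open>K1\<close>; the equation
  of \<open>v\<close> becomes \<open>v'' = K2 * (20/9 * v + g v - z)\<close> with positive linear part. The factor \<open>4/3\<close> in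
  \<open>y = 4/3 * v\<close> balances the two off-diagonal entries of the resulting contraction matrix.\<close>

theorem half_problem_exists:
  fixes F g :: "real \<Rightarrow> real"
  assumes K: "0 < K2" "1000 * K2 \<le> K1"
    and F: "\<And>x y. \<bar>(F x + 9/20 * x) - (F y + 9/20 * y)\<bar> \<le> 3/20 * \<bar>x - y\<bar>"
    and g: "\<And>x y. \<bar>g x - g y\<bar> \<le> 1/25 * \<bar>x - y\<bar>"
  shows "\<exists>u u1 v v1. deriv2_on (domain e) u u1 (\<lambda>x. K1 * (v x - F (u x))) \<and>
           deriv2_on (domain e) v v1 (\<lambda>x. K2 * (g (v x) - u x)) \<and>
           u 0 = p \<and> v 0 = q \<and> far_cond e u u1 \<and> far_cond e v v1"
proof -
  define n where "n = (\<lambda>x. F x + 9/20 * x)"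
  \<comment> \<open>With \<open>v = 3/4 * y\<close> and \<open>u = z - 5/3 * y\<close> the system reads \<open>z'' = 9/20 * K1 * z + hz z y\<close> and
    \<open>y'' = 20/9 * K2 * y + hy z y\<close>.\<close>
  define hz where "hz = (\<lambda>z y. - K1 * n (z - 5/3 * y) + 20/9 * K2 * (g (3/4 * y) - (z - 5/3 * y)))"
  define hy where "hy = (\<lambda>z y. 4/3 * K2 * (g (3/4 * y) - z))"
  have K1: "K1 > 0" using K by linarith
  have n: "\<bar>n x - n y\<bar> \<le> 3/20 * \<bar>x - y\<bar>" for x y using F by (simp add: n_def)
  have hz: "\<bar>hz z y - hz z' y'\<bar> \<le> 9/20 * K1 * (34/100 * \<bar>z - z'\<bar> + 57/100 * \<bar>y - y'\<bar>)" for z y z' y'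
  proof -
    let ?A = "\<bar>z - z'\<bar>" and ?B = "\<bar>y - y'\<bar>"
    have tri: "\<bar>(z - 5/3 * y) - (z' - 5/3 * y')\<bar> \<le> ?A + 5/3 * ?B"
    proof -
      have "(z - 5/3 * y) - (z' - 5/3 * y') = (z - z') - 5/3 * (y - y')" by (simp add: field_simps)
      moreover have "\<bar>5/3 * (y - y')\<bar> = 5/3 * ?B" by (simp only: abs_mult)
      ultimately show ?thesis using abs_triangle_ineq4[of "z - z'" "5/3 * (y - y')"] by linarith
    qed
    have "\<bar>n (z - 5/3 * y) - n (z' - 5/3 * y')\<bar> \<le> 3/20 * (?A + 5/3 * ?B)"
      by (rule order_trans[OF n]) (use tri in simp)
    hence 1: "K1 * \<bar>n (z - 5/3 * y) - n (z' - 5/3 * y')\<bar> \<le> K1 * (3/20 * (?A + 5/3 * ?B))"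
      using K1 by (intro mult_left_mono) auto
    have "\<bar>g (3/4 * y) - g (3/4 * y')\<bar> \<le> 1/25 * (3/4 * ?B)"
      by (rule order_trans[OF g]) (auto simp: abs_if)
    hence "\<bar>(g (3/4 * y) - (z - 5/3 * y)) - (g (3/4 * y') - (z' - 5/3 * y'))\<bar> \<le> ?A + 17/10 * ?B"
      using tri by linarith
    hence 2: "20/9 * K2 * \<bar>(g (3/4 * y) - (z - 5/3 * y)) - (g (3/4 * y') - (z' - 5/3 * y'))\<bar>
        \<le> 20/9 * (K1 / 1000) * (?A + 17/10 * ?B)"
      using K K1 by (intro mult_mono) auto
    have "hz z y - hz z' y' = - K1 * (n (z - 5/3 * y) - n (z' - 5/3 * y')) +
        20/9 * K2 * ((g (3/4 * y) - (z - 5/3 * y)) - (g (3/4 * y') - (z' - 5/3 * y')))"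
      by (simp add: hz_def algebra_simps)
    hence "\<bar>hz z y - hz z' y'\<bar> \<le> K1 * \<bar>n (z - 5/3 * y) - n (z' - 5/3 * y')\<bar> +
        20/9 * K2 * \<bar>(g (3/4 * y) - (z - 5/3 * y)) - (g (3/4 * y') - (z' - 5/3 * y'))\<bar>"
      using abs_linear_combination_le[of K1 "20/9 * K2"] K K1 by simp
    also have "\<dots> \<le> K1 * (3/20 * (?A + 5/3 * ?B)) + 20/9 * (K1 / 1000) * (?A + 17/10 * ?B)"
      using 1 2 by linarith
    also have "\<dots> = K1 * (3/20 * (?A + 5/3 * ?B) + 20/9000 * (?A + 17/10 * ?B))" by (simp add: algebra_simps)
    finally have fin: "\<bar>hz z y - hz z' y'\<bar> \<le> K1 * (3/20 * (?A + 5/3 * ?B) + 20/9000 * (?A + 17/10 * ?B))" .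
    have "3/20 * (A + 5/3 * B) + 20/9000 * (A + 17/10 * B) \<le> 9/20 * (34/100 * A + 57/100 * B)"
      if "A \<ge> 0" "B \<ge> 0" for A B :: real using that by (simp add: field_simps)
    from mult_left_mono[OF this[of ?A ?B], of K1]
    have "K1 * (3/20 * (?A + 5/3 * ?B) + 20/9000 * (?A + 17/10 * ?B)) \<le> K1 * (9/20 * (34/100 * ?A + 57/100 * ?B))"
      using K1 by simp
    with fin show ?thesis by (simp add: field_simps)
  qed
  have hy: "\<bar>hy z y - hy z' y'\<bar> \<le> 20/9 * K2 * (60/100 * \<bar>z - z'\<bar> + 18/1000 * \<bar>y - y'\<bar>)" for z y z' y'
  proof -
    have "\<bar>g (3/4 * y) - g (3/4 * y')\<bar> \<le> 1/25 * (3/4 * \<bar>y - y'\<bar>)"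
      by (rule order_trans[OF g]) (auto simp: abs_if)
    moreover have "\<bar>(g (3/4 * y) - z) - (g (3/4 * y') - z')\<bar> = \<bar>(g (3/4 * y) - g (3/4 * y')) - (z - z')\<bar>"
      by (simp add: algebra_simps)
    ultimately have "\<bar>(g (3/4 * y) - z) - (g (3/4 * y') - z')\<bar> \<le> 5/3 * (60/100 * \<bar>z - z'\<bar> + 18/1000 * \<bar>y - y'\<bar>)"
      using abs_triangle_ineq4[of "g (3/4 * y) - g (3/4 * y')" "z - z'"]
      by (simp only:) (simp add: field_simps)
    hence "4/3 * K2 * \<bar>(g (3/4 * y) - z) - (g (3/4 * y') - z')\<bar> \<le> 4/3 * K2 * (5/3 * (60/100 * \<bar>z - z'\<bar> + 18/1000 * \<bar>y - y'\<bar>))"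
      using K by (intro mult_left_mono) auto
    moreover have "hy z y - hy z' y' = 4/3 * K2 * ((g (3/4 * y) - z) - (g (3/4 * y') - z'))"
      by (simp add: hy_def algebra_simps)
    hence "\<bar>hy z y - hy z' y'\<bar> = 4/3 * K2 * \<bar>(g (3/4 * y) - z) - (g (3/4 * y') - z')\<bar>"
      using K by (simp only: abs_mult)
    ultimately show ?thesis by (simp only:)
  qed
  have cn: "continuous_on S n" for S by (rule lipschitz_continuous_real[OF n])
  have cg: "continuous_on S g" for S by (rule lipschitz_continuous_real[OF g])
  have forcing: "continuous_on UNIV (\<lambda>x. h (apply_bcontfun Z x) (apply_bcontfun Y x)) \<and>
      (\<exists>C. \<forall>x. \<bar>h (apply_bcontfun Z x) (apply_bcontfun Y x)\<bar> \<le> C)"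
    if h: "\<And>z y z' y'. \<bar>h z y - h z' y'\<bar> \<le> L * (L1 * \<bar>z - z'\<bar> + L2 * \<bar>y - y'\<bar>)"
      and L: "L \<ge> 0" "L1 \<ge> 0" "L2 \<ge> 0" and ch: "continuous_on UNIV (\<lambda>x. h (apply_bcontfun Z x) (apply_bcontfun Y x))"
    for h L L1 L2 and Z Y :: "real \<Rightarrow>\<^sub>C real"
  proof (rule conjI)
    obtain a where a: "\<And>x. \<bar>Z x\<bar> \<le> a" using bounded_apply_bcontfun[of Z] by (auto simp: bounded_iff)
    obtain b where b: "\<And>x. \<bar>Y x\<bar> \<le> b" using bounded_apply_bcontfun[of Y] by (auto simp: bounded_iff)
    have "\<bar>h (Z x) (Y x)\<bar> \<le> \<bar>h 0 0\<bar> + L * (L1 * a + L2 * b)" for x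
    proof -
      have "L * (L1 * \<bar>Z x - 0\<bar> + L2 * \<bar>Y x - 0\<bar>) \<le> L * (L1 * a + L2 * b)"
        using a[of x] b[of x] L by (intro mult_left_mono add_mono) auto
      thus ?thesis using h[of "Z x" "Y x" 0 0] by linarith
    qed
    thus "\<exists>C. \<forall>x. \<bar>h (apply_bcontfun Z x) (apply_bcontfun Y x)\<bar> \<le> C" by blast
  qed (rule ch)
  have solz: "\<exists>z z1. deriv2_on UNIV z z1 (\<lambda>x. 9/20 * K1 * z x + hz (Z x) (Y x)) \<and>
      z 0 = p + 20/9 * q \<and> far_cond e z z1" for Z Y :: "real \<Rightarrow>\<^sub>C real"
  proof -
    have c: "continuous_on UNIV (\<lambda>x. hz (apply_bcontfun Z x) (apply_bcontfun Y x))"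
      unfolding hz_def by (intro continuous_intros continuous_on_compose2[OF cn[of UNIV]] continuous_on_compose2[OF cg[of UNIV]]) auto
    obtain C where C: "\<And>x. \<bar>hz (apply_bcontfun Z x) (apply_bcontfun Y x)\<bar> \<le> C"
      using forcing[OF hz _ _ _ c] K1 by auto
    show ?thesis by (rule linear_problem_solution[OF _ c C]) (use K1 in simp)
  qed
  have soly: "\<exists>z z1. deriv2_on UNIV z z1 (\<lambda>x. 20/9 * K2 * z x + hy (Z x) (Y x)) \<and>
      z 0 = 4/3 * q \<and> far_cond e z z1" for Z Y :: "real \<Rightarrow>\<^sub>C real"
  proof -
    have c: "continuous_on UNIV (\<lambda>x. hy (apply_bcontfun Z x) (apply_bcontfun Y x))"
      unfolding hy_def by (intro continuous_intros continuous_on_compose2[OF cg[of UNIV]]) auto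
    obtain C where C: "\<And>x. \<bar>hy (apply_bcontfun Z x) (apply_bcontfun Y x)\<bar> \<le> C"
      using forcing[OF hy _ _ _ c] K by auto
    show ?thesis by (rule linear_problem_solution[OF _ c C]) (use K in simp)
  qed
  define Pz where "Pz = (\<lambda>Z Y zz. deriv2_on UNIV (fst zz) (snd zz) (\<lambda>x. 9/20 * K1 * fst zz x + hz (apply_bcontfun Z x) (apply_bcontfun Y x)) \<and>
      fst zz 0 = p + 20/9 * q \<and> far_cond e (fst zz) (snd zz))"
  define sz where "sz = (\<lambda>Z Y. fst (SOME zz. Pz Z Y zz))"
  define sz1 where "sz1 = (\<lambda>Z Y. snd (SOME zz. Pz Z Y zz))"
  have "Pz Z Y (SOME zz. Pz Z Y zz)" for Z Y
    using solz[of Z Y] by (intro someI_ex[of "Pz Z Y"]) (auto simp: Pz_def)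
  hence sz: "deriv2_on UNIV (sz Z Y) (sz1 Z Y) (\<lambda>x. 9/20 * K1 * sz Z Y x + hz (apply_bcontfun Z x) (apply_bcontfun Y x))"
      "sz Z Y 0 = p + 20/9 * q" "far_cond e (sz Z Y) (sz1 Z Y)" for Z Y
    unfolding Pz_def sz_def sz1_def by blast+
  define Py where "Py = (\<lambda>Z Y zz. deriv2_on UNIV (fst zz) (snd zz) (\<lambda>x. 20/9 * K2 * fst zz x + hy (apply_bcontfun Z x) (apply_bcontfun Y x)) \<and>
      fst zz 0 = 4/3 * q \<and> far_cond e (fst zz) (snd zz))"
  define sy where "sy = (\<lambda>Z Y. fst (SOME zz. Py Z Y zz))"
  define sy1 where "sy1 = (\<lambda>Z Y. snd (SOME zz. Py Z Y zz))"
  have "Py Z Y (SOME zz. Py Z Y zz)" for Z Y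
    using soly[of Z Y] by (intro someI_ex[of "Py Z Y"]) (auto simp: Py_def)
  hence sy: "deriv2_on UNIV (sy Z Y) (sy1 Z Y) (\<lambda>x. 20/9 * K2 * sy Z Y x + hy (apply_bcontfun Z x) (apply_bcontfun Y x))"
      "sy Z Y 0 = 4/3 * q" "far_cond e (sy Z Y) (sy1 Z Y)" for Z Y
    unfolding Py_def sy_def sy1_def by blast+
  define T where "T = (\<lambda>(Z, Y). (Bcontfun (\<lambda>x. sz Z Y (proj e x)), Bcontfun (\<lambda>x. sy Z Y (proj e x))))"
  have apz: "apply_bcontfun (Bcontfun (\<lambda>x. sz Z Y (proj e x))) = (\<lambda>x. sz Z Y (proj e x))" for Z Y
    by (rule Bcontfun_inverse[OF far_cond_bcontfun[OF sz(1,3)]])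
  have apy: "apply_bcontfun (Bcontfun (\<lambda>x. sy Z Y (proj e x))) = (\<lambda>x. sy Z Y (proj e x))" for Z Y
    by (rule Bcontfun_inverse[OF far_cond_bcontfun[OF sy(1,3)]])
  have sub: "deriv2_on UNIV a b c \<Longrightarrow> deriv2_on (domain e) a b c" for a b c by (auto simp: deriv2_on_def)
  have lip: "dist (T P) (T P') \<le> 9/10 * dist P P'" for P P'
  proof (cases P; cases P')
    fix Z Y Z' Y' assume P: "P = (Z, Y)" "P' = (Z', Y')"
    have dZ: "\<bar>Z x - Z' x\<bar> \<le> dist Z Z'" for x using dist_bounded[of Z x Z'] by (simp add: dist_real_def)
    have dY: "\<bar>Y x - Y' x\<bar> \<le> dist Y Y'" for x using dist_bounded[of Y x Y'] by (simp add: dist_real_def)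
    have 1: "\<bar>sz Z Y x - sz Z' Y' x\<bar> \<le> 34/100 * dist Z Z' + 57/100 * dist Y Y'" if x: "x \<in> domain e" for x
    proof (rule linear_problem_bound[where \<kappa>="9/20 * K1" and g="\<lambda>x. hz (Z x) (Y x) - hz (Z' x) (Y' x)"
          and z="\<lambda>x. sz Z Y x - sz Z' Y' x"])
      show "deriv2_on (domain e) (\<lambda>x. sz Z Y x - sz Z' Y' x) (\<lambda>x. sz1 Z Y x - sz1 Z' Y' x)
          (\<lambda>x. 9/20 * K1 * (sz Z Y x - sz Z' Y' x) + (hz (Z x) (Y x) - hz (Z' x) (Y' x)))"
        by (rule deriv2_on_cong[OF deriv2_on_diff[OF sub[OF sz(1)[of Z Y]] sub[OF sz(1)[of Z' Y']]]]) (simp add: field_simps)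
      show "far_cond e (\<lambda>x. sz Z Y x - sz Z' Y' x) (\<lambda>x. sz1 Z Y x - sz1 Z' Y' x)"
        by (intro far_cond_diff sz)
      fix x assume "x \<in> domain e"
      have "9/20 * K1 * (34/100 * \<bar>Z x - Z' x\<bar> + 57/100 * \<bar>Y x - Y' x\<bar>) \<le> 9/20 * K1 * (34/100 * dist Z Z' + 57/100 * dist Y Y')"
        using K1 dZ[of x] dY[of x] by (intro mult_left_mono) auto
      thus "\<bar>hz (Z x) (Y x) - hz (Z' x) (Y' x)\<bar> \<le> 9/20 * K1 * (34/100 * dist Z Z' + 57/100 * dist Y Y')"
        using hz[of "Z x" "Y x" "Z' x" "Y' x"] by linarith
    qed (use K1 sz(2)[of Z Y] sz(2)[of Z' Y'] x in auto)
    have 2: "\<bar>sy Z Y x - sy Z' Y' x\<bar> \<le> 60/100 * dist Z Z' + 18/1000 * dist Y Y'" if x: "x \<in> domain e" for x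
    proof (rule linear_problem_bound[where \<kappa>="20/9 * K2" and g="\<lambda>x. hy (Z x) (Y x) - hy (Z' x) (Y' x)"
          and z="\<lambda>x. sy Z Y x - sy Z' Y' x"])
      show "deriv2_on (domain e) (\<lambda>x. sy Z Y x - sy Z' Y' x) (\<lambda>x. sy1 Z Y x - sy1 Z' Y' x)
          (\<lambda>x. 20/9 * K2 * (sy Z Y x - sy Z' Y' x) + (hy (Z x) (Y x) - hy (Z' x) (Y' x)))"
        by (rule deriv2_on_cong[OF deriv2_on_diff[OF sub[OF sy(1)[of Z Y]] sub[OF sy(1)[of Z' Y']]]]) (simp add: field_simps)
      show "far_cond e (\<lambda>x. sy Z Y x - sy Z' Y' x) (\<lambda>x. sy1 Z Y x - sy1 Z' Y' x)"
        by (intro far_cond_diff sy)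
      fix x assume "x \<in> domain e"
      have "20/9 * K2 * (60/100 * \<bar>Z x - Z' x\<bar> + 18/1000 * \<bar>Y x - Y' x\<bar>) \<le> 20/9 * K2 * (60/100 * dist Z Z' + 18/1000 * dist Y Y')"
        using K dZ[of x] dY[of x] by (intro mult_left_mono) auto
      thus "\<bar>hy (Z x) (Y x) - hy (Z' x) (Y' x)\<bar> \<le> 20/9 * K2 * (60/100 * dist Z Z' + 18/1000 * dist Y Y')"
        using hy[of "Z x" "Y x" "Z' x" "Y' x"] by linarith
    qed (use K sy(2)[of Z Y] sy(2)[of Z' Y'] x in auto)
    have "dist (fst (T P)) (fst (T P')) \<le> 34/100 * dist Z Z' + 57/100 * dist Y Y'"
      by (rule dist_bound) (simp only: T_def P apz dist_real_def fst_conv prod.case 1[OF proj_in])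
    moreover have "dist (snd (T P)) (snd (T P')) \<le> 60/100 * dist Z Z' + 18/1000 * dist Y Y'"
      by (rule dist_bound) (simp only: T_def P apy dist_real_def snd_conv prod.case 2[OF proj_in])
    ultimately show ?thesis unfolding dist_prod_def
      by (intro contraction_matrix) (auto simp: P)
  qed
  obtain Z Y where fp: "T (Z, Y) = (Z, Y)"
  proof -
    have "\<exists>!P. T P = P" by (rule banach_fix_type[of "9/10"]) (use lip in auto)
    thus ?thesis using that by (metis surj_pair)
  qed
  define z where "z = sz Z Y"
  define y where "y = sy Z Y"
  have Zx: "apply_bcontfun Z x = z x" "apply_bcontfun Y x = y x" if "x \<in> domain e" for x
    using fp proj_id[OF that] apz[of Z Y] apy[of Z Y] unfolding T_def z_def y_def
    by (auto dest!: arg_cong[of _ _ "\<lambda>f. apply_bcontfun f x"])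
  have dz: "(z has_real_derivative sz1 Z Y x) (at x)"
      "(sz1 Z Y has_real_derivative 9/20 * K1 * z x + hz (z x) (y x)) (at x)"
      "(y has_real_derivative sy1 Z Y x) (at x)"
      "(sy1 Z Y has_real_derivative 20/9 * K2 * y x + hy (z x) (y x)) (at x)" if "x \<in> domain e" for x
    using sz(1)[of Z Y, unfolded deriv2_on_def, rule_format, of x]
      sy(1)[of Z Y, unfolded deriv2_on_def, rule_format, of x]
    unfolding Zx[OF that] z_def[symmetric] y_def[symmetric] by simp_all
  define u where "u = (\<lambda>x. z x - 5/3 * y x)"
  define v where "v = (\<lambda>x. 3/4 * y x)"
  define u1 where "u1 = (\<lambda>x. sz1 Z Y x - 5/3 * sy1 Z Y x)"
  define v1 where "v1 = (\<lambda>x. 3/4 * sy1 Z Y x)"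
  have "deriv2_on (domain e) u u1 (\<lambda>x. K1 * (v x - F (u x)))"
    unfolding deriv2_on_def u_def u1_def
    by (auto intro!: derivative_eq_intros dz simp: hz_def hy_def n_def v_def field_simps)
  moreover have "deriv2_on (domain e) v v1 (\<lambda>x. K2 * (g (v x) - u x))"
    unfolding deriv2_on_def v_def v1_def
    by (auto intro!: derivative_eq_intros dz simp: hy_def u_def field_simps)
  moreover have "far_cond e y (sy1 Z Y)" "far_cond e z (sz1 Z Y)" using sy(3) sz(3) by (auto simp: z_def y_def)
  hence "far_cond e u u1 \<and> far_cond e v v1"
  proof (cases e)
    case Unbounded
    with \<open>far_cond e y (sy1 Z Y)\<close> \<open>far_cond e z (sz1 Z Y)\<close>
    obtain C C' where C: "\<And>x. x \<ge> 0 \<Longrightarrow> \<bar>y x\<bar> \<le> C" "\<And>x. x \<ge> 0 \<Longrightarrow> \<bar>z x\<bar> \<le> C'" by auto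
    have "\<bar>u x\<bar> \<le> C' + 5/3 * C" "\<bar>v x\<bar> \<le> 3/4 * C" if "x \<ge> 0" for x
      using C[OF that] by (auto simp: u_def v_def abs_if split: if_splits)
    hence "\<exists>C. \<forall>x\<ge>0. \<bar>u x\<bar> \<le> C" "\<exists>C. \<forall>x\<ge>0. \<bar>v x\<bar> \<le> C" by blast+
    thus ?thesis using Unbounded by simp
  qed (auto simp: u1_def v1_def)
  moreover have "u 0 = p" "v 0 = q" by (auto simp: u_def v_def z_def y_def sz sy)
  ultimately show ?thesis by blast
qed

section \<open>The energy of a difference\<close>

text \<open>With these weights the coupling terms \<open>K1 * v\<close> and \<open>- K2 * u\<close> of the two equations cancel in the second
  derivative, so that only the monotonicity of \<open>F\<close> and \<open>g\<close> remains.\<close>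

definition energy :: "real \<Rightarrow> real \<Rightarrow> (real \<Rightarrow> real) \<Rightarrow> (real \<Rightarrow> real) \<Rightarrow> real \<Rightarrow> real" where
  "energy K1 K2 U V x = (V x)\<^sup>2 / K2 + (U x)\<^sup>2 / K1"

lemma deriv2_on_energy:
  assumes "deriv2_on D U U1 U2" "deriv2_on D V V1 V2"
  shows "deriv2_on D (energy K1 K2 U V) (\<lambda>x. 2 * (V x * V1 x / K2 + U x * U1 x / K1))
    (\<lambda>x. 2 * ((V1 x)\<^sup>2 / K2 + (U1 x)\<^sup>2 / K1 + (V x * V2 x / K2 + U x * U2 x / K1)))"
proof -
  have d: "((\<lambda>x. (V x)\<^sup>2 * c + (U x)\<^sup>2 * d) has_real_derivative 2 * (V x * V1 x * c + U x * U1 x * d)) (at x)"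
    "((\<lambda>x. 2 * (V x * V1 x * c + U x * U1 x * d)) has_real_derivative
      2 * ((V1 x)\<^sup>2 * c + (U1 x)\<^sup>2 * d + (V x * V2 x * c + U x * U2 x * d))) (at x)"
    if "x \<in> D" for x c d
    using assms that unfolding deriv2_on_def
    by (auto intro!: derivative_eq_intros simp: algebra_simps power2_eq_square)
  show ?thesis using d[of _ "1 / K2" "1 / K1"] by (auto simp: deriv2_on_def energy_def[abs_def])
qed

lemma far_cond_energy:
  assumes "far_cond e U U1" "far_cond e V V1"
  shows "far_cond e (energy K1 K2 U V) (\<lambda>x. 2 * (V x * V1 x / K2 + U x * U1 x / K1))"
proof (cases e)
  case Unbounded
  then obtain C C' where C: "\<And>x. x \<ge> 0 \<Longrightarrow> \<bar>U x\<bar> \<le> C" "\<And>x. x \<ge> 0 \<Longrightarrow> \<bar>V x\<bar> \<le> C'" using assms by auto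
  have "\<bar>energy K1 K2 U V x\<bar> \<le> C'\<^sup>2 / \<bar>K2\<bar> + C\<^sup>2 / \<bar>K1\<bar>" if "x \<ge> 0" for x
  proof -
    have "(V x)\<^sup>2 \<le> C'\<^sup>2" "(U x)\<^sup>2 \<le> C\<^sup>2"
      using C[OF that] by (metis abs_ge_zero power2_abs power_mono)+
    hence "(V x)\<^sup>2 / \<bar>K2\<bar> \<le> C'\<^sup>2 / \<bar>K2\<bar>" "(U x)\<^sup>2 / \<bar>K1\<bar> \<le> C\<^sup>2 / \<bar>K1\<bar>"
      by (auto intro!: divide_right_mono)
    moreover have "\<bar>(V x)\<^sup>2 / K2 + (U x)\<^sup>2 / K1\<bar> \<le> (V x)\<^sup>2 / \<bar>K2\<bar> + (U x)\<^sup>2 / \<bar>K1\<bar>"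
      by (rule order_trans[OF abs_triangle_ineq]) (simp add: abs_divide)
    ultimately show ?thesis by (simp add: energy_def)
  qed
  thus ?thesis using Unbounded by auto
qed (use assms in auto)

text \<open>The primed functions solve the problem with other coefficients \<open>K1'\<close> and \<open>K2'\<close>. Seen from the unprimed
  problem this is a relative residual of size \<open>\<delta>\<close>. Monotonicity contributes \<open>2 * c * (V\<^sup>2 + U\<^sup>2)\<close> to the second
  derivative of the energy of the difference \<open>(U, V)\<close> and the residual at most
  \<open>2 * \<delta> * (\<bar>V\<bar> + \<bar>U\<bar>)\<close>, so the second derivative is positive wherever the energy exceeds the bound.\<close>

theorem difference_bound:
  fixes F g :: "real \<Rightarrow> real"
  assumes K: "0 < K2" "K2 \<le> K1" and c: "0 < c"
    and F: "\<And>x y. (F x - F y) * (x - y) \<le> - c * (x - y)\<^sup>2"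
    and g: "\<And>x y. (g x - g y) * (x - y) \<ge> c * (x - y)\<^sup>2"
    and u: "deriv2_on (domain e) u u1 (\<lambda>x. K1 * (v x - F (u x)))" "far_cond e u u1"
    and v: "deriv2_on (domain e) v v1 (\<lambda>x. K2 * (g (v x) - u x))" "far_cond e v v1"
    and u': "deriv2_on (domain e) u' u1' (\<lambda>x. K1' * (v' x - F (u' x)))" "far_cond e u' u1'"
    and v': "deriv2_on (domain e) v' v1' (\<lambda>x. K2' * (g (v' x) - u' x))" "far_cond e v' v1'"
    and r: "\<And>x. x \<in> domain e \<Longrightarrow> \<bar>K1 - K1'\<bar> * \<bar>v' x - F (u' x)\<bar> \<le> K1 * \<delta>"
      "\<And>x. x \<in> domain e \<Longrightarrow> \<bar>K2 - K2'\<bar> * \<bar>g (v' x) - u' x\<bar> \<le> K2 * \<delta>"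
    and x: "x \<in> domain e"
  shows "energy K1 K2 (\<lambda>x. u x - u' x) (\<lambda>x. v x - v' x) x \<le>
     max (energy K1 K2 (\<lambda>x. u x - u' x) (\<lambda>x. v x - v' x) 0) (2 * \<delta>\<^sup>2 / (c\<^sup>2 * K2))"
proof -
  define U where "U = (\<lambda>x. u x - u' x)"
  define V where "V = (\<lambda>x. v x - v' x)"
  define M where "M = max (energy K1 K2 U V 0) (2 * \<delta>\<^sup>2 / (c\<^sup>2 * K2))"
  note dU = deriv2_on_diff[OF u(1) u'(1), folded U_def]
  note dV = deriv2_on_diff[OF v(1) v'(1), folded V_def]
  have "energy K1 K2 U V x \<le> M"
  proof (rule max_principle[OF deriv2_on_energy[OF dU dV] _ far_cond_energy _ x])
    show "energy K1 K2 U V 0 \<le> M" by (simp add: M_def)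
    show "far_cond e U (\<lambda>x. u1 x - u1' x)" "far_cond e V (\<lambda>x. v1 x - v1' x)"
      unfolding U_def V_def by (intro far_cond_diff u v u' v')+
    fix x assume x: "x \<in> domain e" and big: "energy K1 K2 U V x > M"
    define S where "S = (V x)\<^sup>2 + (U x)\<^sup>2"
    define e1 where "e1 = (K1 - K1') * (v' x - F (u' x)) / K1"
    define e2 where "e2 = (K2 - K2') * (g (v' x) - u' x) / K2"
    have e: "\<bar>e1\<bar> \<le> \<delta>" "\<bar>e2\<bar> \<le> \<delta>" using r[OF x] K
      by (auto simp: e1_def e2_def abs_mult abs_divide pos_divide_le_eq mult.commute[of \<delta>])
    have "energy K1 K2 U V x \<le> S / K2"
      using K by (auto simp: energy_def S_def add_divide_distrib intro!: divide_left_mono)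
    with big have "2 * \<delta>\<^sup>2 / (c\<^sup>2 * K2) < S / K2" by (simp add: M_def)
    hence S: "2 * \<delta>\<^sup>2 < c\<^sup>2 * S" using K c by (simp add: field_simps)
    have "\<delta> \<ge> 0" using e by linarith
    have "S > 0" using S c by (metis le_less_trans mult_nonneg_nonneg not_numeral_less_zero zero_le_numeral zero_le_power2 zero_less_mult_pos zero_less_power)
    \<comment> \<open>The cross terms of the two equations cancel in the energy.\<close>
    have "V x * (K2 * (g (v x) - u x) - K2' * (g (v' x) - u' x)) / K2 +
          U x * (K1 * (v x - F (u x)) - K1' * (v' x - F (u' x))) / K1 =
          V x * (g (v x) - g (v' x)) - U x * (F (u x) - F (u' x)) + V x * e2 + U x * e1"
      using K by (simp add: U_def V_def e1_def e2_def field_simps)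
    also have "\<dots> \<ge> c * S - \<delta> * (\<bar>V x\<bar> + \<bar>U x\<bar>)"
    proof -
      have "V x * (g (v x) - g (v' x)) \<ge> c * (V x)\<^sup>2" using g[of "v x" "v' x"] by (simp add: V_def mult.commute)
      moreover have "- (U x * (F (u x) - F (u' x))) \<ge> c * (U x)\<^sup>2" using F[of "u x" "u' x"] by (simp add: U_def mult.commute)
      moreover have "\<bar>V x * e2\<bar> \<le> \<bar>V x\<bar> * \<delta>" "\<bar>U x * e1\<bar> \<le> \<bar>U x\<bar> * \<delta>"
        unfolding abs_mult using e by (auto intro!: mult_left_mono)
      ultimately show ?thesis by (auto simp: S_def distrib_left mult.commute abs_le_iff)
    qed
    finally have low: "V x * (K2 * (g (v x) - u x) - K2' * (g (v' x) - u' x)) / K2 +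
          U x * (K1 * (v x - F (u x)) - K1' * (v' x - F (u' x))) / K1 \<ge> c * S - \<delta> * (\<bar>V x\<bar> + \<bar>U x\<bar>)" .
    have "(\<delta> * (\<bar>V x\<bar> + \<bar>U x\<bar>))\<^sup>2 < (c * S)\<^sup>2"
    proof -
      have "(\<bar>V x\<bar> + \<bar>U x\<bar>)\<^sup>2 \<le> 2 * S"
        using zero_le_power2[of "\<bar>V x\<bar> - \<bar>U x\<bar>"] by (simp add: S_def power2_eq_square algebra_simps)
      hence "(\<delta> * (\<bar>V x\<bar> + \<bar>U x\<bar>))\<^sup>2 \<le> \<delta>\<^sup>2 * (2 * S)" by (simp add: power_mult_distrib mult_left_mono)
      also have "\<dots> < (c\<^sup>2 * S) * S" using S \<open>S > 0\<close> by (simp add: mult.assoc[symmetric])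
      finally show ?thesis by (simp add: power2_eq_square mult.assoc mult.left_commute)
    qed
    hence "\<delta> * (\<bar>V x\<bar> + \<bar>U x\<bar>) < c * S"
      by (rule power2_less_imp_less) (use c \<open>S > 0\<close> in simp)
    hence pos: "0 < c * S - \<delta> * (\<bar>V x\<bar> + \<bar>U x\<bar>)" by simp
    have nonneg: "(v1 x - v1' x)\<^sup>2 / K2 + (u1 x - u1' x)\<^sup>2 / K1 \<ge> 0" using K by simp
    show "0 < 2 * ((v1 x - v1' x)\<^sup>2 / K2 + (u1 x - u1' x)\<^sup>2 / K1 +
         (V x * (K2 * (g (v x) - u x) - K2' * (g (v' x) - u' x)) / K2 +
          U x * (K1 * (v x - F (u x)) - K1' * (v' x - F (u' x))) / K1))"
      by (rule mult_pos_pos[OF zero_less_numeral add_nonneg_pos[OF nonneg less_le_trans[OF pos low]]])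
  qed
  thus ?thesis unfolding M_def U_def V_def .
qed

lemma slope_abs_bound:
  assumes d: "deriv2_on {0..h} z z1 z2" and h: "h > 0"
    and z: "\<And>x. 0 \<le> x \<Longrightarrow> x \<le> h \<Longrightarrow> \<bar>z x\<bar> \<le> \<delta>" and z2: "\<And>x. 0 \<le> x \<Longrightarrow> x \<le> h \<Longrightarrow> \<bar>z2 x\<bar> \<le> c"
  shows "\<bar>z1 0\<bar> \<le> 2 * \<delta> / h + c * h"
proof -
  obtain s where s: "0 < s" "s < h" "z h - z 0 = (h - 0) * z1 s"
    using MVT2[of 0 h z z1] d h by (auto simp: deriv2_on_def)
  obtain t where t: "0 < t" "t < s" "z1 s - z1 0 = (s - 0) * z2 t"
    using MVT2[of 0 s z1 z2] d s by (auto simp: deriv2_on_def)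
  have "h * \<bar>z1 s\<bar> \<le> 2 * \<delta>" using s z[of 0] z[of h] h abs_triangle_ineq4[of "z h" "z 0"] by (simp flip: abs_mult)
  hence 1: "\<bar>z1 s\<bar> \<le> 2 * \<delta> / h" using h by (simp add: field_simps)
  have "\<bar>(s - 0) * z2 t\<bar> \<le> h * c"
    unfolding abs_mult using s t z2[of t] by (intro mult_mono) auto
  hence "\<bar>z1 s - z1 0\<bar> \<le> c * h" using t by (simp add: mult.commute)
  thus ?thesis using 1 abs_triangle_ineq4[of "z1 s" "z1 s - z1 0"] by simp
qed

lemma derivative_at_0_bound:
  assumes d: "deriv2_on (domain e) z z1 z2"
    and z: "\<And>x. x \<in> domain e \<Longrightarrow> \<bar>z x\<bar> \<le> \<delta>" and z2: "\<And>x. x \<in> domain e \<Longrightarrow> \<bar>z2 x\<bar> \<le> \<delta>'"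
  shows "\<bar>z1 0\<bar> \<le> 2 * \<delta> + \<delta>'"
proof -
  have "{0..1} \<subseteq> domain e" using unit_subset_domain[of _ e] by auto
  hence "\<bar>z1 0\<bar> \<le> 2 * \<delta> / 1 + \<delta>' * 1"
    using d z z2 by (intro slope_abs_bound[of 1 z z1 z2]) (auto simp: deriv2_on_def)
  thus ?thesis by simp
qed

text \<open>The second derivative of the energy is at least \<open>k\<^sup>2\<close> times the energy, which is therefore compared
  with \<open>exp (- k * x)\<close>.\<close>

lemma energy_decay:
  fixes F g :: "real \<Rightarrow> real"
  assumes K: "0 < K1" "0 < K2"
    and F: "\<And>x. F x * x \<le> - cF * x\<^sup>2" and g: "\<And>x. g x * x \<ge> cg * x\<^sup>2"
    and k: "k > 0" "k\<^sup>2 \<le> 2 * cF * K1" "k\<^sup>2 \<le> 2 * cg * K2"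
    and u: "deriv2_on (domain Unbounded) u u1 (\<lambda>x. K1 * (v x - F (u x)))" "far_cond Unbounded u u1"
    and v: "deriv2_on (domain Unbounded) v v1 (\<lambda>x. K2 * (g (v x) - u x))" "far_cond Unbounded v v1"
    and x: "x \<ge> 0"
  shows "energy K1 K2 u v x \<le> energy K1 K2 u v 0 * exp (- k * x)"
proof -
  let ?N = "energy K1 K2 u v"
  define N1 where "N1 = (\<lambda>x. 2 * (v x * v1 x / K2 + u x * u1 x / K1))"
  define N2 where "N2 = (\<lambda>x. 2 * ((v1 x)\<^sup>2 / K2 + (u1 x)\<^sup>2 / K1 +
      (v x * (K2 * (g (v x) - u x)) / K2 + u x * (K1 * (v x - F (u x))) / K1)))"
  have dN: "deriv2_on {0..} ?N N1 N2"
    unfolding N1_def N2_def using deriv2_on_energy[OF u(1) v(1), of K1 K2] by (simp only: domain.simps)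
  obtain C where C: "\<And>x. x \<ge> 0 \<Longrightarrow> \<bar>?N x\<bar> \<le> C"
    using far_cond_energy[OF u(2) v(2), of K1 K2] by auto
  have N0: "?N y \<ge> 0" for y using K by (simp add: energy_def)
  have N2: "N2 y \<ge> k\<^sup>2 * ?N y" for y
  proof -
    have "v y * (K2 * (g (v y) - u y)) / K2 + u y * (K1 * (v y - F (u y))) / K1 = g (v y) * v y - F (u y) * u y"
      using K by (simp add: field_simps)
    hence "N2 y = 2 * ((v1 y)\<^sup>2 / K2 + (u1 y)\<^sup>2 / K1 + (g (v y) * v y - F (u y) * u y))" by (simp add: N2_def)
    moreover have "(v1 y)\<^sup>2 / K2 \<ge> 0" "(u1 y)\<^sup>2 / K1 \<ge> 0" using K by auto
    moreover note F[of "u y"] g[of "v y"]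
    ultimately have 1: "N2 y \<ge> 2 * cg * (v y)\<^sup>2 + 2 * cF * (u y)\<^sup>2" by (simp add: algebra_simps)
    have 2: "k\<^sup>2 * ((v y)\<^sup>2 / K2) \<le> 2 * cg * (v y)\<^sup>2"
      using mult_right_mono[OF k(3), of "(v y)\<^sup>2 / K2"] K by (simp add: field_simps)
    have 3: "k\<^sup>2 * ((u y)\<^sup>2 / K1) \<le> 2 * cF * (u y)\<^sup>2"
      using mult_right_mono[OF k(2), of "(u y)\<^sup>2 / K1"] K by (simp add: field_simps)
    show ?thesis using order_trans[OF add_mono[OF 2 3] 1] by (simp add: energy_def distrib_left)
  qed
  define E where "E = (\<lambda>x. ?N 0 * exp (- k * x))"
  have "?N x - E x \<le> 0"
  proof (rule max_principle[where e=Unbounded and z="\<lambda>x. ?N x - E x" and ?z1.0="\<lambda>x. N1 x + k * E x" and ?z2.0="\<lambda>x. N2 x - k\<^sup>2 * E x"])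
    show "deriv2_on (domain Unbounded) (\<lambda>x. ?N x - E x) (\<lambda>x. N1 x + k * E x) (\<lambda>x. N2 x - k\<^sup>2 * E x)"
      using dN unfolding deriv2_on_def E_def
      by (auto intro!: derivative_eq_intros simp: power2_eq_square)
    have "\<bar>?N x - E x\<bar> \<le> C + ?N 0" if "x \<ge> 0" for x
    proof -
      have "0 \<le> E x" "E x \<le> ?N 0" unfolding E_def using N0[of 0] k that by (auto simp: mult_left_le)
      thus ?thesis using C[OF that] by linarith
    qed
    thus "far_cond Unbounded (\<lambda>x. ?N x - E x) (\<lambda>x. N1 x + k * E x)" by auto
    fix x assume "?N x - E x > 0"
    hence "k\<^sup>2 * E x < k\<^sup>2 * ?N x" using k by (intro mult_strict_left_mono) auto
    thus "N2 x - k\<^sup>2 * E x > 0" using N2[of x] by simp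
  qed (use x in \<open>auto simp: E_def\<close>)
  thus ?thesis by (simp add: E_def)
qed

lemma deriv2_on_shift:
  assumes "deriv2_on {0..} z z1 z2" "a \<ge> 0"
  shows "deriv2_on {0..} (\<lambda>x. z (a + x)) (\<lambda>x. z1 (a + x)) (\<lambda>x. z2 (a + x))"
  unfolding deriv2_on_def
proof (intro ballI conjI)
  fix x :: real assume "x \<in> {0..}"
  hence "(z has_real_derivative z1 (a + x)) (at (a + x))" "(z1 has_real_derivative z2 (a + x)) (at (a + x))"
    using assms by (auto simp: deriv2_on_def)
  thus "((\<lambda>x. z (a + x)) has_real_derivative z1 (a + x)) (at x)" "((\<lambda>x. z1 (a + x)) has_real_derivative z2 (a + x)) (at x)"
    using DERIV_shift[of z _ x a] DERIV_shift[of z1 _ x a] by (simp_all add: add.commute)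
qed

lemma energy_decreasing:
  fixes F g :: "real \<Rightarrow> real"
  assumes K: "0 < K1" "0 < K2" and c: "0 < cF" "0 < cg"
    and F: "\<And>x. F x * x \<le> - cF * x\<^sup>2" and g: "\<And>x. g x * x \<ge> cg * x\<^sup>2"
    and u: "deriv2_on (domain Unbounded) u u1 (\<lambda>x. K1 * (v x - F (u x)))" "far_cond Unbounded u u1"
    and v: "deriv2_on (domain Unbounded) v v1 (\<lambda>x. K2 * (g (v x) - u x))" "far_cond Unbounded v v1"
    and x: "0 \<le> a" "a \<le> x"
  shows "energy K1 K2 u v x \<le> energy K1 K2 u v a"
proof -
  have far_shift: "far_cond Unbounded z z1 \<Longrightarrow> far_cond Unbounded (\<lambda>x. z (a + x)) z1'" for z z1 z1'
    using x(1) by (auto simp: add_nonneg_nonneg) (meson add_nonneg_nonneg)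
  define k where "k = sqrt (min (2 * cF * K1) (2 * cg * K2))"
  have pos: "min (2 * cF * K1) (2 * cg * K2) > 0" using K c by simp
  have k: "k > 0" "k\<^sup>2 \<le> 2 * cF * K1" "k\<^sup>2 \<le> 2 * cg * K2" using pos by (auto simp: k_def)
  let ?u = "\<lambda>x. u (a + x)" and ?v = "\<lambda>x. v (a + x)"
  have "energy K1 K2 ?u ?v (x - a) \<le> energy K1 K2 ?u ?v 0 * exp (- k * (x - a))"
    by (rule energy_decay[OF K F g k(1-3), where ?u1.0="\<lambda>x. u1 (a + x)" and ?v1.0="\<lambda>x. v1 (a + x)"])
      (use deriv2_on_shift[OF u(1)[unfolded domain.simps] x(1)] deriv2_on_shift[OF v(1)[unfolded domain.simps] x(1)] far_shift[OF u(2)] far_shift[OF v(2)] x in auto)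
  also have "\<dots> \<le> energy K1 K2 ?u ?v 0 * 1"
    using K k x by (intro mult_left_mono) (auto simp: energy_def)
  finally show ?thesis by (simp add: energy_def)
qed

text \<open>Before \<open>v\<close> can become negative it vanishes at some point, where the energy is only \<open>u\<^sup>2 / K1\<close>. From
  there on the energy does not increase, so \<open>v\<close> stays almost nonnegative if \<open>K1\<close> is large.\<close>

lemma inhibitor_lower_bound:
  fixes F g :: "real \<Rightarrow> real"
  assumes K: "0 < K1" "0 < K2" and c: "0 < cF" "0 < cg"
    and F: "\<And>x. F x * x \<le> - cF * x\<^sup>2" and g: "\<And>x. g x * x \<ge> cg * x\<^sup>2"
    and u: "deriv2_on (domain Unbounded) u u1 (\<lambda>x. K1 * (v x - F (u x)))" "far_cond Unbounded u u1"
    and v: "deriv2_on (domain Unbounded) v v1 (\<lambda>x. K2 * (g (v x) - u x))" "far_cond Unbounded v v1"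
    and v0: "v 0 \<ge> 0" and M: "\<And>x. x \<ge> 0 \<Longrightarrow> \<bar>u x\<bar> \<le> M" and x: "x \<ge> 0"
  shows "v x \<ge> - sqrt (K2 / K1) * M"
proof (cases "v x \<ge> 0")
  case True
  have "M \<ge> 0" using M[of 0] by linarith
  thus ?thesis using True K by (smt (verit) mult_nonneg_nonneg real_sqrt_ge_zero divide_nonneg_pos mult_minus_left)
next
  case False
  have "continuous_on {0..x} v"
    using v(1) by (intro continuous_at_imp_continuous_on ballI DERIV_isCont) (auto simp: deriv2_on_def)
  then obtain a where a: "0 \<le> a" "a \<le> x" "v a = 0"
    using IVT2'[of v x 0 0] v0 False x by auto
  have "energy K1 K2 u v x \<le> energy K1 K2 u v a"
    by (rule energy_decreasing[OF K c F g u v a(1,2)])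
  hence "(v x)\<^sup>2 / K2 \<le> (u a)\<^sup>2 / K1"
    using a K by (simp add: energy_def) (smt (verit) divide_nonneg_pos zero_le_power2)
  also have "\<dots> \<le> M\<^sup>2 / K1"
    using M[OF a(1)] K by (intro divide_right_mono) (auto simp: abs_le_square_iff[symmetric])
  finally have "(v x)\<^sup>2 \<le> (sqrt (K2 / K1) * M)\<^sup>2" using K by (simp add: power_mult_distrib field_simps)
  moreover have "M \<ge> 0" using M[of 0] by linarith
  ultimately have "\<bar>v x\<bar> \<le> sqrt (K2 / K1) * M"
    using K by (metis abs_le_square_iff abs_of_nonneg divide_nonneg_pos less_imp_le mult_nonneg_nonneg real_sqrt_ge_zero)
  thus ?thesis by linarith
qed

section \<open>Initial value problems\<close>

text \<open>In the norm \<open>SUP s. exp (- 2 * L * s) * norm (X s)\<close> the Picard iteration contracts by the factor \<open>1/2\<close> on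
  the whole half line. This gives solutions for all forward times at once, and both estimates can be
  read off from the fixed point equation.\<close>

theorem lipschitz_flow:
  fixes f :: "'a::banach \<Rightarrow> 'a"
  assumes f: "\<And>x y. norm (f x - f y) \<le> L * norm (x - y)" and L: "L > 0"
  shows "\<exists>\<Phi>. (\<forall>a. \<Phi> a 0 = a) \<and>
    (\<forall>a s. 0 \<le> s \<longrightarrow> (\<Phi> a has_vector_derivative f (\<Phi> a s)) (at s)) \<and>
    (\<forall>a b s. 0 \<le> s \<longrightarrow> norm (\<Phi> a s - \<Phi> b s) \<le> 2 * exp (2 * L * s) * norm (a - b)) \<and>
    (\<forall>a s. 0 \<le> s \<longrightarrow> norm (\<Phi> a s) \<le> 2 * exp (2 * L * s) * (norm a + norm (f 0) / L))"
proof -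
  define \<mu> where "\<mu> = 2 * L"
  have \<mu>: "\<mu> > 0" using L by (simp add: \<mu>_def)
  have cf: "continuous_on S f" for S
  proof -
    have "L-lipschitz_on S f" using f L by (intro lipschitz_onI) (auto simp: dist_norm)
    thus ?thesis by (rule lipschitz_on_continuous_on)
  qed
  define h where "h = (\<lambda>(Z :: real \<Rightarrow>\<^sub>C 'a) r. f (exp (\<mu> * r) *\<^sub>R apply_bcontfun Z r))"
  define I where "I = (\<lambda>Z. SOME G. G 0 = 0 \<and> (\<forall>x. (G has_vector_derivative h Z x) (at x)))"
  have "\<exists>G. G 0 = 0 \<and> (\<forall>x. (G has_vector_derivative h Z x) (at x))" for Z
  proof -
    have "continuous_on UNIV (h Z)" unfolding h_def
      by (intro continuous_on_compose2[OF cf[of UNIV]] continuous_intros) auto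
    thus ?thesis using antiderivative_UNIV by blast
  qed
  from someI_ex[OF this] have I: "I Z 0 = 0" "(I Z has_vector_derivative h Z x) (at x)" for Z x
    unfolding I_def by blast+
  have bound: "norm (G s) \<le> C / \<mu> * exp (\<mu> * s)"
    if G: "G 0 = 0" "\<And>x. (G has_vector_derivative k x) (at x)"
      and k: "\<And>x. 0 \<le> x \<Longrightarrow> norm (k x) \<le> C * exp (\<mu> * x)" and s: "0 \<le> s" for G k :: "real \<Rightarrow> 'a" and C s
  proof -
    have C: "C \<ge> 0" using order_trans[OF norm_ge_zero k[of 0]] by simp
    have i1: "(k has_integral (G s - G 0)) {0..s}"
      by (rule fundamental_theorem_of_calculus[OF s]) (auto intro: has_vector_derivative_at_within G)
    have i2: "((\<lambda>x. C * exp (\<mu> * x)) has_integral (C / \<mu> * exp (\<mu> * s) - C / \<mu> * exp (\<mu> * 0))) {0..s}"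
      by (rule fundamental_theorem_of_calculus[OF s])
        (use \<mu> in \<open>auto intro!: derivative_eq_intros simp flip: has_real_derivative_iff_has_vector_derivative\<close>)
    have "norm (integral {0..s} k) \<le> integral {0..s} (\<lambda>x. C * exp (\<mu> * x))"
      by (rule integral_norm_bound_integral) (use i1 i2 k in \<open>auto simp: integrable_on_def\<close>)
    hence "norm (G s) \<le> C / \<mu> * exp (\<mu> * s) - C / \<mu> * exp (\<mu> * 0)"
      unfolding integral_unique[OF i1] integral_unique[OF i2] using G(1) by simp
    moreover have "C / \<mu> \<ge> 0" using C \<mu> by simp
    ultimately show ?thesis by simp
  qed
  have hZ: "norm (h Z r - h Y r) \<le> L * dist Z Y * exp (\<mu> * r)" for Z Y r
  proof -
    have "norm (h Z r - h Y r) \<le> L * norm (exp (\<mu> * r) *\<^sub>R (Z r - Y r))"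
      unfolding h_def scaleR_diff_right by (rule f)
    also have "\<dots> = L * (exp (\<mu> * r) * dist (Z r) (Y r))" by (simp add: dist_norm)
    also have "\<dots> \<le> L * (exp (\<mu> * r) * dist Z Y)"
      using L by (intro mult_left_mono dist_bounded) auto
    finally show ?thesis by (simp add: mult_ac)
  qed
  have h0: "norm (h (const_bcontfun 0) r) \<le> norm (f 0) * exp (\<mu> * r)" if "0 \<le> r" for r
    using that \<mu> by (simp add: h_def const_bcontfun.rep_eq mult_le_cancel_left1)
  have Idiff: "norm (I Z s - I Y s) \<le> dist Z Y / 2 * exp (\<mu> * s)" if "0 \<le> s" for Z Y s
  proof -
    have "norm (I Z s - I Y s) \<le> L * dist Z Y / \<mu> * exp (\<mu> * s)"
      by (rule bound[where G="\<lambda>s. I Z s - I Y s" and k="\<lambda>s. h Z s - h Y s"])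
        (use I hZ that in \<open>auto intro!: derivative_intros\<close>)
    thus ?thesis using L by (simp add: \<mu>_def)
  qed
  have I0: "norm (I (const_bcontfun 0) s) \<le> norm (f 0) / \<mu> * exp (\<mu> * s)" if "0 \<le> s" for s
    by (rule bound[OF I h0 that])
  \<comment> \<open>The weighted solution \<open>Z s = exp (- \<mu> * s) * X s\<close> is bounded; freezing the time at \<open>0\<close> on the negative
    axis extends it to the line.\<close>
  define P where "P = (\<lambda>a Z s. exp (- \<mu> * max 0 s) *\<^sub>R (a + I Z (max 0 s)))"
  have e1: "exp (- \<mu> * s) * exp (\<mu> * s) = 1" for s by (simp flip: exp_add)
  have Pdiff: "dist (P a Z s) (P b Y s) \<le> norm (a - b) + dist Z Y / 2" for a b Z Y s
  proof -
    define t where "t = max 0 s"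
    have t: "t \<ge> 0" by (simp add: t_def)
    have "P a Z s - P b Y s = exp (- \<mu> * t) *\<^sub>R ((a - b) + (I Z t - I Y t))"
      by (simp add: P_def t_def[symmetric] algebra_simps)
    hence "dist (P a Z s) (P b Y s) = exp (- \<mu> * t) * norm ((a - b) + (I Z t - I Y t))"
      by (simp add: dist_norm)
    also have "\<dots> \<le> exp (- \<mu> * t) * (norm (a - b) + dist Z Y / 2 * exp (\<mu> * t))"
      using Idiff[OF t, of Z Y] by (intro mult_left_mono order_trans[OF norm_triangle_ineq]) auto
    also have "\<dots> = exp (- \<mu> * t) * norm (a - b) + dist Z Y / 2"
      using e1[of t] by (simp add: distrib_left)
    also have "exp (- \<mu> * t) * norm (a - b) \<le> norm (a - b)"
      using t \<mu> by (intro mult_left_le_one_le) auto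
    finally show ?thesis by simp
  qed
  have P0: "norm (P a (const_bcontfun 0) s) \<le> norm a + norm (f 0) / \<mu>" for a s
  proof -
    define t where "t = max 0 s"
    have t: "t \<ge> 0" by (simp add: t_def)
    have "norm (P a (const_bcontfun 0) s) = exp (- \<mu> * t) * norm (a + I (const_bcontfun 0) t)"
      by (simp add: P_def t_def[symmetric])
    also have "\<dots> \<le> exp (- \<mu> * t) * (norm a + norm (f 0) / \<mu> * exp (\<mu> * t))"
      using I0[OF t] by (intro mult_left_mono order_trans[OF norm_triangle_ineq]) auto
    also have "\<dots> = exp (- \<mu> * t) * norm a + norm (f 0) / \<mu>"
      using e1[of t] by (simp add: distrib_left)
    also have "exp (- \<mu> * t) * norm a \<le> norm a"
      using t \<mu> by (intro mult_left_le_one_le) auto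
    finally show ?thesis by simp
  qed
  have Pin: "P a Z \<in> bcontfun" for a Z
  proof -
    have "continuous_on UNIV (I Z)"
      using I(2) by (intro continuous_at_imp_continuous_on ballI has_vector_derivative_continuous)
    hence "continuous_on UNIV (\<lambda>s. I Z (max 0 s))"
      by (rule continuous_on_compose2) (auto intro!: continuous_intros)
    hence "continuous_on UNIV (P a Z)"
      unfolding P_def by (intro continuous_on_scaleR continuous_on_add) (auto intro!: continuous_intros)
    moreover have "norm (P a Z s) \<le> norm a + norm (f 0) / \<mu> + dist Z (const_bcontfun 0) / 2" for s
      using P0[of a s] Pdiff[of a Z s a "const_bcontfun 0"] norm_triangle_sub[of "P a Z s" "P a (const_bcontfun 0) s"]
      by (simp add: dist_norm)
    ultimately show ?thesis by (auto simp: bcontfun_def bounded_iff)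
  qed
  have ap: "apply_bcontfun (Bcontfun (P a Z)) = P a Z" for a Z by (rule Bcontfun_inverse[OF Pin])
  have "\<exists>!Z. Bcontfun (P a Z) = Z" for a
  proof (rule banach_fix_type[of "1/2"])
    show "\<forall>Z Y. dist (Bcontfun (P a Z)) (Bcontfun (P a Y)) \<le> 1/2 * dist Z Y"
    proof (intro allI dist_bound)
      fix Z Y s
      show "dist (apply_bcontfun (Bcontfun (P a Z)) s) (apply_bcontfun (Bcontfun (P a Y)) s) \<le> 1/2 * dist Z Y"
        using Pdiff[of a Z s a Y] by (simp add: ap)
    qed
  qed auto
  hence "\<exists>Z. Bcontfun (P a Z) = Z" for a by blast
  from someI_ex[OF this] obtain X where X: "Bcontfun (P a (X a)) = X a" for a
    by (rule that[of "\<lambda>a. SOME Z. Bcontfun (P a Z) = Z"])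
  have Xs: "apply_bcontfun (X a) s = P a (X a) s" for a s using ap[of a "X a"] X[of a] by simp
  have Xdiff: "dist (X a) (X b) \<le> 2 * norm (a - b)" for a b
  proof -
    have "dist (X a) (X b) \<le> norm (a - b) + dist (X a) (X b) / 2"
      by (rule dist_bound) (simp add: Xs Pdiff)
    thus ?thesis by simp
  qed
  have Xnorm: "norm (apply_bcontfun (X a) s) \<le> 2 * (norm a + norm (f 0) / L)" for a s
  proof -
    have "dist (X a) (const_bcontfun 0) \<le> norm a + norm (f 0) / \<mu> + dist (X a) (const_bcontfun 0) / 2"
    proof (rule dist_bound)
      fix s
      show "dist (X a s) (const_bcontfun 0 s) \<le> norm a + norm (f 0) / \<mu> + dist (X a) (const_bcontfun 0) / 2"
        using P0[of a s] Pdiff[of a "X a" s a "const_bcontfun 0"]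
          norm_triangle_sub[of "P a (X a) s" "P a (const_bcontfun 0) s"]
        by (simp add: dist_norm Xs const_bcontfun.rep_eq)
    qed
    moreover have "dist (X a s) (const_bcontfun 0 s) \<le> dist (X a) (const_bcontfun 0)" by (rule dist_bounded)
    moreover have "norm (f 0) / \<mu> \<le> norm (f 0) / L" using L by (auto simp: \<mu>_def intro!: divide_left_mono)
    ultimately show ?thesis by (simp add: const_bcontfun.rep_eq)
  qed
  define \<Phi> where "\<Phi> = (\<lambda>a s. a + I (X a) s)"
  have \<Phi>: "\<Phi> a s = exp (\<mu> * s) *\<^sub>R X a s" if "s \<ge> 0" for a s
    using that e1[of s] by (simp add: \<Phi>_def Xs P_def max_def mult.commute)
  show ?thesis
  proof (intro exI[of _ \<Phi>] conjI allI impI)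
    show "\<Phi> a 0 = a" for a by (simp add: \<Phi>_def I)
    show "(\<Phi> a has_vector_derivative f (\<Phi> a s)) (at s)" if "0 \<le> s" for a s
      using I(2)[of "X a" s] \<Phi>[OF that, of a] unfolding h_def
      by (auto simp: \<Phi>_def[abs_def] intro!: derivative_eq_intros)
    show "norm (\<Phi> a s - \<Phi> b s) \<le> 2 * exp (2 * L * s) * norm (a - b)" if "0 \<le> s" for a b s
    proof -
      have "norm (\<Phi> a s - \<Phi> b s) = exp (\<mu> * s) * dist (X a s) (X b s)"
        using that by (simp add: \<Phi> dist_norm flip: scaleR_diff_right)
      also have "\<dots> \<le> exp (\<mu> * s) * (2 * norm (a - b))"
        by (intro mult_left_mono order_trans[OF dist_bounded Xdiff]) auto
      finally show ?thesis by (simp add: \<mu>_def mult_ac)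
    qed
    show "norm (\<Phi> a s) \<le> 2 * exp (2 * L * s) * (norm a + norm (f 0) / L)" if "0 \<le> s" for a s
      using mult_left_mono[OF Xnorm[of a s], of "exp (\<mu> * s)"] that by (simp add: \<Phi> \<mu>_def mult_ac)
  qed
qed

section \<open>Zeros of maps on boxes\<close>

text \<open>Truncate the map \<open>p + f p\<close> to the box and take a Brouwer fixed point. Where the truncation is active,
  \<open>f\<close> would push outwards through a face, which its sign there forbids; so \<open>f\<close> vanishes.\<close>

theorem poincare_miranda_3:
  fixes f1 f2 f3 :: "real \<times> real \<times> real \<Rightarrow> real"
  assumes le: "a1 \<le> b1" "a2 \<le> b2" "a3 \<le> b3"
    and cont: "continuous_on ({a1..b1} \<times> {a2..b2} \<times> {a3..b3}) f1"
      "continuous_on ({a1..b1} \<times> {a2..b2} \<times> {a3..b3}) f2"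
      "continuous_on ({a1..b1} \<times> {a2..b2} \<times> {a3..b3}) f3"
    and s1: "\<And>y z. y \<in> {a2..b2} \<Longrightarrow> z \<in> {a3..b3} \<Longrightarrow> f1 (a1, y, z) > 0 \<and> f1 (b1, y, z) < 0"
    and s2: "\<And>x z. x \<in> {a1..b1} \<Longrightarrow> z \<in> {a3..b3} \<Longrightarrow> f2 (x, a2, z) > 0 \<and> f2 (x, b2, z) < 0"
    and s3: "\<And>x y. x \<in> {a1..b1} \<Longrightarrow> y \<in> {a2..b2} \<Longrightarrow> f3 (x, y, a3) > 0 \<and> f3 (x, y, b3) < 0"
  shows "\<exists>x\<in>{a1..b1}. \<exists>y\<in>{a2..b2}. \<exists>z\<in>{a3..b3}. f1 (x, y, z) = 0 \<and> f2 (x, y, z) = 0 \<and> f3 (x, y, z) = 0"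
proof -
  define S where "S = {a1..b1} \<times> {a2..b2} \<times> {a3..b3}"
  define cl :: "real \<Rightarrow> real \<Rightarrow> real \<Rightarrow> real" where "cl = (\<lambda>a b x. max a (min b x))"
  define T where "T = (\<lambda>p. (cl a1 b1 (fst p + f1 p), cl a2 b2 (fst (snd p) + f2 p), cl a3 b3 (snd (snd p) + f3 p)))"
  have "compact S" "convex S" "S \<noteq> {}" unfolding S_def using le
    by (auto intro!: compact_Times convex_Times)
  moreover have "continuous_on S T"
    unfolding T_def cl_def using cont by (auto simp: S_def intro!: continuous_intros)
  moreover have "T \<in> S \<rightarrow> S" using le by (auto simp: T_def cl_def S_def)
  ultimately obtain p where p: "p \<in> S" "T p = p" by (rule brouwer)
  obtain x y z where xyz: "p = (x, y, z)" by (cases p)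
  have zero: "g = 0" if "a \<le> b" "cl a b (t + g) = t" "t = a \<Longrightarrow> g > 0" "t = b \<Longrightarrow> g < 0" for a b t g
    using that by (auto simp: cl_def max_def min_def split: if_splits)
  have "f1 p = 0" by (rule zero[of a1 b1 x]) (use le p s1 in \<open>auto simp: xyz T_def S_def\<close>)
  moreover have "f2 p = 0" by (rule zero[of a2 b2 y]) (use le p s2 in \<open>auto simp: xyz T_def S_def\<close>)
  moreover have "f3 p = 0" by (rule zero[of a3 b3 z]) (use le p s3 in \<open>auto simp: xyz T_def S_def\<close>)
  ultimately show ?thesis using p unfolding xyz S_def by blast
qed

section \<open>Orbits of the first-order system\<close>

type_synonym state = "real \<times> real \<times> real \<times> real"

text \<open>The components of a state are \<open>u\<close>, \<open>u'\<close>, \<open>v\<close>, \<open>v'\<close>.\<close>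

definition pulse_field :: "real \<Rightarrow> real \<Rightarrow> real \<Rightarrow> state \<Rightarrow> state" where
  "pulse_field \<beta> \<gamma> d = (\<lambda>(u, p, v, w). (p, (v - cubic \<beta> u) / d, w, \<gamma> * v + v ^ 3 - u))"

definition orbit_on :: "real \<Rightarrow> real \<Rightarrow> real \<Rightarrow> real set \<Rightarrow> (real \<Rightarrow> state) \<Rightarrow> bool" where
  "orbit_on \<beta> \<gamma> d I X \<longleftrightarrow> (\<forall>x\<in>I. (X has_vector_derivative pulse_field \<beta> \<gamma> d (X x)) (at x))"

lemma has_vector_derivative_glue:
  fixes X Y :: "real \<Rightarrow> 'a::real_normed_vector"
  assumes "x \<le> c \<Longrightarrow> (X has_vector_derivative D) (at x)" "c \<le> x \<Longrightarrow> (Y has_vector_derivative D) (at x)" "X c = Y c"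
  shows "((\<lambda>x. if x \<le> c then X x else Y x) has_vector_derivative D) (at x)"
proof (cases x c rule: linorder_cases)
  case less
  show ?thesis
    by (rule has_vector_derivative_transform_within_open[of X D x "{..<c}"]) (use less assms in auto)
next
  case greater
  show ?thesis
    by (rule has_vector_derivative_transform_within_open[of Y D x "{c<..}"]) (use greater assms in auto)
next
  case equal
  have "((\<lambda>x. if x \<in> {..c} then X x else Y x) has_vector_derivative (if x \<in> {..c} then D else D)) (at x within UNIV)"
    by (rule has_vector_derivative_If_within_closures[where T="{c<..}"])
      (use equal assms in \<open>auto intro: has_vector_derivative_at_within\<close>)
  thus ?thesis by simp
qed

lemma orbit_on_glue:
  assumes "orbit_on \<beta> \<gamma> d I X" "orbit_on \<beta> \<gamma> d J Y" "X c = Y c"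
    and "\<And>x. x \<in> K \<Longrightarrow> x \<le> c \<Longrightarrow> x \<in> I" "\<And>x. x \<in> K \<Longrightarrow> c \<le> x \<Longrightarrow> x \<in> J"
  shows "orbit_on \<beta> \<gamma> d K (\<lambda>x. if x \<le> c then X x else Y x)"
  unfolding orbit_on_def
proof
  fix x assume x: "x \<in> K"
  show "((\<lambda>x. if x \<le> c then X x else Y x) has_vector_derivative pulse_field \<beta> \<gamma> d (if x \<le> c then X x else Y x)) (at x)"
    by (rule has_vector_derivative_glue) (use assms x in \<open>auto simp: orbit_on_def\<close>)
qed

definition reflect :: "state \<Rightarrow> state" where
  "reflect = (\<lambda>(u, p, v, w). (u, - p, v, - w))"

lemma state_derivativeD:
  fixes u p v w :: "real \<Rightarrow> real"
  assumes "((\<lambda>x. (u x, p x, v x, w x)) has_vector_derivative (a, b, c, d)) (at x)"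
  shows "(u has_real_derivative a) (at x)" "(p has_real_derivative b) (at x)"
    "(v has_real_derivative c) (at x)" "(w has_real_derivative d) (at x)"
proof -
  note 1 = bounded_linear.has_vector_derivative[OF bounded_linear_fst assms]
    and 2 = bounded_linear.has_vector_derivative[OF bounded_linear_snd assms]
  note 3 = bounded_linear.has_vector_derivative[OF bounded_linear_fst 2]
    and 4 = bounded_linear.has_vector_derivative[OF bounded_linear_snd 2]
  note 5 = bounded_linear.has_vector_derivative[OF bounded_linear_fst 4]
    and 6 = bounded_linear.has_vector_derivative[OF bounded_linear_snd 4]
  show "(u has_real_derivative a) (at x)" "(p has_real_derivative b) (at x)"
    "(v has_real_derivative c) (at x)" "(w has_real_derivative d) (at x)"
    using 1 3 5 6 by (simp_all add: has_real_derivative_iff_has_vector_derivative)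
qed

lemma orbit_onI:
  assumes "\<And>x. x \<in> I \<Longrightarrow> (u has_real_derivative p x) (at x)"
    "\<And>x. x \<in> I \<Longrightarrow> (p has_real_derivative (v x - cubic \<beta> (u x)) / d) (at x)"
    "\<And>x. x \<in> I \<Longrightarrow> (v has_real_derivative w x) (at x)"
    "\<And>x. x \<in> I \<Longrightarrow> (w has_real_derivative \<gamma> * v x + v x ^ 3 - u x) (at x)"
  shows "orbit_on \<beta> \<gamma> d I (\<lambda>x. (u x, p x, v x, w x))"
  using assms unfolding orbit_on_def pulse_field_def has_real_derivative_iff_has_vector_derivative
  by (auto intro!: has_vector_derivative_Pair)

lemma orbit_onD:
  assumes "orbit_on \<beta> \<gamma> d I X" "x \<in> I" "X = (\<lambda>x. (u x, p x, v x, w x))"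
  shows "(u has_real_derivative p x) (at x)"
    "(p has_real_derivative (v x - cubic \<beta> (u x)) / d) (at x)"
    "(v has_real_derivative w x) (at x)"
    "(w has_real_derivative \<gamma> * v x + v x ^ 3 - u x) (at x)"
proof -
  have D: "((\<lambda>x. (u x, p x, v x, w x)) has_vector_derivative
      (p x, (v x - cubic \<beta> (u x)) / d, w x, \<gamma> * v x + v x ^ 3 - u x)) (at x)"
    using assms by (simp add: orbit_on_def pulse_field_def)
  show "(u has_real_derivative p x) (at x)"
    "(p has_real_derivative (v x - cubic \<beta> (u x)) / d) (at x)"
    "(v has_real_derivative w x) (at x)"
    "(w has_real_derivative \<gamma> * v x + v x ^ 3 - u x) (at x)"
    by (rule state_derivativeD[OF D])+
qed

lemma orbit_on_reflect:
  assumes "orbit_on \<beta> \<gamma> d {0..} X"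
  shows "orbit_on \<beta> \<gamma> d {..0} (\<lambda>x. reflect (X (- x)))"
proof -
  define u p v w where "u = (\<lambda>x. fst (X x))" and "p = (\<lambda>x. fst (snd (X x)))"
    and "v = (\<lambda>x. fst (snd (snd (X x))))" and "w = (\<lambda>x. snd (snd (snd (X x))))"
  have X: "X = (\<lambda>x. (u x, p x, v x, w x))" by (simp add: u_def p_def v_def w_def)
  have neg: "((\<lambda>x. z (- x)) has_real_derivative - D) (at x)" if "(z has_real_derivative D) (at (- x))" for z D and x :: real
    using DERIV_mirror[of "\<lambda>x. z x" D x] that by simp
  have "orbit_on \<beta> \<gamma> d {..0} (\<lambda>x. (u (- x), - p (- x), v (- x), - w (- x)))"
  proof (rule orbit_onI)
    fix x :: real assume "x \<in> {..0}"
    hence x: "- x \<in> {0..}" by simp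
    note D = orbit_onD[OF assms x X]
    show "((\<lambda>x. u (- x)) has_real_derivative - p (- x)) (at x)" "((\<lambda>x. v (- x)) has_real_derivative - w (- x)) (at x)"
      by (intro neg D)+
    show "((\<lambda>x. - p (- x)) has_real_derivative (v (- x) - cubic \<beta> (u (- x))) / d) (at x)"
      using DERIV_minus[OF neg[OF D(2)]] by simp
    show "((\<lambda>x. - w (- x)) has_real_derivative \<gamma> * v (- x) + v (- x) ^ 3 - u (- x)) (at x)"
      using DERIV_minus[OF neg[OF D(4)]] by simp
  qed
  thus ?thesis by (simp add: X reflect_def)
qed

text \<open>Along an orbit the derivatives of \<open>u\<close>, \<open>u'\<close>, \<open>v\<close>, \<open>v'\<close> are polynomials in these four functions. The
  polynomials in them are thus closed under differentiation, and an orbit is smooth.\<close>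

inductive_set flow_polynomials :: "(real \<Rightarrow> real) set \<Rightarrow> (real \<Rightarrow> real) set" for S where
  generator: "g \<in> S \<Longrightarrow> g \<in> flow_polynomials S"
| const: "(\<lambda>_. c) \<in> flow_polynomials S"
| add: "g \<in> flow_polynomials S \<Longrightarrow> h \<in> flow_polynomials S \<Longrightarrow> (\<lambda>x. g x + h x) \<in> flow_polynomials S"
| mult: "g \<in> flow_polynomials S \<Longrightarrow> h \<in> flow_polynomials S \<Longrightarrow> (\<lambda>x. g x * h x) \<in> flow_polynomials S"

lemma flow_polynomials_deriv:
  assumes "\<And>g. g \<in> S \<Longrightarrow> \<exists>g'\<in>flow_polynomials S. \<forall>x. (g has_real_derivative g' x) (at x)"
    and "h \<in> flow_polynomials S"
  shows "\<exists>h'\<in>flow_polynomials S. \<forall>x. (h has_real_derivative h' x) (at x)"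
  using assms(2)
proof induction
  case (const c)
  show ?case by (rule bexI[OF _ flow_polynomials.const[of 0]]) auto
next
  case (add g h)
  then obtain g' h' where "g' \<in> flow_polynomials S" "h' \<in> flow_polynomials S"
    "\<forall>x. (g has_real_derivative g' x) (at x)" "\<forall>x. (h has_real_derivative h' x) (at x)" by blast
  thus ?case by (intro bexI[OF _ flow_polynomials.add[of g' S h']]) (auto intro!: derivative_intros)
next
  case (mult g h)
  then obtain g' h' where *: "g' \<in> flow_polynomials S" "h' \<in> flow_polynomials S"
    "\<forall>x. (g has_real_derivative g' x) (at x)" "\<forall>x. (h has_real_derivative h' x) (at x)" by blast
  show ?case
    by (rule bexI[OF _ flow_polynomials.add[OF flow_polynomials.mult[OF *(1) mult(2)] flow_polynomials.mult[OF *(2) mult(1)]]])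
      (use * in \<open>auto intro!: derivative_eq_intros\<close>)
qed (use assms(1) in blast)

lemma flow_polynomials_smooth:
  assumes S: "\<And>g. g \<in> S \<Longrightarrow> \<exists>g'\<in>flow_polynomials S. \<forall>x. (g has_real_derivative g' x) (at x)"
    and h: "h \<in> flow_polynomials S"
  shows "smooth_on_pos h"
proof -
  have *: "(deriv ^^ n) h \<in> flow_polynomials S" for n
  proof (induction n)
    case (Suc n)
    obtain g where g: "g \<in> flow_polynomials S" "\<forall>x. ((deriv ^^ n) h has_real_derivative g x) (at x)"
      using flow_polynomials_deriv[OF S Suc] by blast
    hence "deriv ((deriv ^^ n) h) = g" by (auto intro!: DERIV_imp_deriv)
    thus ?case using g by simp
  qed (use h in simp)
  show ?thesis unfolding smooth_on_pos_def field_differentiable_def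
    using flow_polynomials_deriv[OF S *] by blast
qed

lemma orbit_smooth:
  assumes "orbit_on \<beta> \<gamma> d UNIV (\<lambda>x. (u x, p x, v x, w x))"
  shows "smooth_on_pos u" "smooth_on_pos v"
proof -
  let ?S = "{u, p, v, w}"
  note D = orbit_onD[OF assms UNIV_I refl]
  have gen: "u \<in> flow_polynomials ?S" "p \<in> flow_polynomials ?S" "v \<in> flow_polynomials ?S" "w \<in> flow_polynomials ?S"
    by (auto intro: flow_polynomials.generator)
  note poly = flow_polynomials.add flow_polynomials.mult flow_polynomials.const gen
  have "(\<lambda>x. (1 / d) * (v x + (-1) * (u x * ((1 + (-1) * u x) * (u x + (- \<beta>)))))) \<in> flow_polynomials ?S"
    by (intro poly)
  also have "(\<lambda>x. (1 / d) * (v x + (-1) * (u x * ((1 + (-1) * u x) * (u x + (- \<beta>)))))) =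
      (\<lambda>x. (v x - cubic \<beta> (u x)) / d)"
    by (rule ext) (simp add: cubic_def mult.assoc)
  finally have 1: "(\<lambda>x. (v x - cubic \<beta> (u x)) / d) \<in> flow_polynomials ?S" .
  have "(\<lambda>x. \<gamma> * v x + (v x * (v x * v x) + (-1) * u x)) \<in> flow_polynomials ?S"
    by (intro poly)
  also have "(\<lambda>x. \<gamma> * v x + (v x * (v x * v x) + (-1) * u x)) = (\<lambda>x. \<gamma> * v x + v x ^ 3 - u x)"
    by (rule ext) (simp add: power3_eq_cube mult.assoc)
  finally have 2: "(\<lambda>x. \<gamma> * v x + v x ^ 3 - u x) \<in> flow_polynomials ?S" .
  have S: "\<exists>g'\<in>flow_polynomials ?S. \<forall>x. (g has_real_derivative g' x) (at x)" if "g \<in> ?S" for g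
    using that by (elim insertE emptyE)
      (use D in \<open>auto intro: bexI[OF _ gen(2)] bexI[OF _ 1] bexI[OF _ gen(4)] bexI[OF _ 2]\<close>)
  show "smooth_on_pos u" "smooth_on_pos v"
    using flow_polynomials_smooth[OF S] gen by blast+
qed

section \<open>The modified nonlinearities\<close>

lemma derivative_at_touching_0:
  fixes z :: "real \<Rightarrow> real"
  assumes "(z has_real_derivative D) (at 0)" "z 0 = 0" "b > 0" "\<And>x. 0 < x \<Longrightarrow> x < b \<Longrightarrow> z x \<le> 0"
  shows "D \<le> 0"
proof (rule ccontr)
  assume "\<not> D \<le> 0"
  then obtain \<delta> where "\<delta> > 0" "\<And>h. 0 < h \<Longrightarrow> h < \<delta> \<Longrightarrow> z 0 < z (0 + h)"
    using DERIV_pos_inc_right[OF assms(1)] by (meson not_le)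
  moreover define h where "h = min \<delta> b / 2"
  moreover have "0 < h" "h < \<delta>" "h < b" using \<open>\<delta> > 0\<close> assms(3) by (auto simp: h_def min_def)
  ultimately have "z 0 < z (0 + h)" "z h \<le> 0" using assms(4) by blast+
  thus False using assms(2) by simp
qed

lemma taylor_upper:
  assumes d: "deriv2_on {0..b} z z1 z2" and c: "\<And>x. 0 \<le> x \<Longrightarrow> x \<le> b \<Longrightarrow> z2 x \<le> c"
    and x: "0 \<le> x" "x \<le> b"
  shows "z x \<le> z 0 + z1 0 * x + c * x\<^sup>2 / 2"
proof -
  have 1: "z1 0 + c * y - z1 y \<ge> 0" if "0 \<le> y" "y \<le> b" for y
  proof -
    have "z1 0 + c * 0 - z1 0 \<le> z1 0 + c * y - z1 y"
      by (rule DERIV_nonneg_imp_nondecreasing[OF that(1), of "\<lambda>y. z1 0 + c * y - z1 y"])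
        (use d c that in \<open>auto simp: deriv2_on_def intro!: exI derivative_eq_intros\<close>)
    thus ?thesis by simp
  qed
  have "z 0 + z1 0 * 0 + c * 0\<^sup>2 / 2 - z 0 \<le> z 0 + z1 0 * x + c * x\<^sup>2 / 2 - z x"
  proof (rule DERIV_nonneg_imp_nondecreasing[OF x(1), of "\<lambda>y. z 0 + z1 0 * y + c * y\<^sup>2 / 2 - z y"])
    fix y assume y: "0 \<le> y" "y \<le> x"
    have "((\<lambda>y. z 0 + z1 0 * y + c * y\<^sup>2 / 2 - z y) has_real_derivative (z1 0 + c * y - z1 y)) (at y)"
      using d y x by (auto simp: deriv2_on_def intro!: derivative_eq_intros)
    thus "\<exists>D. ((\<lambda>y. z 0 + z1 0 * y + c * y\<^sup>2 / 2 - z y) has_real_derivative D) (at y) \<and> 0 \<le> D"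
      using 1[of y] y x by auto
  qed
  thus ?thesis by simp
qed

locale cubic_parameter =
  fixes \<beta> :: real
  assumes beta: "1/3 < \<beta>" "\<beta> < 1/2"
begin

text \<open>The inflection point \<open>mid\<close> of the cubic is the centre of symmetry of its graph, and \<open>jump\<close> is the
  value of the cubic there. On the window between \<open>lo\<close> and \<open>1/100\<close>, which belongs to the left
  decreasing branch, the slope of the cubic lies between \<open>- 3/5\<close> and \<open>- 3/10\<close>.\<close>

definition mid :: real where "mid = (1 + \<beta>) / 3"
definition jump :: real where "jump = cubic \<beta> mid"
definition lo :: real where "lo = mid - 13/25"

lemma mid_bounds: "4/9 < mid" "mid < 1/2"
  using beta by (auto simp: mid_def)

lemma lo_bounds: "lo < -1/50" "-1/10 < lo"
  using mid_bounds by (auto simp: lo_def)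

lemma jump_bounds: "0 < jump" "jump < 1/36"
proof -
  have eq: "jump = (1 + \<beta>) * (2 - \<beta>) * (1 - 2 * \<beta>) / 27"
    by (simp add: jump_def cubic_def mid_def field_simps)
  show "0 < jump" unfolding eq using beta by simp
  have "(1 + \<beta>) * (2 - \<beta>) = 9/4 - (\<beta> - 1/2)\<^sup>2" by (simp add: power2_eq_square field_simps)
  hence "(1 + \<beta>) * (2 - \<beta>) \<le> 9/4" by simp
  hence "(1 + \<beta>) * (2 - \<beta>) * (1 - 2 * \<beta>) \<le> 9/4 * (1 - 2 * \<beta>)"
    using beta by (intro mult_right_mono) auto
  also have "\<dots> < 9/4 * (1/3)" using beta by simp
  finally show "jump < 1/36" unfolding eq by simp
qed

lemma cubic_zero [simp]: "cubic \<beta> 0 = 0"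
  by (simp add: cubic_def)

text \<open>The point reflection of the graph in its inflection point exchanges the left and the right decreasing
  branch. It turns the core of the pulse into a problem on the left branch.\<close>

lemma cubic_odd: "cubic \<beta> (2 * mid - u) = 2 * jump - cubic \<beta> u"
  by (simp add: cubic_def jump_def mid_def field_simps power2_eq_square)

lemma cubic_deriv: "(cubic \<beta> has_real_derivative (1 - \<beta> + \<beta>\<^sup>2) / 3 - 3 * (u - mid)\<^sup>2) (at u)"
proof -
  have "((\<lambda>u. u * (1 - u) * (u - \<beta>)) has_real_derivative (1 - \<beta> + \<beta>\<^sup>2) / 3 - 3 * (u - mid)\<^sup>2) (at u)"
    by (auto intro!: derivative_eq_intros simp: mid_def field_simps power2_eq_square)
  thus ?thesis by (simp add: cubic_def[abs_def])
qed

lemma cubic_deriv_bounds: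
  assumes "lo \<le> u" "u \<le> 1/100"
  shows "\<bar>(1 - \<beta> + \<beta>\<^sup>2) / 3 - 3 * (u - mid)\<^sup>2 + 9/20\<bar> \<le> 3/20"
proof -
  have 1: "(\<beta> - 1/3) * (\<beta> - 1/2) \<le> 0" "0 \<le> (\<beta> - 1/2)\<^sup>2"
    using beta by (auto simp: mult_le_0_iff)
  have "(mid - u)\<^sup>2 \<le> (13/25)\<^sup>2" using assms mid_bounds by (intro power_mono) (auto simp: lo_def)
  hence "3 * (u - mid)\<^sup>2 \<le> 3 * (13/25)\<^sup>2" by (simp add: power2_commute)
  moreover have "(mid - 1/100)\<^sup>2 \<le> (mid - u)\<^sup>2" using assms mid_bounds by (intro power_mono) auto
  hence "3 * (mid - 1/100)\<^sup>2 \<le> 3 * (u - mid)\<^sup>2" by (simp add: power2_commute)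
  moreover have "3 * (mid - 1/100)\<^sup>2 = (1 - \<beta> + \<beta>\<^sup>2) / 3 + 98/100 * \<beta> - 197/10000"
    by (simp add: mid_def power2_eq_square field_simps)
  moreover have "(1 - \<beta> + \<beta>\<^sup>2) / 3 \<ge> 1/4" using 1(2) by (simp add: power2_eq_square algebra_simps)
  moreover have "3 * (13/25 :: real)\<^sup>2 = 507/625" by (simp add: power2_eq_square)
  moreover define R Q where "R = (1 - \<beta> + \<beta>\<^sup>2) / 3" and "Q = (u - mid)\<^sup>2"
  ultimately have "3 * Q \<le> 507/625" "R + 98/100 * \<beta> - 197/10000 \<le> 3 * Q" "R \<ge> 1/4" by metis+
  hence "\<bar>R - 3 * Q + 9/20\<bar> \<le> 3/20" using beta by (intro abs_leI) simp_all
  thus ?thesis by (simp add: R_def Q_def)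
qed

text \<open>The cubic on the window, continued with the slope \<open>- 9/20\<close> in the middle of the admitted slopes.\<close>

definition clamp_u :: "real \<Rightarrow> real" where "clamp_u u = max lo (min (1/100) u)"

definition f_left :: "real \<Rightarrow> real" where "f_left u = cubic \<beta> (clamp_u u) - 9/20 * (u - clamp_u u)"

lemma f_left_eq: "lo \<le> u \<Longrightarrow> u \<le> 1/100 \<Longrightarrow> f_left u = cubic \<beta> u"
  by (simp add: f_left_def clamp_u_def)

lemma f_left_zero [simp]: "f_left 0 = 0"
  using lo_bounds by (simp add: f_left_eq)

lemma f_left_contract: "\<bar>(f_left x + 9/20 * x) - (f_left y + 9/20 * y)\<bar> \<le> 3/20 * \<bar>x - y\<bar>"
proof -
  define n where "n = (\<lambda>u. cubic \<beta> u + 9/20 * u)"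
  have n: "\<bar>n u - n u'\<bar> \<le> 3/20 * (u' - u)" if "lo \<le> u" "u < u'" "u' \<le> 1/100" for u u'
  proof -
    have "\<exists>t. u < t \<and> t < u' \<and> n u' - n u = (u' - u) * ((1 - \<beta> + \<beta>\<^sup>2) / 3 - 3 * (t - mid)\<^sup>2 + 9/20)"
      unfolding n_def by (rule MVT2) (use that in \<open>auto intro!: derivative_eq_intros cubic_deriv\<close>)
    then obtain t where t: "u < t" "t < u'" "n u' - n u = (u' - u) * ((1 - \<beta> + \<beta>\<^sup>2) / 3 - 3 * (t - mid)\<^sup>2 + 9/20)"
      by blast
    have "\<bar>n u' - n u\<bar> \<le> (u' - u) * (3/20)"
      unfolding t(3) abs_mult using t that by (intro mult_mono cubic_deriv_bounds) auto
    thus ?thesis by (simp add: abs_minus_commute)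
  qed
  have "\<bar>n (clamp_u x) - n (clamp_u y)\<bar> \<le> 3/20 * \<bar>clamp_u x - clamp_u y\<bar>"
  proof (cases "clamp_u x" "clamp_u y" rule: linorder_cases)
    case less
    then show ?thesis using n[of "clamp_u x" "clamp_u y"] lo_bounds by (auto simp: clamp_u_def)
  next
    case greater
    then show ?thesis using n[of "clamp_u y" "clamp_u x"] lo_bounds by (auto simp: clamp_u_def abs_minus_commute)
  qed simp
  also have "\<bar>clamp_u x - clamp_u y\<bar> \<le> \<bar>x - y\<bar>" by (auto simp: clamp_u_def max_def min_def)
  finally have "\<bar>n (clamp_u x) - n (clamp_u y)\<bar> \<le> 3/20 * \<bar>x - y\<bar>" by simp
  moreover have "f_left u + 9/20 * u = n (clamp_u u)" for u by (simp add: f_left_def n_def field_simps)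
  ultimately show ?thesis by (simp only:)
qed

lemma f_left_decreasing: "(f_left x - f_left y) * (x - y) \<le> - (3/10) * (x - y)\<^sup>2"
proof -
  have "((f_left x + 9/20 * x) - (f_left y + 9/20 * y)) * (x - y) \<le> (3/20 * \<bar>x - y\<bar>) * \<bar>x - y\<bar>"
    using mult_right_mono[OF f_left_contract[of x y], of "\<bar>x - y\<bar>"] by (simp flip: abs_mult)
  thus ?thesis by (simp add: power2_eq_square field_simps)
qed

lemma f_left_sign: "f_left x * x \<le> - (3/10) * x\<^sup>2"
  using f_left_decreasing[of x 0] by simp

lemma f_left_difference:
  assumes "y \<le> x"
  shows "f_left x - f_left y \<le> - (3/10) * (x - y)" "f_left x - f_left y \<ge> - (3/5) * (x - y)"
proof -
  have "\<bar>(f_left x - f_left y) + 9/20 * (x - y)\<bar> \<le> 3/20 * (x - y)"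
  proof -
    have "(f_left x + 9/20 * x) - (f_left y + 9/20 * y) = (f_left x - f_left y) + 9/20 * (x - y)" by (simp add: field_simps)
    thus ?thesis using f_left_contract[of x y] assms by (simp only: abs_of_nonneg diff_ge_0_iff_ge)
  qed
  thus "f_left x - f_left y \<le> - (3/10) * (x - y)" "f_left x - f_left y \<ge> - (3/5) * (x - y)"
    unfolding abs_le_iff by (auto simp: field_simps)
qed

lemma f_left_le: "x \<ge> 0 \<Longrightarrow> f_left x \<le> - (3/10) * x"
  using f_left_difference[of 0 x] by simp

lemma f_left_ge: "x \<le> 0 \<Longrightarrow> f_left x \<ge> - (3/10) * x"
  using f_left_difference[of x 0] by simp

lemma f_left_le_nonpos: "x \<le> 0 \<Longrightarrow> f_left x \<le> - (3/5) * x"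
  using f_left_difference[of x 0] by simp

lemma f_left_mono: "x \<le> y \<Longrightarrow> f_left y \<le> f_left x"
  using f_left_difference[of x y] by simp

lemma f_left_lipschitz: "\<bar>f_left x - f_left y\<bar> \<le> 3/5 * \<bar>x - y\<bar>"
proof (cases "x \<le> y")
  case True
  then show ?thesis using f_left_difference[OF True] by (simp add: abs_if field_simps)
next
  case False
  then show ?thesis using f_left_difference[of y x] by (simp add: abs_if field_simps)
qed

text \<open>To the left of the window \<open>f_left\<close> exceeds every value that the inhibitor will take; this keeps \<open>u\<close>
  from leaving the window.\<close>

lemma f_left_below_lo: "u < lo \<Longrightarrow> f_left u \<ge> jump + 1/200"
proof -
  have "cubic \<beta> lo = jump + 13/25 * ((13/25)\<^sup>2 - (1 - \<beta> + \<beta>\<^sup>2) / 3)"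
    by (simp add: jump_def lo_def mid_def cubic_def power2_eq_square field_simps)
  moreover have "(\<beta> - 1/3) * (\<beta> - 2/3) \<le> 0" using beta by (auto simp: mult_le_0_iff)
  hence "(1 - \<beta> + \<beta>\<^sup>2) / 3 \<le> 7/27" by (simp add: power2_eq_square field_simps)
  moreover define R where "R = (1 - \<beta> + \<beta>\<^sup>2) / 3"
  ultimately have "cubic \<beta> lo = jump + 13/25 * ((13/25)\<^sup>2 - R)" "R \<le> 7/27" by metis+
  hence "cubic \<beta> lo \<ge> jump + 1/200" by (simp add: power2_eq_square field_simps)
  moreover assume "u < lo"
  ultimately show ?thesis using f_left_mono[of u lo] lo_bounds by (simp add: f_left_eq)
qed

text \<open>Truncating \<open>v\<close> in the cubic term makes the inhibitor reaction globally Lipschitz with a small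
  constant.\<close>

definition clamp_v :: "real \<Rightarrow> real" where "clamp_v v = max (-1/10) (min (1/10) v)"
definition g_out :: "real \<Rightarrow> real \<Rightarrow> real" where "g_out \<gamma> v = \<gamma> * v + clamp_v v ^ 3"

lemma g_out_eq: "\<bar>v\<bar> \<le> 1/10 \<Longrightarrow> g_out \<gamma> v = \<gamma> * v + v ^ 3"
  by (auto simp: g_out_def clamp_v_def)

lemma clamp_v_cube:
  shows "0 \<le> (clamp_v x ^ 3 - clamp_v y ^ 3) * (x - y)"
    and "\<bar>clamp_v x ^ 3 - clamp_v y ^ 3\<bar> \<le> 3/100 * \<bar>x - y\<bar>"
proof -
  let ?a = "clamp_v x" and ?b = "clamp_v y"
  have b: "\<bar>?a\<bar> \<le> 1/10" "\<bar>?b\<bar> \<le> 1/10" by (auto simp: clamp_v_def)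
  have fac: "?a ^ 3 - ?b ^ 3 = (?a - ?b) * (?a\<^sup>2 + ?a * ?b + ?b\<^sup>2)"
    by (simp add: power2_eq_square power3_eq_cube algebra_simps)
  have "?a\<^sup>2 + ?a * ?b + ?b\<^sup>2 = (?a + ?b / 2)\<^sup>2 + 3/4 * ?b\<^sup>2"
    by (simp add: power2_eq_square field_simps)
  hence pos: "?a\<^sup>2 + ?a * ?b + ?b\<^sup>2 \<ge> 0" by simp
  have "?a\<^sup>2 \<le> 1/100" "?b\<^sup>2 \<le> 1/100"
    using b power_mono[of "\<bar>?a\<bar>" "1/10" 2] power_mono[of "\<bar>?b\<bar>" "1/10" 2] by (simp_all add: power_divide)
  moreover have "\<bar>?a * ?b\<bar> \<le> 1/10 * (1/10)" unfolding abs_mult using b by (intro mult_mono) auto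
  ultimately have le: "?a\<^sup>2 + ?a * ?b + ?b\<^sup>2 \<le> 3/100" by (simp add: abs_le_iff)
  have "(?a - ?b) * (x - y) \<ge> 0"
    by (cases "x \<le> y") (auto simp: clamp_v_def mult_nonneg_nonneg mult_nonpos_nonpos)
  hence "0 \<le> ((?a - ?b) * (x - y)) * (?a\<^sup>2 + ?a * ?b + ?b\<^sup>2)" using pos by (rule mult_nonneg_nonneg)
  thus "0 \<le> (?a ^ 3 - ?b ^ 3) * (x - y)" unfolding fac by (simp only: mult_ac)
  have "\<bar>?a - ?b\<bar> \<le> \<bar>x - y\<bar>" by (auto simp: clamp_v_def max_def min_def)
  thus "\<bar>?a ^ 3 - ?b ^ 3\<bar> \<le> 3/100 * \<bar>x - y\<bar>" unfolding fac abs_mult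
    using pos le by (subst mult.commute) (intro mult_mono, auto)
qed

lemma g_out_zero [simp]: "g_out \<gamma> 0 = 0"
  by (simp add: g_out_def clamp_v_def)

lemma g_out_increasing: "(g_out \<gamma> x - g_out \<gamma> y) * (x - y) \<ge> \<gamma> * (x - y)\<^sup>2"
  using clamp_v_cube(1)[of x y] by (simp add: g_out_def power2_eq_square algebra_simps)

lemma g_out_sign: "g_out \<gamma> x * x \<ge> \<gamma> * x\<^sup>2"
  using g_out_increasing[of \<gamma> x 0] by simp

lemma g_out_lipschitz:
  assumes "0 < \<gamma>" "\<gamma> \<le> 1/100"
  shows "\<bar>g_out \<gamma> x - g_out \<gamma> y\<bar> \<le> 1/25 * \<bar>x - y\<bar>"
proof -
  have "\<bar>\<gamma> * (x - y)\<bar> \<le> 1/100 * \<bar>x - y\<bar>" unfolding abs_mult using assms by (intro mult_right_mono) auto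
  moreover have "g_out \<gamma> x - g_out \<gamma> y = \<gamma> * (x - y) + (clamp_v x ^ 3 - clamp_v y ^ 3)"
    by (simp add: g_out_def algebra_simps)
  ultimately show ?thesis using clamp_v_cube(2)[of x y]
      abs_triangle_ineq[of "\<gamma> * (x - y)" "clamp_v x ^ 3 - clamp_v y ^ 3"] by linarith
qed

lemma g_out_abs:
  assumes "0 < \<gamma>" "\<gamma> \<le> 1/100"
  shows "\<bar>g_out \<gamma> x\<bar> \<le> 1/25 * \<bar>x\<bar>"
  using g_out_lipschitz[OF assms, of x 0] by simp

section \<open>Solutions of the half problems\<close>

text \<open>One side of the pulse: \<open>u\<close> is pinned to \<open>0\<close> and \<open>v\<close> to \<open>q\<close> at the point where the transition layer is
  attached.\<close>

definition half_solution ::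
  "far_end \<Rightarrow> real \<Rightarrow> real \<Rightarrow> (real \<Rightarrow> real) \<Rightarrow> real \<Rightarrow> (real \<Rightarrow> real) \<Rightarrow> (real \<Rightarrow> real) \<Rightarrow> (real \<Rightarrow> real) \<Rightarrow> (real \<Rightarrow> real) \<Rightarrow> bool"
  where "half_solution e K1 K2 g q u u1 v v1 \<longleftrightarrow>
    deriv2_on (domain e) u u1 (\<lambda>x. K1 * (v x - f_left (u x))) \<and> far_cond e u u1 \<and> u 0 = 0 \<and>
    deriv2_on (domain e) v v1 (\<lambda>x. K2 * (g (v x) - u x)) \<and> far_cond e v v1 \<and> v 0 = q"

lemma half_solutionD:
  assumes "half_solution e K1 K2 g q u u1 v v1"
  shows "deriv2_on (domain e) u u1 (\<lambda>x. K1 * (v x - f_left (u x)))" "far_cond e u u1" "u 0 = 0"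
    "deriv2_on (domain e) v v1 (\<lambda>x. K2 * (g (v x) - u x))" "far_cond e v v1" "v 0 = q"
  using assms by (auto simp: half_solution_def)

lemma activator_bound:
  assumes s: "half_solution e K1 K2 g q u u1 v v1" and K: "K1 > 0"
    and M: "\<And>x. x \<in> domain e \<Longrightarrow> \<bar>v x\<bar> \<le> M" and x: "x \<in> domain e"
  shows "\<bar>u x\<bar> \<le> 10/3 * M"
proof (rule abs_max_principle[OF half_solutionD(1)[OF s] _ half_solutionD(2)[OF s] _ _ x])
  have "M \<ge> 0" using M[OF x] by linarith
  thus "\<bar>u 0\<bar> \<le> 10/3 * M" using half_solutionD(3)[OF s] by simp
  fix y assume y: "y \<in> domain e"
  show "K1 * (v y - f_left (u y)) > 0" if "u y > 10/3 * M"
    using that M[OF y] f_left_le[of "u y"] \<open>M \<ge> 0\<close> K by (intro mult_pos_pos) auto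
  show "K1 * (v y - f_left (u y)) < 0" if "u y < - (10/3 * M)"
    using that M[OF y] f_left_ge[of "u y"] \<open>M \<ge> 0\<close> K by (intro mult_pos_neg) (auto simp: abs_le_iff)
qed

lemma activator_lower:
  assumes s: "half_solution e K1 K2 g q u u1 v v1" and K: "K1 > 0"
    and M: "\<And>x. x \<in> domain e \<Longrightarrow> v x < jump + 1/200" and x: "x \<in> domain e"
  shows "lo \<le> u x"
proof (rule min_principle[OF half_solutionD(1)[OF s] _ half_solutionD(2)[OF s] _ x])
  show "lo \<le> u 0" using half_solutionD(3)[OF s] lo_bounds by simp
  fix y assume y: "y \<in> domain e" "u y < lo"
  show "K1 * (v y - f_left (u y)) < 0"
    using M[OF y(1)] f_left_below_lo[OF y(2)] K by (intro mult_pos_neg) auto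
qed

text \<open>The parabola \<open>W\<close> below has minimum \<open>- q0 / 4\<close>. Wherever \<open>u > W\<close>, therefore \<open>f_left u < q0 / 2\<close>, and then
  \<open>u'' > K * q0 / 2 = W''\<close>. So \<open>u - W\<close> has no positive maximum; \<open>u\<close> lies below \<open>W\<close> and starts with at
  most its slope.\<close>

lemma initial_slope:
  assumes u: "deriv2_on {0..x0} u u1 (\<lambda>x. K * (v x - f_left (u x)))" "u 0 = 0"
    and K: "K > 0" and x0: "x0 > 0" and q0: "q0 > 0"
    and v: "\<And>x. 0 \<le> x \<Longrightarrow> x \<le> x0 \<Longrightarrow> v x \<ge> q0"
    and M: "u x0 \<le> q0 / 4 * (K * x0\<^sup>2) - q0 / 2 * (sqrt K * x0)"
  shows "u1 0 \<le> - (q0 / 2) * sqrt K"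
proof -
  define W where "W = (\<lambda>x. - (q0 / 2) * sqrt K * x + q0 / 4 * K * x\<^sup>2)"
  have Wlow: "W x \<ge> - q0 / 4" for x
  proof -
    have "W x + q0 / 4 = q0 / 4 * (sqrt K * x - 1)\<^sup>2"
      using K by (simp add: W_def power2_eq_square algebra_simps)
    moreover have "\<dots> \<ge> 0" using q0 by simp
    ultimately show ?thesis by linarith
  qed
  have le: "u x - W x \<le> 0" if "0 \<le> x" "x \<le> x0" for x
  proof (rule interior_max_principle[where b=x0 and z="\<lambda>x. u x - W x" and ?z1.0="\<lambda>x. u1 x - (- (q0 / 2) * sqrt K + q0 / 2 * K * x)"
        and ?z2.0="\<lambda>x. K * (v x - f_left (u x)) - q0 / 2 * K"])
    fix x assume x: "0 \<le> x" "x \<le> x0"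
    show "((\<lambda>x. u x - W x) has_real_derivative u1 x - (- (q0 / 2) * sqrt K + q0 / 2 * K * x)) (at x)"
      using u(1) x unfolding deriv2_on_def W_def by (auto intro!: derivative_eq_intros)
    show "((\<lambda>x. u1 x - (- (q0 / 2) * sqrt K + q0 / 2 * K * x)) has_real_derivative K * (v x - f_left (u x)) - q0 / 2 * K) (at x)"
      using u(1) x unfolding deriv2_on_def by (auto intro!: derivative_eq_intros)
  next
    fix x assume x: "0 < x" "x \<le> x0" "u x - W x > 0"
    have "f_left (u x) < q0 / 2"
    proof (cases "u x \<ge> 0")
      case True
      then show ?thesis using f_left_le[OF True] q0 by linarith
    next
      case False
      then show ?thesis using f_left_le_nonpos[of "u x"] x Wlow[of x] q0 by linarith
    qed
    hence "v x - f_left (u x) > q0 / 2" using v[of x] x by linarith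
    hence "K * (v x - f_left (u x)) > K * (q0 / 2)" using K by (rule mult_strict_left_mono)
    thus "K * (v x - f_left (u x)) - q0 / 2 * K > 0" by (simp add: mult.commute)
  next
    have "W x0 = q0 / 4 * (K * x0\<^sup>2) - q0 / 2 * (sqrt K * x0)" by (simp add: W_def)
    thus "u x0 - W x0 \<le> 0 \<or> u1 x0 - (- (q0 / 2) * sqrt K + q0 / 2 * K * x0) = 0" using M by linarith
  qed (use that u in \<open>auto simp: W_def\<close>)
  have "u1 0 - (- (q0 / 2) * sqrt K) \<le> 0"
  proof (rule derivative_at_touching_0)
    show "((\<lambda>x. u x - W x) has_real_derivative u1 0 - (- (q0 / 2) * sqrt K)) (at 0)"
      using u(1) x0 unfolding deriv2_on_def W_def by (auto intro!: derivative_eq_intros)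
  qed (use le x0 u in \<open>auto simp: W_def\<close>)
  thus ?thesis by simp
qed

text \<open>The line with slope \<open>C'\<close> is a barrier for \<open>u - u'\<close>: above it the monotonicity of \<open>f_left\<close> outweighs
  the difference of the inhibitors.\<close>

lemma slope_comparison:
  assumes u: "deriv2_on {0..x0} u u1 (\<lambda>x. K * (v x - f_left (u x)))" "u 0 = 0"
    and u': "deriv2_on {0..x0} u' u1' (\<lambda>x. K * (v' x - f_left (u' x)))" "u' 0 = 0"
    and K: "K > 0" and x0: "x0 > 0"
    and v: "\<And>x. 0 \<le> x \<Longrightarrow> x \<le> x0 \<Longrightarrow> v x - v' x \<ge> - C * x"
    and C: "C \<ge> 0" "C \<le> 3/10 * C'" and M: "u x0 - u' x0 \<le> C' * x0"
  shows "u1 0 - u1' 0 \<le> C'"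
proof -
  define z where "z = (\<lambda>x. u x - u' x - C' * x)"
  have d: "(z has_real_derivative u1 x - u1' x - C') (at x)"
    "((\<lambda>x. u1 x - u1' x - C') has_real_derivative K * (v x - f_left (u x)) - K * (v' x - f_left (u' x))) (at x)"
    if "0 \<le> x" "x \<le> x0" for x
    using u(1) u'(1) that unfolding deriv2_on_def z_def by (auto intro!: derivative_eq_intros)
  have le: "z x \<le> 0" if "0 \<le> x" "x \<le> x0" for x
  proof (rule interior_max_principle[OF d])
    fix x assume x: "0 < x" "x \<le> x0" "z x > 0"
    have U: "u x - u' x > C' * x" using x by (simp add: z_def)
    have "C' * x \<ge> 0" using C x by (intro mult_nonneg_nonneg) auto
    have "f_left (u x) - f_left (u' x) \<le> - (3/10 * u x) + 3/10 * u' x"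
      using f_left_difference(1)[of "u' x" "u x"] U \<open>C' * x \<ge> 0\<close> by (simp add: field_simps)
    moreover have "C * x \<le> 3/10 * (C' * x)" using C x mult_right_mono[OF C(2), of x] by simp
    moreover have "v x - v' x \<ge> - (C * x)" using v[of x] x by simp
    ultimately have "(v x - f_left (u x)) - (v' x - f_left (u' x)) > 0" using U by linarith
    hence "K * ((v x - f_left (u x)) - (v' x - f_left (u' x))) > 0" using K by simp
    thus "K * (v x - f_left (u x)) - K * (v' x - f_left (u' x)) > 0" by (simp add: algebra_simps)
  qed (use that M u u' in \<open>auto simp: z_def\<close>)
  have "u1 0 - u1' 0 - C' \<le> 0"
    by (rule derivative_at_touching_0[OF d(1) _ x0]) (use le x0 u u' in \<open>auto simp: z_def\<close>)
  thus ?thesis by simp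
qed

end

section \<open>The tail and the core of the pulse\<close>

context cubic_parameter
begin

lemma half_solution_exists:
  assumes K: "0 < K2" "1000 * K2 \<le> K1" and g: "\<And>x y. \<bar>g x - g y\<bar> \<le> 1/25 * \<bar>x - y\<bar>"
  shows "\<exists>u u1 v v1. half_solution e K1 K2 g q u u1 v v1"
  using half_problem_exists[OF K f_left_contract g, of e 0 q] unfolding half_solution_def by blast

lemma deriv2_on_subset: "deriv2_on D z z1 z2 \<Longrightarrow> D' \<subseteq> D \<Longrightarrow> deriv2_on D' z z1 z2"
  by (auto simp: deriv2_on_def)

text \<open>The tail of the pulse, with \<open>\<epsilon> = sqrt d\<close> and the pinned end shifted to \<open>0\<close>.\<close>

definition outer_solution where
  "outer_solution \<gamma> \<epsilon> q u u1 v v1 \<longleftrightarrow> half_solution Unbounded (1 / \<epsilon>\<^sup>2) 1 (g_out \<gamma>) q u u1 v v1"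

text \<open>Energy decay bounds \<open>v\<close> by \<open>q\<close>, and the maximum principle then bounds \<open>u\<close>. Since \<open>v\<close> is at least a small
  negative multiple of \<open>\<epsilon>\<close>, \<open>u\<close> cannot rise above \<open>1/100\<close>; since \<open>v \<le> q < jump + 1/200\<close>, it cannot fall below
  \<open>lo\<close>. The upper bound for \<open>v1 0\<close> comes from the slope of the decay estimate at \<open>0\<close>, the lower one from
  Taylor's formula: a steeper start would make \<open>v\<close> too negative.\<close>

lemma outer_solution_props:
  assumes s: "outer_solution \<gamma> \<epsilon> q u u1 v v1" and \<gamma>: "0 < \<gamma>" "\<gamma> \<le> 1/100"
    and \<epsilon>: "0 < \<epsilon>" "\<epsilon> \<le> 1/100" and q: "19/20 * jump \<le> q" "q \<le> 21/20 * jump"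
  shows outer_decay: "\<And>x. x \<ge> 0 \<Longrightarrow> (v x)\<^sup>2 + \<epsilon>\<^sup>2 * (u x)\<^sup>2 \<le> q\<^sup>2 * exp (- sqrt (2 * \<gamma>) * x)"
    and outer_v_abs: "\<And>x. x \<ge> 0 \<Longrightarrow> \<bar>v x\<bar> \<le> q"
    and outer_u_abs: "\<And>x. x \<ge> 0 \<Longrightarrow> \<bar>u x\<bar> \<le> 10/3 * q"
    and outer_u_range: "\<And>x. x \<ge> 0 \<Longrightarrow> lo \<le> u x \<and> u x \<le> 1/100"
    and outer_v1_upper: "v1 0 \<le> - (sqrt (2 * \<gamma>) / 2) * q"
    and outer_v1_lower: "v1 0 \<ge> - 27/10 * q"
    and outer_v_near_0: "\<And>x. 0 \<le> x \<Longrightarrow> x \<le> 1 \<Longrightarrow> v x \<ge> q - x"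
    and outer_v2: "\<And>x. x \<ge> 0 \<Longrightarrow> \<bar>g_out \<gamma> (v x) - u x\<bar> \<le> 338/100 * q"
proof -
  note S = half_solutionD[OF s[unfolded outer_solution_def]]
  have q0: "0 < q" "q \<le> 3/100" using q jump_bounds by auto
  have K: "0 < 1 / \<epsilon>\<^sup>2" using \<epsilon> by simp
  have e2: "\<epsilon>\<^sup>2 \<le> 1/10000" using power_mono[of \<epsilon> "1/100" 2] \<epsilon> by (simp add: power_divide)
  define k where "k = sqrt (2 * \<gamma>)"
  have k: "k > 0" "k\<^sup>2 = 2 * \<gamma>" using \<gamma> by (auto simp: k_def)
  have K1: "1 / \<epsilon>\<^sup>2 \<ge> 10000" using e2 \<epsilon> by (simp add: field_simps)
  have en: "energy (1 / \<epsilon>\<^sup>2) 1 u v x = (v x)\<^sup>2 + \<epsilon>\<^sup>2 * (u x)\<^sup>2" for x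
    by (simp add: energy_def mult.commute)
  have dec: "(v x)\<^sup>2 + \<epsilon>\<^sup>2 * (u x)\<^sup>2 \<le> q\<^sup>2 * exp (- k * x)" if "x \<ge> 0" for x
  proof -
    have "energy (1 / \<epsilon>\<^sup>2) 1 u v x \<le> energy (1 / \<epsilon>\<^sup>2) 1 u v 0 * exp (- k * x)"
      by (rule energy_decay[OF K _ _ _ k(1) _ _ S(1,2) S(4,5) that, where cF="3/10" and cg=\<gamma>])
        (use k K1 \<gamma> g_out_sign f_left_sign in \<open>auto simp: mult.commute\<close>)
    thus ?thesis unfolding en using S(3,6) by simp
  qed
  show "(v x)\<^sup>2 + \<epsilon>\<^sup>2 * (u x)\<^sup>2 \<le> q\<^sup>2 * exp (- sqrt (2 * \<gamma>) * x)" if "x \<ge> 0" for x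
    using dec[OF that] by (simp add: k_def)
  show v_abs: "\<bar>v x\<bar> \<le> q" if "x \<ge> 0" for x
  proof -
    have "(v x)\<^sup>2 \<le> (v x)\<^sup>2 + \<epsilon>\<^sup>2 * (u x)\<^sup>2" by simp
    also have "\<dots> \<le> q\<^sup>2 * exp (- k * x)" by (rule dec[OF that])
    also have "\<dots> \<le> q\<^sup>2" using k that by (simp add: mult_left_le)
    finally show ?thesis using q0 by (simp add: abs_le_square_iff[symmetric])
  qed
  show u_abs: "\<bar>u x\<bar> \<le> 10/3 * q" if "x \<ge> 0" for x
    by (rule activator_bound[OF s[unfolded outer_solution_def] K]) (use v_abs that in auto)
  have v_low: "v x \<ge> - (\<epsilon> * (10/3 * q))" if "x \<ge> 0" for x
  proof -
    have "v x \<ge> - sqrt (1 / (1 / \<epsilon>\<^sup>2)) * (10/3 * q)"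
      by (rule inhibitor_lower_bound[OF K _ _ _ _ _ S(1,2) S(4,5) _ _ that, where cF="3/10" and cg=\<gamma>])
        (use \<gamma> g_out_sign f_left_sign u_abs S(6) q0 in auto)
    thus ?thesis using \<epsilon> by simp
  qed
  have v_low': "v x \<ge> - (3/1000)" if "x \<ge> 0" for x
  proof -
    have "\<epsilon> * (10/3 * q) \<le> 1/100 * (10/3 * (3/100))" using \<epsilon> q0 by (intro mult_mono) auto
    thus ?thesis using v_low[OF that] by simp
  qed
  have u_up: "u x \<le> 1/100" if "x \<ge> 0" for x
  proof (rule max_principle[OF S(1) _ S(2)])
    fix y assume y: "y \<in> domain Unbounded" "0 < y" "u y > 1/100"
    have "f_left (u y) < - (3/1000)" using f_left_le[of "u y"] y by simp
    hence "v y - f_left (u y) > 0" using v_low'[of y] y by simp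
    thus "1 / \<epsilon>\<^sup>2 * (v y - f_left (u y)) > 0" using K by (rule mult_pos_pos[rotated])
  qed (use S(3) that in auto)
  have u_lo: "lo \<le> u x" if "x \<ge> 0" for x
  proof (rule activator_lower[OF s[unfolded outer_solution_def] K])
    fix y assume "y \<in> domain Unbounded"
    thus "v y < jump + 1/200" using v_abs[of y] q jump_bounds by (simp add: abs_le_iff)
  qed (use that in auto)
  show "lo \<le> u x \<and> u x \<le> 1/100" if "x \<ge> 0" for x using u_up u_lo that by auto
  show v2: "\<bar>g_out \<gamma> (v x) - u x\<bar> \<le> 338/100 * q" if "x \<ge> 0" for x
    using g_out_abs[OF \<gamma>, of "v x"] v_abs[OF that] u_abs[OF that]
      abs_triangle_ineq4[of "g_out \<gamma> (v x)" "u x"] q0 by simp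
  show "v1 0 \<le> - (sqrt (2 * \<gamma>) / 2) * q"
  proof -
    have d: "(v has_real_derivative v1 0) (at 0)" "(u has_real_derivative u1 0) (at 0)"
      using S(1,4) by (auto simp: deriv2_on_def)
    have "2 * v 0 * v1 0 + \<epsilon>\<^sup>2 * (2 * u 0 * u1 0) + k * q\<^sup>2 \<le> 0"
    proof (rule derivative_at_touching_0[where b=1])
      show "((\<lambda>x. (v x)\<^sup>2 + \<epsilon>\<^sup>2 * (u x)\<^sup>2 - q\<^sup>2 * exp (- k * x)) has_real_derivative
          2 * v 0 * v1 0 + \<epsilon>\<^sup>2 * (2 * u 0 * u1 0) + k * q\<^sup>2) (at 0)"
        using d by (auto intro!: derivative_eq_intros)
    qed (use dec S in auto)
    hence "q * (2 * v1 0 + k * q) \<le> 0" using S by (simp add: power2_eq_square algebra_simps)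
    hence "2 * v1 0 + k * q \<le> 0" using q0 by (simp add: mult_le_0_iff)
    thus ?thesis by (simp add: k_def)
  qed
  have d2: "deriv2_on {0..1} v v1 (\<lambda>x. 1 * (g_out \<gamma> (v x) - u x))"
    by (rule deriv2_on_subset[OF S(4)]) auto
  show v1l: "v1 0 \<ge> - 27/10 * q"
  proof -
    have "v (3/4) \<le> v 0 + v1 0 * (3/4) + (338/100 * q) * (3/4)\<^sup>2 / 2"
      by (rule taylor_upper[OF d2]) (use abs_le_D1[OF v2] in auto)
    moreover have "\<epsilon> * (10/3 * q) \<le> 1/100 * (10/3 * q)" using \<epsilon> q0 by (intro mult_right_mono) auto
    hence "v (3/4) \<ge> - (1/30 * q)" using v_low[of "3/4"] by simp
    ultimately show ?thesis using S(6) q0 by (simp add: power2_eq_square)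
  qed
  show "v x \<ge> q - x" if "0 \<le> x" "x \<le> 1" for x
  proof -
    have "- v x \<le> - v 0 + - v1 0 * x + (338/100 * q) * x\<^sup>2 / 2"
      by (rule taylor_upper[OF deriv2_on_neg[OF d2] _ that]) (use abs_le_D2[OF v2] in auto)
    moreover have "- v1 0 * x \<le> 27/10 * q * x" using v1l that by (intro mult_right_mono) auto
    moreover have "q * x\<^sup>2 \<le> q * x" using that q0 by (intro mult_left_mono) (auto simp: power2_eq_square mult_left_le)
    moreover have "q * x \<le> 3/100 * x" using that q0 by (intro mult_right_mono) auto
    ultimately show ?thesis using S(6) that by (simp add: field_simps)
  qed
qed

lemma outer_exists:
  assumes "0 < \<gamma>" "\<gamma> \<le> 1/100" "0 < \<epsilon>" "\<epsilon> \<le> 1/100"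
  shows "\<exists>u u1 v v1. outer_solution \<gamma> \<epsilon> q u u1 v v1"
proof -
  have "\<epsilon>\<^sup>2 \<le> 1/10000" using power_mono[of \<epsilon> "1/100" 2] assms by (simp add: power_divide)
  thus ?thesis unfolding outer_solution_def
    using assms by (intro half_solution_exists g_out_lipschitz) (auto simp: field_simps)
qed

text \<open>The core of the pulse around its centre, seen through the point reflection
  \<open>(u, v) \<mapsto> (2 * mid - u, 2 * jump - v)\<close>, with its half length \<open>l\<close> scaled to one and the pinned end at \<open>0\<close>.
  The reflection turns \<open>f\<close> on the right branch into \<open>f_left\<close> and the inhibitor reaction \<open>g_out\<close> into
  \<open>g_in\<close>.\<close>

definition g_in :: "real \<Rightarrow> real \<Rightarrow> real" where
  "g_in \<gamma> v = 2 * mid - g_out \<gamma> (2 * jump - v)"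

lemma g_in_lipschitz:
  assumes "0 < \<gamma>" "\<gamma> \<le> 1/100"
  shows "\<bar>g_in \<gamma> x - g_in \<gamma> y\<bar> \<le> 1/25 * \<bar>x - y\<bar>"
  using g_out_lipschitz[OF assms, of "2 * jump - y" "2 * jump - x"] by (simp add: g_in_def)

lemma g_in_increasing: "(g_in \<gamma> x - g_in \<gamma> y) * (x - y) \<ge> \<gamma> * (x - y)\<^sup>2"
  using g_out_increasing[of \<gamma> "2 * jump - y" "2 * jump - x"] by (simp add: g_in_def)

definition inner_solution where
  "inner_solution \<gamma> \<epsilon> l q u u1 v v1 \<longleftrightarrow> half_solution Reflecting (l\<^sup>2 / \<epsilon>\<^sup>2) (l\<^sup>2) (g_in \<gamma>) q u u1 v v1"

text \<open>As \<open>l\<^sup>2\<close> is small against \<open>jump\<close>, the inhibitor hardly changes over the core. A first bound for the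
  maximum \<open>M\<close> of \<open>\<bar>v\<bar>\<close> bounds \<open>u\<close> and \<open>v''\<close> in terms of \<open>M\<close>, and integrating from the reflecting end bounds
  \<open>M\<close>. With that, \<open>v''\<close> turns out to be comparable with \<open>l\<^sup>2 * 2 * mid\<close>, which gives the ranges and, for the slope at
  the pinned end, a value of the order \<open>- l\<^sup>2\<close>.\<close>

lemma inner_solution_props:
  assumes s: "inner_solution \<gamma> \<epsilon> l q u u1 v v1" and \<gamma>: "0 < \<gamma>" "\<gamma> \<le> 1/100"
    and \<epsilon>: "0 < \<epsilon>" "\<epsilon> \<le> 1/100" and q: "19/20 * jump \<le> q" "q \<le> 21/20 * jump"
    and l: "0 < l" "l \<le> 7/2 * jump"
  shows inner_v_range: "\<And>t. 0 \<le> t \<Longrightarrow> t \<le> 1 \<Longrightarrow> jump / 2 \<le> v t \<and> v t \<le> q"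
    and inner_u_range: "\<And>t. 0 \<le> t \<Longrightarrow> t \<le> 1 \<Longrightarrow> lo \<le> u t \<and> u t \<le> 0"
    and inner_v1_upper: "v1 0 \<le> - (88/100) * l\<^sup>2"
    and inner_v1_lower: "v1 0 \<ge> - (12/10) * l\<^sup>2"
    and inner_v_near_0: "\<And>t. 0 \<le> t \<Longrightarrow> t \<le> 1 \<Longrightarrow> v t \<ge> q - 12/10 * l\<^sup>2 * t"
    and inner_v2: "\<And>t. 0 \<le> t \<Longrightarrow> t \<le> 1 \<Longrightarrow> \<bar>g_in \<gamma> (v t) - u t\<bar> \<le> 12/10"
proof -
  note S = half_solutionD[OF s[unfolded inner_solution_def]]
  have K: "l\<^sup>2 / \<epsilon>\<^sup>2 > 0" "l\<^sup>2 > 0" using \<epsilon> l by auto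
  have l2: "l\<^sup>2 \<le> 341/1000 * jump"
  proof -
    have "l\<^sup>2 \<le> (7/2 * jump)\<^sup>2" using l by (intro power_mono) auto
    also have "\<dots> = 49/4 * (jump * jump)" by (simp add: power2_eq_square)
    also have "\<dots> \<le> 49/4 * (1/36 * jump)" using jump_bounds by (intro mult_left_mono mult_right_mono) auto
    finally show ?thesis using jump_bounds by simp
  qed
  have dv: "(v has_real_derivative v1 t) (at t)" "(v1 has_real_derivative l\<^sup>2 * (g_in \<gamma> (v t) - u t)) (at t)"
    if "0 \<le> t" "t \<le> 1" for t using S(4) that by (auto simp: deriv2_on_def)
  have v11: "v1 1 = 0" using S(5) by simp
  \<comment> \<open>The slope of \<open>v\<close> is recovered from the second derivative by the reflecting condition, and \<open>v\<close> from
    its slope by the pinned value.\<close>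
  have v1: "\<exists>s. t \<le> s \<and> s \<le> 1 \<and> v1 t = - ((1 - t) * (l\<^sup>2 * (g_in \<gamma> (v s) - u s)))" if t: "0 \<le> t" "t \<le> 1" for t
  proof (cases "t = 1")
    case False
    have "\<exists>s. t < s \<and> s < 1 \<and> v1 1 - v1 t = (1 - t) * (l\<^sup>2 * (g_in \<gamma> (v s) - u s))"
      using t False by (intro MVT2) (auto intro!: dv)
    thus ?thesis using v11 by (metis diff_0 less_imp_le minus_minus)
  qed (use v11 in auto)
  have v0: "\<exists>s. 0 \<le> s \<and> s \<le> 1 \<and> v t = q + t * v1 s" if t: "0 \<le> t" "t \<le> 1" for t
  proof (cases "t = 0")
    case False
    have "\<exists>s. 0 < s \<and> s < t \<and> v t - v 0 = (t - 0) * v1 s"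
      using t False by (intro MVT2) (auto intro!: dv)
    then obtain s where "0 < s" "s < t" "v t = q + t * v1 s" using S(6) by auto
    thus ?thesis using t by (intro exI[of _ s]) auto
  qed (use S(6) in auto)
  have v1_bound: "- (G * l\<^sup>2) \<le> v1 t \<and> v1 t \<le> G * l\<^sup>2"
    if G: "\<And>s. 0 \<le> s \<Longrightarrow> s \<le> 1 \<Longrightarrow> \<bar>g_in \<gamma> (v s) - u s\<bar> \<le> G" and t: "0 \<le> t" "t \<le> 1" for G t
  proof -
    obtain s where s: "t \<le> s" "s \<le> 1" "v1 t = - ((1 - t) * (l\<^sup>2 * (g_in \<gamma> (v s) - u s)))" using v1[OF t] by blast
    have "\<bar>v1 t\<bar> \<le> 1 * (l\<^sup>2 * G)"
      unfolding s(3) abs_minus_cancel abs_mult using s t G[of s] by (intro mult_mono) auto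
    thus ?thesis by (auto simp: abs_le_iff mult.commute)
  qed
  have "continuous_on {0..1} (\<lambda>t. \<bar>v t\<bar>)"
    by (intro continuous_on_rabs continuous_at_imp_continuous_on ballI DERIV_isCont[OF dv(1)]) auto
  then obtain t0 where t0: "0 \<le> t0" "t0 \<le> 1" "\<And>t. 0 \<le> t \<Longrightarrow> t \<le> 1 \<Longrightarrow> \<bar>v t\<bar> \<le> \<bar>v t0\<bar>"
    using continuous_attains_sup[of "{0..1::real}" "\<lambda>t. \<bar>v t\<bar>"] by auto
  define M where "M = \<bar>v t0\<bar>"
  have M0: "M \<ge> 0" by (simp add: M_def)
  have vM: "\<bar>v t\<bar> \<le> M" if "0 \<le> t" "t \<le> 1" for t using t0 that by (auto simp: M_def)
  have uM: "\<bar>u t\<bar> \<le> 10/3 * M" if "0 \<le> t" "t \<le> 1" for t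
    by (rule activator_bound[OF s[unfolded inner_solution_def] K(1)]) (use vM that in auto)
  have giM: "\<bar>g_in \<gamma> (v t) - 2 * mid\<bar> \<le> 1/25 * (2 * jump + M)" if "0 \<le> t" "t \<le> 1" for t
  proof -
    have "\<bar>2 * jump - v t\<bar> \<le> 2 * jump + M" using vM[OF that] jump_bounds by (simp add: abs_le_iff)
    thus ?thesis using g_out_abs[OF \<gamma>, of "2 * jump - v t"] by (simp add: g_in_def)
  qed
  have G1: "\<bar>g_in \<gamma> (v t) - u t\<bar> \<le> 101/100 + 34/10 * M" if "0 \<le> t" "t \<le> 1" for t
    using giM[OF that, unfolded abs_le_iff] uM[OF that, unfolded abs_le_iff] mid_bounds jump_bounds M0
    by (simp add: abs_le_iff)
  have M: "M \<le> 1/20"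
  proof -
    obtain s where s: "0 \<le> s" "s \<le> 1" "v t0 = q + t0 * v1 s" using v0[OF t0(1,2)] by blast
    have "\<bar>t0 * v1 s\<bar> \<le> 1 * ((101/100 + 34/10 * M) * l\<^sup>2)"
      unfolding abs_mult using v1_bound[OF G1 s(1,2)] t0 by (intro mult_mono) (auto simp: abs_le_iff)
    also have "\<dots> \<le> 1 * ((101/100 + 34/10 * M) * (1/100))"
      using l2 jump_bounds vM[of 0] by (intro mult_left_mono) auto
    finally have "\<bar>t0 * v1 s\<bar> \<le> 101/10000 + 34/1000 * M" by (simp add: field_simps)
    moreover have "M \<le> q + \<bar>t0 * v1 s\<bar>"
      using s(3) q jump_bounds abs_triangle_ineq[of q "t0 * v1 s"] by (simp add: M_def)
    ultimately have "M \<le> q + (101/10000 + 34/1000 * M)" by linarith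
    thus ?thesis using q jump_bounds by (simp add: field_simps)
  qed
  have G2: "71/100 \<le> g_in \<gamma> (v t) - u t \<and> g_in \<gamma> (v t) - u t \<le> 12/10" if "0 \<le> t" "t \<le> 1" for t
    using giM[OF that, unfolded abs_le_iff] uM[OF that, unfolded abs_le_iff] mid_bounds jump_bounds M by simp
  show G2': "\<bar>g_in \<gamma> (v t) - u t\<bar> \<le> 12/10" if "0 \<le> t" "t \<le> 1" for t using G2[OF that] by (simp add: abs_le_iff)
  have v1_neg: "v1 t \<le> 0" if t: "0 \<le> t" "t \<le> 1" for t
  proof -
    obtain s where "t \<le> s" "s \<le> 1" "v1 t = - ((1 - t) * (l\<^sup>2 * (g_in \<gamma> (v s) - u s)))" using v1[OF t] by blast
    thus ?thesis using G2[of s] t by simp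
  qed
  show near: "v t \<ge> q - 12/10 * l\<^sup>2 * t" if t: "0 \<le> t" "t \<le> 1" for t
  proof -
    obtain s where s: "0 \<le> s" "s \<le> 1" "v t = q + t * v1 s" using v0[OF t] by blast
    have "t * v1 s \<ge> t * - (12/10 * l\<^sup>2)" using v1_bound[OF G2' s(1,2)] t by (intro mult_left_mono) auto
    thus ?thesis using s(3) by (simp add: mult_ac)
  qed
  show vr: "jump / 2 \<le> v t \<and> v t \<le> q" if t: "0 \<le> t" "t \<le> 1" for t
  proof
    obtain s where s: "0 \<le> s" "s \<le> 1" "v t = q + t * v1 s" using v0[OF t] by blast
    show "v t \<le> q" using s v1_neg[of s] t by (simp add: mult_nonneg_nonpos)
    have "12/10 * l\<^sup>2 * t \<le> 12/10 * l\<^sup>2" using t by (intro mult_left_le) auto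
    thus "jump / 2 \<le> v t" using near[OF t] l2 q jump_bounds by linarith
  qed
  show ur: "lo \<le> u t \<and> u t \<le> 0" if t: "0 \<le> t" "t \<le> 1" for t
  proof
    show "lo \<le> u t"
    proof (rule activator_lower[OF s[unfolded inner_solution_def] K(1)])
      fix y assume "y \<in> domain Reflecting"
      thus "v y < jump + 1/200" using vr[of y] q jump_bounds by simp
    qed (use t in auto)
    show "u t \<le> 0"
    proof (rule max_principle[OF S(1) _ S(2)])
      fix y assume y: "y \<in> domain Reflecting" "0 < y" "u y > 0"
      have "v y - f_left (u y) > 0" using f_left_le[of "u y"] y vr[of y] jump_bounds by simp
      thus "l\<^sup>2 / \<epsilon>\<^sup>2 * (v y - f_left (u y)) > 0" using K(1) by (rule mult_pos_pos[rotated])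
    qed (use S(3) t in auto)
  qed
  show "v1 0 \<ge> - (12/10) * l\<^sup>2" using v1_bound[OF G2', of 0] by simp
  obtain s where s: "0 \<le> s" "s \<le> 1" "v1 0 = - ((1 - 0) * (l\<^sup>2 * (g_in \<gamma> (v s) - u s)))" using v1[of 0] by auto
  have "g_in \<gamma> (v s) - u s \<ge> 88/100"
    using g_out_abs[OF \<gamma>, of "2 * jump - v s", unfolded abs_le_iff] vr[of s] ur[of s] s q jump_bounds mid_bounds
    by (simp add: g_in_def abs_le_iff)
  hence "l\<^sup>2 * (g_in \<gamma> (v s) - u s) \<ge> l\<^sup>2 * (88/100)" by (intro mult_left_mono) auto
  thus "v1 0 \<le> - (88/100) * l\<^sup>2" using s(3) by simp
qed

lemma inner_exists:
  assumes "0 < \<gamma>" "\<gamma> \<le> 1/100" "0 < \<epsilon>" "\<epsilon> \<le> 1/100" "0 < l"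
  shows "\<exists>u u1 v v1. inner_solution \<gamma> \<epsilon> l q u u1 v v1"
proof -
  have "\<epsilon>\<^sup>2 \<le> 1/10000" using power_mono[of \<epsilon> "1/100" 2] assms by (simp add: power_divide)
  hence "1000 * l\<^sup>2 \<le> l\<^sup>2 / \<epsilon>\<^sup>2"
    using assms by (simp add: pos_le_divide_eq)
  thus ?thesis unfolding inner_solution_def
    using assms by (intro half_solution_exists g_in_lipschitz) auto
qed

end

section \<open>The slopes at the pinned end\<close>

context cubic_parameter
begin

text \<open>The energy bound controls the differences \<open>U\<close>, \<open>V\<close> and, through the equations, their second derivatives;
  together these control the slopes at the pinned end. The coefficients may differ because the length of
  the core enters through them.\<close>

lemma slope_dependence:
  assumes s: "half_solution e K1 K2 g q u u1 v v1" and s': "half_solution e K1' K2' g q' u' u1' v' v1'"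
    and K: "0 < K2" "K2 \<le> K1" and c: "0 < c" "c \<le> 3/10"
    and g: "\<And>x y. (g x - g y) * (x - y) \<ge> c * (x - y)\<^sup>2" "\<And>x y. \<bar>g x - g y\<bar> \<le> 1/25 * \<bar>x - y\<bar>"
    and R: "\<And>x. x \<in> domain e \<Longrightarrow> \<bar>v' x - f_left (u' x)\<bar> \<le> R" "\<And>x. x \<in> domain e \<Longrightarrow> \<bar>g (v' x) - u' x\<bar> \<le> R"
    and \<delta>: "\<bar>K1 - K1'\<bar> * R \<le> K1 * \<delta>" "\<bar>K2 - K2'\<bar> * R \<le> K2 * \<delta>"
  defines "D \<equiv> \<bar>q - q'\<bar> + 2 * \<delta> / c" and "\<sigma> \<equiv> sqrt (K1 / K2)"
  shows "\<bar>u1 0 - u1' 0\<bar> \<le> 2 * (\<sigma> * D) + (K1 * (D + \<sigma> * D) + K1 * \<delta>)"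
    and "\<bar>v1 0 - v1' 0\<bar> \<le> 2 * D + (K2 * (D + \<sigma> * D) + K2 * \<delta>)"
proof -
  note S = half_solutionD[OF s] and S' = half_solutionD[OF s']
  have R1: "\<bar>K1 - K1'\<bar> * \<bar>v' x - f_left (u' x)\<bar> \<le> K1 * \<delta>" if "x \<in> domain e" for x
    using mult_left_mono[OF R(1)[OF that], of "\<bar>K1 - K1'\<bar>"] \<delta>(1) by simp
  have R2: "\<bar>K2 - K2'\<bar> * \<bar>g (v' x) - u' x\<bar> \<le> K2 * \<delta>" if "x \<in> domain e" for x
    using mult_left_mono[OF R(2)[OF that], of "\<bar>K2 - K2'\<bar>"] \<delta>(2) by simp
  have \<delta>0: "\<delta> \<ge> 0"
  proof -
    have "0 \<in> domain e" using unit_subset_domain by simp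
    hence "0 \<le> K2 * \<delta>" using order_trans[OF _ R2[of 0]] by simp
    thus ?thesis using K by (simp add: zero_le_mult_iff)
  qed
  have D0: "D \<ge> 0" using \<delta>0 c by (simp add: D_def)
  have en: "energy K1 K2 (\<lambda>x. u x - u' x) (\<lambda>x. v x - v' x) x \<le> D\<^sup>2 / K2" if x: "x \<in> domain e" for x
  proof -
    have F: "(f_left x - f_left y) * (x - y) \<le> - c * (x - y)\<^sup>2" for x y
    proof -
      have "c * (x - y)\<^sup>2 \<le> 3/10 * (x - y)\<^sup>2" using c by (intro mult_right_mono) auto
      thus ?thesis using f_left_decreasing[of x y] by simp
    qed
    have "energy K1 K2 (\<lambda>x. u x - u' x) (\<lambda>x. v x - v' x) x \<le>
       max (energy K1 K2 (\<lambda>x. u x - u' x) (\<lambda>x. v x - v' x) 0) (2 * \<delta>\<^sup>2 / (c\<^sup>2 * K2))"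
      by (rule difference_bound[OF K c(1) F g(1) S(1,2) S(4,5) S'(1,2) S'(4,5) R1 R2 x])
    also have "\<dots> \<le> D\<^sup>2 / K2"
    proof (rule max.boundedI)
      have "(q - q')\<^sup>2 \<le> D\<^sup>2" using \<delta>0 c by (simp add: D_def abs_le_square_iff[symmetric])
      thus "energy K1 K2 (\<lambda>x. u x - u' x) (\<lambda>x. v x - v' x) 0 \<le> D\<^sup>2 / K2"
        using S S' K by (simp add: energy_def divide_right_mono)
      have "2 * \<delta>\<^sup>2 / c\<^sup>2 \<le> (2 * \<delta> / c)\<^sup>2" using c by (simp add: power_divide power_mult_distrib divide_right_mono)
      also have "\<dots> \<le> D\<^sup>2" using \<delta>0 c by (intro power_mono) (auto simp: D_def)
      finally have "(2 * \<delta>\<^sup>2 / c\<^sup>2) / K2 \<le> D\<^sup>2 / K2" using K by (intro divide_right_mono) auto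
      thus "2 * \<delta>\<^sup>2 / (c\<^sup>2 * K2) \<le> D\<^sup>2 / K2" by simp
    qed
    finally show ?thesis .
  qed
  have V: "\<bar>v x - v' x\<bar> \<le> D" if x: "x \<in> domain e" for x
  proof -
    have "(v x - v' x)\<^sup>2 / K2 \<le> D\<^sup>2 / K2" using en[OF x] K unfolding energy_def
      by (smt (verit) divide_nonneg_nonneg zero_le_power2)
    hence "(v x - v' x)\<^sup>2 \<le> D\<^sup>2" using K by (simp add: divide_le_cancel)
    thus ?thesis using D0 by (simp add: abs_le_square_iff[symmetric])
  qed
  have U: "\<bar>u x - u' x\<bar> \<le> \<sigma> * D" if x: "x \<in> domain e" for x
  proof -
    have "(u x - u' x)\<^sup>2 / K1 \<le> D\<^sup>2 / K2" using en[OF x] K unfolding energy_def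
      by (smt (verit) divide_nonneg_nonneg zero_le_power2)
    hence "(u x - u' x)\<^sup>2 \<le> (\<sigma> * D)\<^sup>2" using K by (simp add: \<sigma>_def power_mult_distrib field_simps)
    moreover have "\<sigma> * D \<ge> 0" using D0 K by (simp add: \<sigma>_def)
    ultimately show ?thesis by (simp add: abs_le_square_iff[symmetric])
  qed
  have U2: "\<bar>K1 * (v x - f_left (u x)) - K1' * (v' x - f_left (u' x))\<bar> \<le> K1 * (D + \<sigma> * D) + K1 * \<delta>" if x: "x \<in> domain e" for x
  proof -
    have "\<bar>(v x - v' x) - (f_left (u x) - f_left (u' x))\<bar> \<le> D + \<sigma> * D"
    proof (rule order_trans[OF abs_triangle_ineq4 add_mono[OF V[OF x]]])
      show "\<bar>f_left (u x) - f_left (u' x)\<bar> \<le> \<sigma> * D"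
        by (rule order_trans[OF _ U[OF x]], rule order_trans[OF f_left_lipschitz]) simp
    qed
    hence "K1 * \<bar>(v x - v' x) - (f_left (u x) - f_left (u' x))\<bar> \<le> K1 * (D + \<sigma> * D)" using K by (intro mult_left_mono) auto
    hence "\<bar>K1 * ((v x - v' x) - (f_left (u x) - f_left (u' x)))\<bar> \<le> K1 * (D + \<sigma> * D)" using K by (simp add: abs_mult)
    moreover have "\<bar>(K1 - K1') * (v' x - f_left (u' x))\<bar> \<le> K1 * \<delta>" using R1[OF x] by (simp only: abs_mult)
    moreover have "K1 * (v x - f_left (u x)) - K1' * (v' x - f_left (u' x)) =
        K1 * ((v x - v' x) - (f_left (u x) - f_left (u' x))) + (K1 - K1') * (v' x - f_left (u' x))" by (simp add: algebra_simps)
    ultimately show ?thesis using abs_triangle_ineq[of "K1 * ((v x - v' x) - (f_left (u x) - f_left (u' x)))" "(K1 - K1') * (v' x - f_left (u' x))"]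
      by (simp only:)
  qed
  have V2: "\<bar>K2 * (g (v x) - u x) - K2' * (g (v' x) - u' x)\<bar> \<le> K2 * (D + \<sigma> * D) + K2 * \<delta>" if x: "x \<in> domain e" for x
  proof -
    have "\<bar>(g (v x) - g (v' x)) - (u x - u' x)\<bar> \<le> D + \<sigma> * D"
    proof (rule order_trans[OF abs_triangle_ineq4 add_mono[OF _ U[OF x]]])
      show "\<bar>g (v x) - g (v' x)\<bar> \<le> D"
        by (rule order_trans[OF _ V[OF x]], rule order_trans[OF g(2)]) simp
    qed
    hence "K2 * \<bar>(g (v x) - g (v' x)) - (u x - u' x)\<bar> \<le> K2 * (D + \<sigma> * D)" using K by (intro mult_left_mono) auto
    hence "\<bar>K2 * ((g (v x) - g (v' x)) - (u x - u' x))\<bar> \<le> K2 * (D + \<sigma> * D)" using K by (simp add: abs_mult)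
    moreover have "\<bar>(K2 - K2') * (g (v' x) - u' x)\<bar> \<le> K2 * \<delta>" using R2[OF x] by (simp only: abs_mult)
    moreover have "K2 * (g (v x) - u x) - K2' * (g (v' x) - u' x) =
        K2 * ((g (v x) - g (v' x)) - (u x - u' x)) + (K2 - K2') * (g (v' x) - u' x)" by (simp add: algebra_simps)
    ultimately show ?thesis using abs_triangle_ineq[of "K2 * ((g (v x) - g (v' x)) - (u x - u' x))" "(K2 - K2') * (g (v' x) - u' x)"]
      by (simp only:)
  qed
  show "\<bar>u1 0 - u1' 0\<bar> \<le> 2 * (\<sigma> * D) + (K1 * (D + \<sigma> * D) + K1 * \<delta>)"
    by (rule derivative_at_0_bound[OF deriv2_on_diff[OF S(1) S'(1)] U U2])
  show "\<bar>v1 0 - v1' 0\<bar> \<le> 2 * D + (K2 * (D + \<sigma> * D) + K2 * \<delta>)"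
    by (rule derivative_at_0_bound[OF deriv2_on_diff[OF S(4) S'(4)] V V2])
qed

definition pin_range :: "real set" where "pin_range = {19/20 * jump..21/20 * jump}"

lemma lipschitz_bound_continuous_on:
  fixes f :: "'a::metric_space \<Rightarrow> real"
  assumes "\<And>x y. x \<in> S \<Longrightarrow> y \<in> S \<Longrightarrow> \<bar>f x - f y\<bar> \<le> C * dist x y"
  shows "continuous_on S f"
proof -
  have "\<bar>C\<bar>-lipschitz_on S f"
  proof (rule lipschitz_onI)
    fix x y assume "x \<in> S" "y \<in> S"
    hence "dist (f x) (f y) \<le> C * dist x y" using assms by (simp add: dist_real_def)
    also have "\<dots> \<le> \<bar>C\<bar> * dist x y" by (intro mult_right_mono) auto
    finally show "dist (f x) (f y) \<le> \<bar>C\<bar> * dist x y" .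
  qed simp
  thus ?thesis by (rule lipschitz_on_continuous_on)
qed

text \<open>Solutions are chosen for every pinned value of \<open>v\<close>. By the previous estimate their slopes are
  Lipschitz functions of it.\<close>

lemma outer_slopes:
  assumes \<gamma>: "0 < \<gamma>" "\<gamma> \<le> 1/100" and \<epsilon>: "0 < \<epsilon>" "\<epsilon> \<le> 1/100"
  shows "\<exists>A B. (\<forall>q\<in>pin_range. \<exists>u u1 v v1. outer_solution \<gamma> \<epsilon> q u u1 v v1 \<and> A q = \<epsilon> * u1 0 \<and> B q = v1 0) \<and>
    continuous_on pin_range A \<and> continuous_on pin_range B"
proof -
  define P where "P = (\<lambda>q (u, u1, v, v1). outer_solution \<gamma> \<epsilon> q u u1 v v1)"
  have "\<exists>s. P q s" for q unfolding P_def using outer_exists[OF \<gamma> \<epsilon>, of q] by auto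
  then obtain sol where sol: "\<And>q. P q (sol q)" using choice[of P] by blast
  define A where "A = (\<lambda>q. \<epsilon> * fst (snd (sol q)) 0)"
  define B where "B = (\<lambda>q. snd (snd (snd (sol q))) 0)"
  have ex: "\<exists>u u1 v v1. outer_solution \<gamma> \<epsilon> q u u1 v v1 \<and> A q = \<epsilon> * u1 0 \<and> B q = v1 0" for q
    using sol[of q] by (cases "sol q") (auto simp: P_def A_def B_def)
  have e2: "\<epsilon>\<^sup>2 \<le> 1" "\<epsilon>\<^sup>2 > 0" using \<epsilon> power_le_one[of \<epsilon> 2] by auto
  define \<sigma> where "\<sigma> = sqrt (1 / \<epsilon>\<^sup>2 / 1)"
  have \<sigma>: "\<sigma> \<ge> 0" by (simp add: \<sigma>_def)
  have diff: "\<bar>A q - A q'\<bar> \<le> \<epsilon> * (2 * \<sigma> + 1 / \<epsilon>\<^sup>2 * (1 + \<sigma>)) * dist q q'"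
    "\<bar>B q - B q'\<bar> \<le> (2 + 1 + \<sigma>) * dist q q'" if "q \<in> pin_range" "q' \<in> pin_range" for q q'
  proof -
    obtain u u1 v v1 where s: "outer_solution \<gamma> \<epsilon> q u u1 v v1" "A q = \<epsilon> * u1 0" "B q = v1 0" using ex by blast
    obtain u' u1' v' v1' where s': "outer_solution \<gamma> \<epsilon> q' u' u1' v' v1'" "A q' = \<epsilon> * u1' 0" "B q' = v1' 0" using ex by blast
    have q': "19/20 * jump \<le> q'" "q' \<le> 21/20 * jump" using that by (auto simp: pin_range_def)
    note pr = outer_v_abs[OF s'(1) \<gamma> \<epsilon> q'] outer_u_abs[OF s'(1) \<gamma> \<epsilon> q'] outer_v2[OF s'(1) \<gamma> \<epsilon> q']
    have R1: "\<bar>v' x - f_left (u' x)\<bar> \<le> 1" if "x \<in> domain Unbounded" for x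
      using pr(1)[of x] pr(2)[of x] f_left_lipschitz[of "u' x" 0] abs_triangle_ineq4[of "v' x" "f_left (u' x)"] that q' jump_bounds by simp
    have R2: "\<bar>g_out \<gamma> (v' x) - u' x\<bar> \<le> 1" if "x \<in> domain Unbounded" for x
      using pr(3)[of x] that q' jump_bounds by simp
    note D = slope_dependence[OF s(1)[unfolded outer_solution_def] s'(1)[unfolded outer_solution_def], of \<gamma> 1 0,
        folded \<sigma>_def]
    have 1: "\<bar>u1 0 - u1' 0\<bar> \<le> (2 * \<sigma> + 1 / \<epsilon>\<^sup>2 * (1 + \<sigma>)) * dist q q'"
      using D(1) \<gamma> e2 g_out_increasing g_out_lipschitz[OF \<gamma>] R1 R2 by (simp add: dist_real_def algebra_simps add_divide_distrib)
    have "\<bar>A q - A q'\<bar> = \<epsilon> * \<bar>u1 0 - u1' 0\<bar>" using s s' \<epsilon> by (simp add: abs_mult flip: right_diff_distrib)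
    also have "\<dots> \<le> \<epsilon> * ((2 * \<sigma> + 1 / \<epsilon>\<^sup>2 * (1 + \<sigma>)) * dist q q')" using 1 \<epsilon> by (intro mult_left_mono) auto
    finally show "\<bar>A q - A q'\<bar> \<le> \<epsilon> * (2 * \<sigma> + 1 / \<epsilon>\<^sup>2 * (1 + \<sigma>)) * dist q q'" by (simp only: mult.assoc)
    show "\<bar>B q - B q'\<bar> \<le> (2 + 1 + \<sigma>) * dist q q'"
      using D(2) \<gamma> e2 g_out_increasing g_out_lipschitz[OF \<gamma>] R1 R2 s s' by (simp add: dist_real_def algebra_simps add_divide_distrib)
  qed
  have "continuous_on pin_range A" "continuous_on pin_range B"
    by (rule lipschitz_bound_continuous_on[OF diff(1)] lipschitz_bound_continuous_on[OF diff(2)]; assumption)+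
  thus ?thesis using ex by blast
qed

lemma inner_slopes:
  assumes \<gamma>: "0 < \<gamma>" "\<gamma> \<le> 1/100" and \<epsilon>: "0 < \<epsilon>" "\<epsilon> \<le> 1/100" and l1: "0 < l1"
  defines "S \<equiv> {l1..7/2 * jump} \<times> pin_range"
  shows "\<exists>A B. (\<forall>(l, q)\<in>S. \<exists>u u1 v v1. inner_solution \<gamma> \<epsilon> l q u u1 v v1 \<and> A (l, q) = \<epsilon> * u1 0 / l \<and> B (l, q) = v1 0 / l) \<and>
    continuous_on S A \<and> continuous_on S B"
proof -
  define P where "P = (\<lambda>p (u, u1, v, v1). 0 < fst p \<longrightarrow> inner_solution \<gamma> \<epsilon> (fst p) (snd p) u u1 v v1)"
  have "\<exists>s. P p s" for p unfolding P_def using inner_exists[OF \<gamma> \<epsilon>, of "fst p" "snd p"] by auto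
  then obtain sol where sol: "\<And>q. P q (sol q)" using choice[of P] by blast
  define A where "A = (\<lambda>p. fst (snd (sol p)) 0)"
  define B where "B = (\<lambda>p. snd (snd (snd (sol p))) 0)"
  have ex: "\<exists>u u1 v v1. inner_solution \<gamma> \<epsilon> l q u u1 v v1 \<and> A (l, q) = u1 0 \<and> B (l, q) = v1 0" if "(l, q) \<in> S" for l q
    using sol[of "(l, q)"] that l1 by (cases "sol (l, q)") (auto simp: P_def A_def B_def S_def)
  have e2: "\<epsilon>\<^sup>2 \<le> 1" "\<epsilon>\<^sup>2 > 0" using \<epsilon> power_le_one[of \<epsilon> 2] by auto
  define \<sigma> where "\<sigma> = 1 / \<epsilon>"
  have \<sigma>: "\<sigma> \<ge> 1" using \<epsilon> by (simp add: \<sigma>_def)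
  define C where "C = 1 + 8 / (l1\<^sup>2 * \<gamma>)"
  have C0: "C \<ge> 1" using l1 \<gamma> by (simp add: C_def)
  have diff: "\<bar>A p - A p'\<bar> \<le> (2 * \<sigma> + 1 / \<epsilon>\<^sup>2 * (1 + \<sigma>) + 1 / \<epsilon>\<^sup>2) * C * dist p p'"
    "\<bar>B p - B p'\<bar> \<le> (2 + (1 + \<sigma>) + 1) * C * dist p p'" if pS: "p \<in> S" "p' \<in> S" for p p'
  proof -
    obtain l q where p: "p = (l, q)" by (cases p)
    obtain l' q' where p': "p' = (l', q')" by (cases p')
    obtain u u1 v v1 where s: "inner_solution \<gamma> \<epsilon> l q u u1 v v1" "A p = u1 0" "B p = v1 0" using ex[of l q] pS p by auto
    obtain u' u1' v' v1' where s': "inner_solution \<gamma> \<epsilon> l' q' u' u1' v' v1'" "A p' = u1' 0" "B p' = v1' 0" using ex[of l' q'] pS p' by auto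
    have q': "19/20 * jump \<le> q'" "q' \<le> 21/20 * jump" and l': "0 < l'" "l' \<le> 7/2 * jump" and l: "l1 \<le> l" "l \<le> 7/2 * jump"
      using pS l1 by (auto simp: pin_range_def S_def p p')
    have ll: "l \<le> 1" "l' \<le> 1" "l\<^sup>2 \<le> 1" "l > 0" "l1\<^sup>2 \<le> l\<^sup>2" using l l' l1 jump_bounds by (auto intro!: power_le_one power_mono)
    note pr = inner_v_range[OF s'(1) \<gamma> \<epsilon> q' l'] inner_u_range[OF s'(1) \<gamma> \<epsilon> q' l'] inner_v2[OF s'(1) \<gamma> \<epsilon> q' l']
    have R1: "\<bar>v' x - f_left (u' x)\<bar> \<le> 2" if "x \<in> domain Reflecting" for x
    proof -
      have x: "0 \<le> x" "x \<le> 1" using that by auto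
      have "\<bar>v' x\<bar> \<le> 1" "\<bar>u' x\<bar> \<le> 1" using pr(1)[OF x] pr(2)[OF x] lo_bounds q' jump_bounds by auto
      thus ?thesis using f_left_lipschitz[of "u' x" 0] abs_triangle_ineq4[of "v' x" "f_left (u' x)"] by simp
    qed
    have R2: "\<bar>g_in \<gamma> (v' x) - u' x\<bar> \<le> 2" if "x \<in> domain Reflecting" for x
      using pr(3)[of x] that by simp
    define \<delta> where "\<delta> = 2 * \<bar>l\<^sup>2 - l'\<^sup>2\<bar> / l\<^sup>2"
    have \<delta>1: "\<bar>l\<^sup>2 - l'\<^sup>2\<bar> * 2 \<le> l\<^sup>2 * \<delta>" using ll by (simp add: \<delta>_def)
    have "l\<^sup>2 / \<epsilon>\<^sup>2 - l'\<^sup>2 / \<epsilon>\<^sup>2 = (l\<^sup>2 - l'\<^sup>2) / \<epsilon>\<^sup>2" by (simp add: diff_divide_distrib)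
    hence "\<bar>l\<^sup>2 / \<epsilon>\<^sup>2 - l'\<^sup>2 / \<epsilon>\<^sup>2\<bar> * 2 = \<bar>l\<^sup>2 - l'\<^sup>2\<bar> * 2 / \<epsilon>\<^sup>2" by (simp add: abs_divide)
    also have "\<dots> \<le> l\<^sup>2 * \<delta> / \<epsilon>\<^sup>2" using \<delta>1 by (rule divide_right_mono) simp
    finally have \<delta>2: "\<bar>l\<^sup>2 / \<epsilon>\<^sup>2 - l'\<^sup>2 / \<epsilon>\<^sup>2\<bar> * 2 \<le> l\<^sup>2 / \<epsilon>\<^sup>2 * \<delta>" by simp
    have \<sigma>': "sqrt (l\<^sup>2 / \<epsilon>\<^sup>2 / l\<^sup>2) = \<sigma>" using ll \<epsilon> by (simp add: \<sigma>_def real_sqrt_divide)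
    have Kle: "l\<^sup>2 \<le> l\<^sup>2 / \<epsilon>\<^sup>2" using e2 by (simp add: pos_le_divide_eq mult_left_le)
    define D where "D = \<bar>q - q'\<bar> + 2 * \<delta> / \<gamma>"
    note sd = slope_dependence[OF s(1)[unfolded inner_solution_def] s'(1)[unfolded inner_solution_def], of \<gamma> 2 \<delta>,
        OF _ Kle _ _ g_in_increasing g_in_lipschitz[OF \<gamma>] R1 R2 \<delta>2 \<delta>1, unfolded \<sigma>', folded D_def]
    have \<delta>0: "\<delta> \<ge> 0" by (simp add: \<delta>_def)
    have dq: "\<bar>q - q'\<bar> \<le> dist p p'" "\<bar>l - l'\<bar> \<le> dist p p'"
      unfolding p p' by (auto simp: dist_Pair_Pair dist_real_def)
    have "\<bar>l\<^sup>2 - l'\<^sup>2\<bar> = \<bar>l - l'\<bar> * (l + l')"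
      using ll l' by (simp add: abs_mult[symmetric] abs_of_pos power2_eq_square square_diff_square_factored[symmetric])
        (metis abs_mult abs_of_pos add_pos_pos mult.commute square_diff_square_factored)
    also have "\<dots> \<le> dist p p' * 2" using dq ll l' by (intro mult_mono) auto
    finally have \<delta>le: "\<delta> \<le> 2 * (dist p p' * 2) / l1\<^sup>2"
      unfolding \<delta>_def using ll l1 by (intro frac_le) auto
    hence \<delta>C: "\<delta> / \<gamma> \<le> 4 / (l1\<^sup>2 * \<gamma>) * dist p p'"
    proof -
      have "\<delta> / \<gamma> \<le> 2 * (dist p p' * 2) / l1\<^sup>2 / \<gamma>" using \<delta>le \<gamma> by (intro divide_right_mono) auto
      thus ?thesis by (simp add: mult.commute)
    qed
    have D: "D \<le> C * dist p p'" using dq(1) \<delta>C by (simp add: D_def C_def distrib_right)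
    have "\<delta> \<le> 2 * \<delta> / \<gamma>" using \<gamma> \<delta>0 by (simp add: pos_le_divide_eq mult_left_le mult.commute mult_mono)
    hence \<delta>D: "\<delta> \<le> C * dist p p'" using D by (simp add: D_def)
    define E where "E = C * dist p p'"
    have E0: "E \<ge> 0" using C0 by (simp add: E_def)
    have b: "2 * (\<sigma> * D) \<le> 2 * (\<sigma> * E)" "D + \<sigma> * D \<le> E + \<sigma> * E"
      using D \<sigma> by (auto simp: E_def intro!: mult_left_mono add_mono)
    have lle: "l\<^sup>2 / \<epsilon>\<^sup>2 \<le> 1 / \<epsilon>\<^sup>2" using ll by (simp add: divide_right_mono)
    have "D \<ge> 0" using \<delta>0 \<gamma> by (simp add: D_def)
    hence D0: "D + \<sigma> * D \<ge> 0" using \<sigma> by simp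
    have \<delta>E: "\<delta> \<le> E" using \<delta>D by (simp add: E_def)
    have "l\<^sup>2 / \<epsilon>\<^sup>2 * (D + \<sigma> * D) \<le> 1 / \<epsilon>\<^sup>2 * (E + \<sigma> * E)" "l\<^sup>2 / \<epsilon>\<^sup>2 * \<delta> \<le> 1 / \<epsilon>\<^sup>2 * E"
      by (rule mult_mono[OF lle b(2) _ D0] mult_mono[OF lle \<delta>E _ \<delta>0], simp)+
    hence "\<bar>u1 0 - u1' 0\<bar> \<le> 2 * (\<sigma> * E) + (1 / \<epsilon>\<^sup>2 * (E + \<sigma> * E) + 1 / \<epsilon>\<^sup>2 * E)"
      using sd(1) \<gamma> ll b(1) by simp
    also have "\<dots> = (2 * \<sigma> + 1 / \<epsilon>\<^sup>2 * (1 + \<sigma>) + 1 / \<epsilon>\<^sup>2) * E" by (simp add: distrib_left distrib_right add_divide_distrib)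
    finally show "\<bar>A p - A p'\<bar> \<le> (2 * \<sigma> + 1 / \<epsilon>\<^sup>2 * (1 + \<sigma>) + 1 / \<epsilon>\<^sup>2) * C * dist p p'"
      using s s' by (simp add: E_def mult.assoc)
    have "l\<^sup>2 * (D + \<sigma> * D) \<le> 1 * (E + \<sigma> * E)" "l\<^sup>2 * \<delta> \<le> 1 * E"
      by (rule mult_mono[OF ll(3) b(2) _ D0] mult_mono[OF ll(3) \<delta>E _ \<delta>0], simp)+
    hence "\<bar>v1 0 - v1' 0\<bar> \<le> 2 * E + (1 * (E + \<sigma> * E) + 1 * E)"
      using sd(2) \<gamma> ll D by (simp add: E_def)
    also have "\<dots> = (2 + (1 + \<sigma>) + 1) * E" by (simp add: distrib_left distrib_right)
    finally show "\<bar>B p - B p'\<bar> \<le> (2 + (1 + \<sigma>) + 1) * C * dist p p'"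
      using s s' by (simp add: E_def mult.assoc)
  qed
  have cA: "continuous_on S A" by (rule lipschitz_bound_continuous_on[OF diff(1)])
  have cB: "continuous_on S B" by (rule lipschitz_bound_continuous_on[OF diff(2)])
  have S0: "\<forall>p\<in>S. fst p \<noteq> 0" using l1 by (auto simp: S_def)
  have cA': "continuous_on S (\<lambda>p. \<epsilon> * A p / fst p)" and cB': "continuous_on S (\<lambda>p. B p / fst p)"
    using cA cB S0 by (auto intro!: continuous_intros)
  have "\<forall>(l, q)\<in>S. \<exists>u u1 v v1. inner_solution \<gamma> \<epsilon> l q u u1 v v1 \<and>
      \<epsilon> * A (l, q) / fst (l, q) = \<epsilon> * u1 0 / l \<and> B (l, q) / fst (l, q) = v1 0 / l"
    using ex by fastforce
  thus ?thesis using cA' cB' by (intro exI[of _ "\<lambda>p. \<epsilon> * A p / fst p"] exI[of _ "\<lambda>p. B p / fst p"]) auto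
qed

end

context cubic_parameter
begin

text \<open>The upper bound of the slope comes from the parabola of \<open>initial_slope\<close> on a stretch of length \<open>q / 2\<close>, where \<open>v\<close> has
  not yet dropped below \<open>q / 2\<close>; for the other one the slope is
  compared with the size of \<open>u\<close> over a distance \<open>\<epsilon>\<close>.\<close>

lemma outer_slope_bounds:
  assumes s: "outer_solution \<gamma> \<epsilon> q u u1 v v1" and \<gamma>: "0 < \<gamma>" "\<gamma> \<le> 1/100"
    and \<epsilon>: "0 < \<epsilon>" "\<epsilon> \<le> 1/100" "\<epsilon> \<le> jump\<^sup>2" and q: "19/20 * jump \<le> q" "q \<le> 21/20 * jump"
  shows "\<epsilon> * u1 0 \<le> 0" "\<bar>\<epsilon> * u1 0\<bar> \<le> 1"
proof -
  note S = half_solutionD[OF s[unfolded outer_solution_def]]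
  note pr = outer_v_abs[OF s \<gamma> \<epsilon>(1,2) q] outer_u_range[OF s \<gamma> \<epsilon>(1,2) q] outer_v_near_0[OF s \<gamma> \<epsilon>(1,2) q]
  have q0: "0 < q" "q \<le> 3/100" using q jump_bounds by auto
  have d: "deriv2_on {0..b} u u1 (\<lambda>x. 1 / \<epsilon>\<^sup>2 * (v x - f_left (u x)))" for b
    by (rule deriv2_on_subset[OF S(1)]) auto
  have sq: "sqrt (1 / \<epsilon>\<^sup>2) = 1 / \<epsilon>" using \<epsilon> by (simp add: real_sqrt_divide)
  define m where "m = q / (2 * \<epsilon>)"
  have m1: "m \<ge> 4" "q * m \<ge> 1/2 * (3/4)"
  proof -
    have "jump\<^sup>2 \<le> 1/36 * jump" unfolding power2_eq_square using jump_bounds by (intro mult_right_mono) auto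
    hence "8 * \<epsilon> \<le> q" using \<epsilon> q jump_bounds by simp
    thus "m \<ge> 4" using \<epsilon> by (simp add: m_def field_simps)
    have "(19/20 * jump)\<^sup>2 \<le> q\<^sup>2" using q jump_bounds by (intro power_mono) auto
    hence "\<epsilon> * (3/4) \<le> q\<^sup>2" using \<epsilon> by (simp add: power_mult_distrib power_divide)
    thus "q * m \<ge> 1/2 * (3/4)" using \<epsilon> by (simp add: m_def power2_eq_square field_simps)
  qed
  have "u1 0 \<le> - (q / 2 / 2) * sqrt (1 / \<epsilon>\<^sup>2)"
  proof (rule initial_slope[OF d S(3)])
    show "v x \<ge> q / 2" if "0 \<le> x" "x \<le> q / 2" for x using pr(3)[of x] that q0 by simp
    have "q / 2 / 4 * (1 / \<epsilon>\<^sup>2 * (q / 2)\<^sup>2) - q / 2 / 2 * (sqrt (1 / \<epsilon>\<^sup>2) * (q / 2)) = q * m / 8 * (m - 2)"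
      unfolding sq using \<epsilon> by (simp add: m_def power2_eq_square field_simps)
    also have "\<dots> \<ge> (1/2 * (3/4)) / 8 * 2" by (rule mult_mono) (use m1 in auto)
    finally have low: "(1/2 * (3/4)) / 8 * 2 \<le> q / 2 / 4 * (1 / \<epsilon>\<^sup>2 * (q / 2)\<^sup>2) - q / 2 / 2 * (sqrt (1 / \<epsilon>\<^sup>2) * (q / 2))" .
    show "u (q / 2) \<le> q / 2 / 4 * (1 / \<epsilon>\<^sup>2 * (q / 2)\<^sup>2) - q / 2 / 2 * (sqrt (1 / \<epsilon>\<^sup>2) * (q / 2))"
      by (rule order_trans[OF _ low]) (use pr(2)[of "q / 2"] q0 in simp)
  qed (use \<epsilon> q0 in auto)
  also have "\<dots> \<le> 0" using q0 by simp
  finally show "\<epsilon> * u1 0 \<le> 0" using \<epsilon> by (simp add: mult_nonneg_nonpos)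
  have ub: "\<bar>u x\<bar> \<le> 1/10" if "x \<ge> 0" for x using pr(2)[OF that] lo_bounds by (intro abs_leI) auto
  have "\<bar>u1 0\<bar> \<le> 2 * (1/10) / \<epsilon> + 1 / \<epsilon>\<^sup>2 * (1/5) * \<epsilon>"
  proof (rule slope_abs_bound[OF d \<epsilon>(1)])
    fix x assume x: "0 \<le> x" "x \<le> \<epsilon>"
    show "\<bar>u x\<bar> \<le> 1/10" by (rule ub[OF x(1)])
    have "\<bar>f_left (u x)\<bar> \<le> 6/100" using f_left_lipschitz[of "u x" 0] ub[OF x(1)] by simp
    hence "\<bar>v x - f_left (u x)\<bar> \<le> 1/5" using pr(1)[OF x(1)] q0 abs_triangle_ineq4[of "v x" "f_left (u x)"] by simp
    hence "1 / \<epsilon>\<^sup>2 * \<bar>v x - f_left (u x)\<bar> \<le> 1 / \<epsilon>\<^sup>2 * (1/5)" by (intro mult_left_mono) auto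
    thus "\<bar>1 / \<epsilon>\<^sup>2 * (v x - f_left (u x))\<bar> \<le> 1 / \<epsilon>\<^sup>2 * (1/5)" by (simp add: abs_mult)
  qed
  hence "\<epsilon> * \<bar>u1 0\<bar> \<le> \<epsilon> * (2 * (1/10) / \<epsilon> + 1 / \<epsilon>\<^sup>2 * (1/5) * \<epsilon>)" using \<epsilon> by (intro mult_left_mono) auto
  also have "\<dots> = 2/5" using \<epsilon> by (simp add: field_simps power2_eq_square)
  finally show "\<bar>\<epsilon> * u1 0\<bar> \<le> 1" using \<epsilon> by (simp add: abs_mult)
qed

text \<open>In the original length scale the core solves the same activator equation as the tail, which makes
  their slopes comparable.\<close>

lemma inner_rescale:
  assumes s: "inner_solution \<gamma> \<epsilon> l q u u1 v v1" and l: "l > 0"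
  shows "deriv2_on {0..l} (\<lambda>x. u (x / l)) (\<lambda>x. u1 (x / l) / l) (\<lambda>x. 1 / \<epsilon>\<^sup>2 * (v (x / l) - f_left (u (x / l))))"
    "deriv2_on {0..l} (\<lambda>x. v (x / l)) (\<lambda>x. v1 (x / l) / l) (\<lambda>x. g_in \<gamma> (v (x / l)) - u (x / l))"
proof -
  note S = half_solutionD[OF s[unfolded inner_solution_def]]
  have chain: "((\<lambda>x. z (x / l)) has_real_derivative D / l) (at x)" if "(z has_real_derivative D) (at (x / l))" for z D x
  proof -
    have "((\<lambda>x. (1 / l) * x) has_real_derivative 1 / l) (at x)" by (rule DERIV_cmult_Id)
    hence "((\<lambda>x. z ((1 / l) * x)) has_real_derivative D * (1 / l)) (at x)"
      by (rule DERIV_chain2[rotated]) (use that in simp)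
    thus ?thesis by simp
  qed
  have dom: "x / l \<in> domain Reflecting" if "x \<in> {0..l}" for x using that l by (auto simp: field_simps)
  show "deriv2_on {0..l} (\<lambda>x. u (x / l)) (\<lambda>x. u1 (x / l) / l) (\<lambda>x. 1 / \<epsilon>\<^sup>2 * (v (x / l) - f_left (u (x / l))))"
    unfolding deriv2_on_def
  proof (intro ballI conjI)
    fix x assume x: "x \<in> {0..l}"
    note D = S(1)[unfolded deriv2_on_def, rule_format, OF dom[OF x]]
    show "((\<lambda>x. u (x / l)) has_real_derivative u1 (x / l) / l) (at x)" by (rule chain) (use D in simp)
    have "((\<lambda>x. u1 (x / l)) has_real_derivative l\<^sup>2 / \<epsilon>\<^sup>2 * (v (x / l) - f_left (u (x / l))) / l) (at x)"
      by (rule chain) (use D in simp)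
    from DERIV_cdivide[OF this, of l]
    show "((\<lambda>x. u1 (x / l) / l) has_real_derivative 1 / \<epsilon>\<^sup>2 * (v (x / l) - f_left (u (x / l)))) (at x)"
      using l by (simp add: power2_eq_square)
  qed
  show "deriv2_on {0..l} (\<lambda>x. v (x / l)) (\<lambda>x. v1 (x / l) / l) (\<lambda>x. g_in \<gamma> (v (x / l)) - u (x / l))"
    unfolding deriv2_on_def
  proof (intro ballI conjI)
    fix x assume x: "x \<in> {0..l}"
    note D = S(4)[unfolded deriv2_on_def, rule_format, OF dom[OF x]]
    show "((\<lambda>x. v (x / l)) has_real_derivative v1 (x / l) / l) (at x)" by (rule chain) (use D in simp)
    have "((\<lambda>x. v1 (x / l)) has_real_derivative l\<^sup>2 * (g_in \<gamma> (v (x / l)) - u (x / l)) / l) (at x)"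
      by (rule chain) (use D in simp)
    from DERIV_cdivide[OF this, of l]
    show "((\<lambda>x. v1 (x / l) / l) has_real_derivative g_in \<gamma> (v (x / l)) - u (x / l)) (at x)"
      using l by (simp add: power2_eq_square)
  qed
qed

lemma inner_slope_bounds:
  assumes s: "inner_solution \<gamma> \<epsilon> l q u u1 v v1" and \<gamma>: "0 < \<gamma>" "\<gamma> \<le> 1/100"
    and \<epsilon>: "0 < \<epsilon>" "\<epsilon> \<le> 1/100" and q: "19/20 * jump \<le> q" "q \<le> 21/20 * jump"
    and l: "2 * \<epsilon> \<le> l" "l \<le> 7/2 * jump"
  shows "\<epsilon> * u1 0 / l \<le> - (jump / 4)" "\<bar>\<epsilon> * u1 0 / l\<bar> \<le> 1"
proof -
  note S = half_solutionD[OF s[unfolded inner_solution_def]]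
  have l0: "l > 0" using l \<epsilon> by simp
  note pr = inner_v_range[OF s \<gamma> \<epsilon> q l0 l(2)] inner_u_range[OF s \<gamma> \<epsilon> q l0 l(2)]
  have d: "deriv2_on {0..1} u u1 (\<lambda>x. l\<^sup>2 / \<epsilon>\<^sup>2 * (v x - f_left (u x)))"
    by (rule deriv2_on_subset[OF S(1)]) auto
  have sq: "sqrt (l\<^sup>2 / \<epsilon>\<^sup>2) = l / \<epsilon>" using \<epsilon> l0 by (simp add: real_sqrt_divide)
  have "u1 0 \<le> - (jump / 2 / 2) * sqrt (l\<^sup>2 / \<epsilon>\<^sup>2)"
  proof (rule initial_slope[OF d S(3)])
    show "v x \<ge> jump / 2" if "0 \<le> x" "x \<le> 1" for x using pr(1)[OF that] by simp
    have "jump / 2 / 4 * (r * r * 1\<^sup>2) - jump / 2 / 2 * (r * 1) = jump / 8 * r * (r - 2)" for r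
      by (simp add: field_simps)
    from this[of "l / \<epsilon>"]
    have "jump / 2 / 4 * (l\<^sup>2 / \<epsilon>\<^sup>2 * 1\<^sup>2) - jump / 2 / 2 * (sqrt (l\<^sup>2 / \<epsilon>\<^sup>2) * 1) = jump / 8 * (l / \<epsilon>) * (l / \<epsilon> - 2)"
      unfolding sq power_divide[symmetric] power2_eq_square[of "l / \<epsilon>"] sq[unfolded power_divide[symmetric] power2_eq_square[of "l / \<epsilon>"]] .
    also have "\<dots> \<ge> 0" using l l0 \<epsilon> jump_bounds by (intro mult_nonneg_nonneg) (auto simp: field_simps)
    finally show "u 1 \<le> jump / 2 / 4 * (l\<^sup>2 / \<epsilon>\<^sup>2 * 1\<^sup>2) - jump / 2 / 2 * (sqrt (l\<^sup>2 / \<epsilon>\<^sup>2) * 1)"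
      using pr(2)[of 1] by simp
  qed (use \<epsilon> l0 jump_bounds in auto)
  hence "u1 0 \<le> - (jump / 4) * (l / \<epsilon>)" by (simp add: sq)
  thus "\<epsilon> * u1 0 / l \<le> - (jump / 4)" using \<epsilon> l0 by (simp add: field_simps)
  have h: "\<epsilon> / l > 0" "\<epsilon> / l \<le> 1" using \<epsilon> l l0 by auto
  have "\<bar>u1 0\<bar> \<le> 2 * (1/10) / (\<epsilon> / l) + l\<^sup>2 / \<epsilon>\<^sup>2 * (1/5) * (\<epsilon> / l)"
  proof (rule slope_abs_bound[OF deriv2_on_subset[OF d] h(1)])
    show "{0..\<epsilon> / l} \<subseteq> {0..1}" using h by auto
    fix x assume x: "0 \<le> x" "x \<le> \<epsilon> / l"
    hence x': "0 \<le> x" "x \<le> 1" using h by auto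
    show ux: "\<bar>u x\<bar> \<le> 1/10" using pr(2)[OF x'] lo_bounds by simp
    have "\<bar>f_left (u x)\<bar> \<le> 6/100" using f_left_lipschitz[of "u x" 0] ux by simp
    moreover have "\<bar>v x\<bar> \<le> 3/100" using pr(1)[OF x'] q jump_bounds by simp
    ultimately have "\<bar>v x - f_left (u x)\<bar> \<le> 1/5" using abs_triangle_ineq4[of "v x" "f_left (u x)"] by simp
    hence "l\<^sup>2 / \<epsilon>\<^sup>2 * \<bar>v x - f_left (u x)\<bar> \<le> l\<^sup>2 / \<epsilon>\<^sup>2 * (1/5)" by (intro mult_left_mono) auto
    thus "\<bar>l\<^sup>2 / \<epsilon>\<^sup>2 * (v x - f_left (u x))\<bar> \<le> l\<^sup>2 / \<epsilon>\<^sup>2 * (1/5)" by (simp add: abs_mult)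
  qed
  hence "\<epsilon> / l * \<bar>u1 0\<bar> \<le> \<epsilon> / l * (2 * (1/10) / (\<epsilon> / l) + l\<^sup>2 / \<epsilon>\<^sup>2 * (1/5) * (\<epsilon> / l))"
    using h by (intro mult_left_mono) auto
  also have "\<dots> = 2/5" using \<epsilon> l0 by (simp add: field_simps power2_eq_square)
  finally show "\<bar>\<epsilon> * u1 0 / l\<bar> \<le> 1" using \<epsilon> l0 by (simp add: abs_mult abs_divide field_simps)
qed

text \<open>Near the pinned end the inhibitors of tail and core differ from their pinned values by at most \<open>x\<close>.
  The activator with the larger pinned inhibitor value is pushed upwards more strongly, hence has to
  start with the smaller slope, up to an error of order \<open>\<epsilon>\<close>.\<close>

lemma outer_inner_comparison:
  assumes so: "outer_solution \<gamma> \<epsilon> qo uo uo1 vo vo1" and si: "inner_solution \<gamma> \<epsilon> l qi ui ui1 vi vi1"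
    and \<gamma>: "0 < \<gamma>" "\<gamma> \<le> 1/100" and \<epsilon>: "0 < \<epsilon>" "\<epsilon> \<le> 1/100"
    and qo: "19/20 * jump \<le> qo" "qo \<le> 21/20 * jump" and qi: "19/20 * jump \<le> qi" "qi \<le> 21/20 * jump"
    and l: "0 < l" "l \<le> 7/2 * jump"
  shows "qo \<ge> qi \<Longrightarrow> \<epsilon> * uo1 0 \<le> \<epsilon> * ui1 0 / l + \<epsilon> * (10 / l)"
    and "qi \<ge> qo \<Longrightarrow> \<epsilon> * ui1 0 / l \<le> \<epsilon> * uo1 0 + \<epsilon> * (10 / l)"
proof -
  note So = half_solutionD[OF so[unfolded outer_solution_def]]
  note Si = half_solutionD[OF si[unfolded inner_solution_def]]
  note po = outer_v_abs[OF so \<gamma> \<epsilon> qo] outer_u_range[OF so \<gamma> \<epsilon> qo] outer_v_near_0[OF so \<gamma> \<epsilon> qo]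
  note pi = inner_v_range[OF si \<gamma> \<epsilon> qi l] inner_u_range[OF si \<gamma> \<epsilon> qi l] inner_v_near_0[OF si \<gamma> \<epsilon> qi l]
  have l1: "l \<le> 1/10" using l jump_bounds by simp
  have du: "deriv2_on {0..l} uo uo1 (\<lambda>x. 1 / \<epsilon>\<^sup>2 * (vo x - f_left (uo x)))"
    by (rule deriv2_on_subset[OF So(1)]) auto
  note di = inner_rescale(1)[OF si l(1)]
  have xl: "0 \<le> x / l" "x / l \<le> 1" if "0 \<le> x" "x \<le> l" for x using that l by auto
  have "uo1 0 - ui1 (0 / l) / l \<le> 10 / l" if "qo \<ge> qi"
  proof (rule slope_comparison[OF du So(3) di])
    show "vo x - vi (x / l) \<ge> - 1 * x" if "0 \<le> x" "x \<le> l" for x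
      using po(3)[of x] pi(1)[OF xl[OF that]] that l1 \<open>qo \<ge> qi\<close> by simp
    show "uo l - ui (l / l) \<le> 10 / l * l" using po(2)[of l] pi(2)[of 1] l lo_bounds by simp
  qed (use l l1 \<epsilon> Si(3) in \<open>auto simp: field_simps\<close>)
  hence "\<epsilon> * (uo1 0 - ui1 0 / l) \<le> \<epsilon> * (10 / l)" if "qo \<ge> qi" using that \<epsilon> by (intro mult_left_mono) auto
  thus "qo \<ge> qi \<Longrightarrow> \<epsilon> * uo1 0 \<le> \<epsilon> * ui1 0 / l + \<epsilon> * (10 / l)" by (simp add: right_diff_distrib)
  have "ui1 (0 / l) / l - uo1 0 \<le> 10 / l" if "qi \<ge> qo"
  proof (rule slope_comparison[OF di _ du So(3)])
    show "vi (x / l) - vo x \<ge> - 1 * x" if x: "0 \<le> x" "x \<le> l" for x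
    proof -
      have "12/10 * l\<^sup>2 * (x / l) = (12/10 * l) * x" using l by (simp add: power2_eq_square)
      also have "\<dots> \<le> 1 * x" using x l1 by (intro mult_right_mono) auto
      finally show ?thesis using po(1)[of x] pi(3)[OF xl[OF x]] x \<open>qi \<ge> qo\<close> by simp
    qed
    show "ui (l / l) - uo l \<le> 10 / l * l" using po(2)[of l] pi(2)[of 1] l lo_bounds by simp
  qed (use l l1 \<epsilon> Si(3) in \<open>auto simp: field_simps\<close>)
  hence "\<epsilon> * (ui1 0 / l - uo1 0) \<le> \<epsilon> * (10 / l)" if "qi \<ge> qo" using that \<epsilon> by (intro mult_left_mono) auto
  thus "qi \<ge> qo \<Longrightarrow> \<epsilon> * ui1 0 / l \<le> \<epsilon> * uo1 0 + \<epsilon> * (10 / l)" by (simp add: right_diff_distrib)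
qed

end

section \<open>The transition layer\<close>

lemma abs_drift:
  fixes z :: "real \<Rightarrow> real"
  assumes d: "\<And>s. 0 \<le> s \<Longrightarrow> s \<le> S \<Longrightarrow> (z has_real_derivative z1 s) (at s)"
    and c: "\<And>s. 0 \<le> s \<Longrightarrow> s \<le> S \<Longrightarrow> \<bar>z1 s\<bar> \<le> c" and s: "0 \<le> s" "s \<le> S"
  shows "\<bar>z s - z 0\<bar> \<le> c * S"
proof (cases "s = 0")
  case True
  have "0 \<le> c" using c[of 0] s by simp
  thus ?thesis using True s by simp
next
  case False
  then obtain t where t: "0 < t" "t < s" "z s - z 0 = (s - 0) * z1 t"
    using MVT2[of 0 s z z1] d s by auto
  have "\<bar>(s - 0) * z1 t\<bar> \<le> S * c"
    unfolding abs_mult using s t c[of t] by (intro mult_mono) auto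
  thus ?thesis using t by (simp add: mult.commute)
qed

lemma norm_fst_snd_le:
  fixes X :: state
  assumes "X = (u, y, v, w)"
  shows "\<bar>u\<bar> \<le> norm X" "\<bar>y\<bar> \<le> norm X" "\<bar>v\<bar> \<le> norm X" "\<bar>w\<bar> \<le> norm X"
    and "norm X \<le> \<bar>u\<bar> + \<bar>y\<bar> + \<bar>v\<bar> + \<bar>w\<bar>"
proof -
  have 1: "norm u \<le> norm (u, y, v, w)" "norm (y, v, w) \<le> norm (u, y, v, w)"
    "norm y \<le> norm (y, v, w)" "norm (v, w) \<le> norm (y, v, w)" "norm v \<le> norm (v, w)" "norm w \<le> norm (v, w)"
    using norm_fst_le[of u "(y, v, w)"] norm_snd_le[of "(y, v, w)" u] norm_fst_le[of y "(v, w)"]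
      norm_snd_le[of "(v, w)" y] norm_fst_le[of v w] norm_snd_le[of w v] by auto
  show "\<bar>u\<bar> \<le> norm X" "\<bar>y\<bar> \<le> norm X" "\<bar>v\<bar> \<le> norm X" "\<bar>w\<bar> \<le> norm X"
    using 1 unfolding assms real_norm_def by linarith+
  show "norm X \<le> \<bar>u\<bar> + \<bar>y\<bar> + \<bar>v\<bar> + \<bar>w\<bar>"
    using norm_Pair_le[of u "(y, v, w)"] norm_Pair_le[of y "(v, w)"] norm_Pair_le[of v w]
    unfolding assms real_norm_def by linarith
qed

context cubic_parameter
begin

text \<open>The cubic between \<open>0\<close> and \<open>2 * mid\<close>, continued with a steep negative slope. The continuation is Lipschitz,
  and to the left of \<open>0\<close> its antiderivative drops so fast that the linear term \<open>u * q\<close> cannot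
  compete.\<close>

definition clamp_m :: "real \<Rightarrow> real" where "clamp_m u = max 0 (min (2 * mid) u)"

definition f_mid :: "real \<Rightarrow> real" where "f_mid u = cubic \<beta> (clamp_m u) - 100 * (u - clamp_m u)"

lemma f_mid_eq: "0 \<le> u \<Longrightarrow> u \<le> 2 * mid \<Longrightarrow> f_mid u = cubic \<beta> u"
  by (simp add: f_mid_def clamp_m_def)

lemma f_mid_neg: "u \<le> 0 \<Longrightarrow> f_mid u = - 100 * u"
  using mid_bounds by (simp add: f_mid_def clamp_m_def)

lemma f_mid_lipschitz: "\<bar>f_mid x - f_mid y\<bar> \<le> 101 * \<bar>x - y\<bar>"
proof -
  have b: "\<bar>(1 - \<beta> + \<beta>\<^sup>2) / 3 - 3 * (t - mid)\<^sup>2\<bar> \<le> 1" if "0 \<le> t" "t \<le> 2 * mid" for t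
  proof -
    have "\<bar>t - mid\<bar> \<le> 1/2" using that mid_bounds by (intro abs_leI) auto
    hence "(t - mid)\<^sup>2 \<le> (1/2)\<^sup>2" by (metis abs_ge_zero power2_abs power_mono)
    hence 1: "3 * (t - mid)\<^sup>2 \<le> 3/4" by (simp add: power2_eq_square)
    have "\<beta>\<^sup>2 \<le> 1" using beta by (intro power_le_one) auto
    hence "0 \<le> (1 - \<beta> + \<beta>\<^sup>2) / 3" "(1 - \<beta> + \<beta>\<^sup>2) / 3 \<le> 1" using beta by auto
    moreover have "0 \<le> 3 * (t - mid)\<^sup>2" by simp
    ultimately show ?thesis using 1 by (intro abs_leI) linarith+
  qed
  have n: "\<bar>cubic \<beta> u - cubic \<beta> u'\<bar> \<le> u' - u" if "0 \<le> u" "u < u'" "u' \<le> 2 * mid" for u u'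
  proof -
    have "\<exists>t. u < t \<and> t < u' \<and> cubic \<beta> u' - cubic \<beta> u = (u' - u) * ((1 - \<beta> + \<beta>\<^sup>2) / 3 - 3 * (t - mid)\<^sup>2)"
      by (rule MVT2) (use that in \<open>auto intro!: cubic_deriv\<close>)
    then obtain t where t: "u < t" "t < u'" "cubic \<beta> u' - cubic \<beta> u = (u' - u) * ((1 - \<beta> + \<beta>\<^sup>2) / 3 - 3 * (t - mid)\<^sup>2)"
      by blast
    have "\<bar>cubic \<beta> u' - cubic \<beta> u\<bar> \<le> (u' - u) * 1"
      unfolding t(3) abs_mult using t that by (intro mult_mono b) auto
    thus ?thesis by (simp add: abs_minus_commute)
  qed
  have "\<bar>cubic \<beta> (clamp_m x) - cubic \<beta> (clamp_m y)\<bar> \<le> \<bar>clamp_m x - clamp_m y\<bar>"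
  proof (cases "clamp_m x" "clamp_m y" rule: linorder_cases)
    case less
    have "\<bar>cubic \<beta> (clamp_m x) - cubic \<beta> (clamp_m y)\<bar> \<le> clamp_m y - clamp_m x"
      by (rule n) (use less mid_bounds in \<open>auto simp: clamp_m_def\<close>)
    then show ?thesis using less by simp
  next
    case greater
    have "\<bar>cubic \<beta> (clamp_m y) - cubic \<beta> (clamp_m x)\<bar> \<le> clamp_m x - clamp_m y"
      by (rule n) (use greater mid_bounds in \<open>auto simp: clamp_m_def\<close>)
    then show ?thesis using greater by (simp add: abs_minus_commute)
  qed simp
  also have "\<bar>clamp_m x - clamp_m y\<bar> \<le> \<bar>x - y\<bar>" by (auto simp: clamp_m_def max_def min_def)
  finally have 1: "\<bar>cubic \<beta> (clamp_m x) - cubic \<beta> (clamp_m y)\<bar> \<le> \<bar>x - y\<bar>" .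
  have "\<bar>(x - clamp_m x) - (y - clamp_m y)\<bar> \<le> \<bar>x - y\<bar>" using mid_bounds by (auto simp: clamp_m_def max_def min_def)
  hence 2: "\<bar>100 * ((x - clamp_m x) - (y - clamp_m y))\<bar> \<le> 100 * \<bar>x - y\<bar>" unfolding abs_mult by simp
  have "f_mid x - f_mid y = (cubic \<beta> (clamp_m x) - cubic \<beta> (clamp_m y)) - 100 * ((x - clamp_m x) - (y - clamp_m y))"
    by (simp add: f_mid_def algebra_simps)
  thus ?thesis
    using abs_triangle_ineq4[of "cubic \<beta> (clamp_m x) - cubic \<beta> (clamp_m y)" "100 * ((x - clamp_m x) - (y - clamp_m y))"] 1 2
    by simp
qed

definition F_mid :: "real \<Rightarrow> real" where
  "F_mid = (SOME G. G 0 = 0 \<and> (\<forall>x. (G has_real_derivative f_mid x) (at x)))"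

lemma F_mid: "F_mid 0 = 0" "(F_mid has_real_derivative f_mid x) (at x)"
proof -
  have "continuous_on UNIV f_mid" by (rule lipschitz_continuous_real[OF f_mid_lipschitz])
  then obtain G where "G 0 = 0" "\<And>x. (G has_vector_derivative f_mid x) (at x)"
    using antiderivative_UNIV by blast
  hence "\<exists>G. G 0 = 0 \<and> (\<forall>x. (G has_real_derivative f_mid x) (at x))"
    by (auto simp: has_real_derivative_iff_has_vector_derivative)
  from someI_ex[OF this] show "F_mid 0 = 0" "(F_mid has_real_derivative f_mid x) (at x)"
    unfolding F_mid_def by blast+
qed

lemma F_mid_inside:
  assumes "0 \<le> u" "u \<le> 2 * mid"
  shows "F_mid u = u * jump + ((u - mid)\<^sup>2 - mid\<^sup>2) * ((1 - \<beta> + \<beta>\<^sup>2) / 6 - ((u - mid)\<^sup>2 + mid\<^sup>2) / 4)"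
proof -
  define r where "r = (1 - \<beta> + \<beta>\<^sup>2) / 6"
  define z where "z = (\<lambda>u. F_mid u - (u * jump + r * (u - mid) ^ 2 - (u - mid) ^ 4 / 4))"
  have cub: "cubic \<beta> x = jump + 2 * r * (x - mid) - (x - mid) ^ 3" for x
    unfolding cubic_def jump_def mid_def r_def by (simp add: field_simps power2_eq_square power3_eq_cube)
  have "(z has_real_derivative 0) (at x)" if "0 \<le> x" "x \<le> u" for x
  proof -
    have "(z has_real_derivative f_mid x - (jump + 2 * r * (x - mid) - (x - mid) ^ 3)) (at x)"
      unfolding z_def by (auto intro!: derivative_eq_intros F_mid(2))
    thus ?thesis using f_mid_eq[of x] cub[of x] that assms by simp
  qed
  hence "\<bar>z u - z 0\<bar> \<le> 0 * u" using assms by (intro abs_drift[where ?z1.0="\<lambda>_. 0"]) auto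
  hence "F_mid u = u * jump + r * (u - mid) ^ 2 - (u - mid) ^ 4 / 4 - (r * mid ^ 2 - mid ^ 4 / 4)"
    by (simp add: z_def F_mid)
  also have "\<dots> = u * jump + ((u - mid)\<^sup>2 - mid\<^sup>2) * (r - ((u - mid)\<^sup>2 + mid\<^sup>2) / 4)"
  proof -
    have "r * w ^ 2 - w ^ 4 / 4 - (r * mid ^ 2 - mid ^ 4 / 4) = (w\<^sup>2 - mid\<^sup>2) * (r - (w\<^sup>2 + mid\<^sup>2) / 4)" for w :: real
      by (simp add: power2_eq_square power4_eq_xxxx field_simps)
    from this[of "u - mid"] show ?thesis by (simp only: add_diff_eq[symmetric] diff_diff_eq)
  qed
  finally show ?thesis by (simp only: r_def)
qed

lemma F_mid_neg: "u \<le> 0 \<Longrightarrow> F_mid u = - 50 * u\<^sup>2"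
proof -
  assume u: "u \<le> 0"
  define z where "z = (\<lambda>t. F_mid (- t) + 50 * t\<^sup>2)"
  have "(z has_real_derivative 0) (at x)" if "0 \<le> x" for x
  proof -
    have "((\<lambda>t. F_mid (- t)) has_real_derivative f_mid (- x) * (- 1)) (at x)"
      by (rule DERIV_chain2[OF F_mid(2)]) (auto intro!: derivative_eq_intros)
    hence "(z has_real_derivative f_mid (- x) * (- 1) + 100 * x) (at x)"
      unfolding z_def by (auto intro!: derivative_eq_intros)
    thus ?thesis using f_mid_neg[of "- x"] that by simp
  qed
  hence "\<bar>z (- u) - z 0\<bar> \<le> 0 * (- u)" using u by (intro abs_drift[where ?z1.0="\<lambda>_. 0"]) auto
  moreover have "z 0 = 0" by (simp add: z_def F_mid)
  ultimately show ?thesis by (simp add: z_def)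
qed

text \<open>The equal area rule: the line at height \<open>jump\<close> through the centre of symmetry cuts off equal areas
  above and below, so the potential \<open>F_mid u - u * jump\<close> has the same value at both ends of the
  layer.\<close>

lemma F_mid_two_mid: "F_mid (2 * mid) = 2 * mid * jump"
  using F_mid_inside[of "2 * mid"] mid_bounds by simp

text \<open>At \<open>q = jump\<close> the potential \<open>F_mid u - u * q\<close> is at most its common value at \<open>0\<close> and \<open>2 * mid\<close>: between
  these points their difference is the product of \<open>(u - mid)\<^sup>2 - mid\<^sup>2\<close> and a quantity that is nonnegative
  because \<open>\<beta> \<le> 1/2\<close>. Hence an orbit of the layer equation that starts at \<open>2 * mid\<close> with some speed is not stopped on its way
  down.\<close>

lemma potential_bound:
  assumes "u \<le> 2 * mid"
  shows "F_mid (2 * mid) - 2 * mid * q - (F_mid u - u * q) \<ge> - \<bar>q - jump\<bar> - q\<^sup>2 / 200"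
proof (cases "u \<ge> 0")
  case True
  have "(u - mid)\<^sup>2 - mid\<^sup>2 \<le> 0"
  proof -
    have "(u - mid)\<^sup>2 - mid\<^sup>2 = u * (u - 2 * mid)" by (simp add: power2_eq_square algebra_simps)
    thus ?thesis using True assms by (simp add: mult_nonneg_nonpos)
  qed
  moreover have "(1 - \<beta> + \<beta>\<^sup>2) / 6 - ((u - mid)\<^sup>2 + mid\<^sup>2) / 4 \<ge> 0"
  proof -
    have "(1 - \<beta> + \<beta>\<^sup>2) / 6 - mid\<^sup>2 / 2 = (2 - \<beta>) * (1 - 2 * \<beta>) / 18"
      by (simp add: mid_def power2_eq_square field_simps)
    moreover have "\<dots> \<ge> 0" using beta by simp
    ultimately show ?thesis using \<open>(u - mid)\<^sup>2 - mid\<^sup>2 \<le> 0\<close> by (simp add: field_simps)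
  qed
  ultimately have "((u - mid)\<^sup>2 - mid\<^sup>2) * ((1 - \<beta> + \<beta>\<^sup>2) / 6 - ((u - mid)\<^sup>2 + mid\<^sup>2) / 4) \<le> 0"
    by (rule mult_nonpos_nonneg)
  hence F: "F_mid u \<le> u * jump" using F_mid_inside[OF True assms] by simp
  have "\<bar>(q - jump) * (2 * mid - u)\<bar> \<le> \<bar>q - jump\<bar> * 1"
    unfolding abs_mult using True assms mid_bounds by (intro mult_left_mono) auto
  hence "(q - jump) * (2 * mid - u) \<le> \<bar>q - jump\<bar>" by (simp add: abs_le_iff)
  moreover have "F_mid (2 * mid) - 2 * mid * q - (F_mid u - u * q) = (u * jump - F_mid u) - (q - jump) * (2 * mid - u)"
    unfolding F_mid_two_mid by (simp add: algebra_simps)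
  moreover have "q\<^sup>2 / 200 \<ge> 0" by simp
  ultimately show ?thesis using F by linarith
next
  case False
  have "\<bar>2 * mid * (q - jump)\<bar> \<le> 1 * \<bar>q - jump\<bar>"
    unfolding abs_mult using mid_bounds by (intro mult_right_mono) auto
  hence "2 * mid * (q - jump) \<le> \<bar>q - jump\<bar>" by (simp add: abs_le_iff)
  moreover have "F_mid (2 * mid) - 2 * mid * q - (F_mid u - u * q) = - (2 * mid * (q - jump)) + (50 * u\<^sup>2 + u * q)"
    using False unfolding F_mid_two_mid by (simp add: F_mid_neg algebra_simps)
  moreover have "50 * u\<^sup>2 + u * q = 50 * (u + q / 100)\<^sup>2 - q\<^sup>2 / 200"
    by (simp add: power2_eq_square field_simps)
  moreover have "50 * (u + q / 100)\<^sup>2 \<ge> 0" by simp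
  ultimately show ?thesis by linarith
qed

text \<open>The system in the fast variable \<open>s = x / \<epsilon>\<close>, with \<open>y = \<epsilon> * u'\<close>. Inhibitor and its slope move with velocity
  \<open>O(\<epsilon>)\<close>.\<close>

definition layer_field :: "real \<Rightarrow> real \<Rightarrow> state \<Rightarrow> state" where
  "layer_field \<gamma> \<epsilon> = (\<lambda>(u, y, v, w). (y, v - f_mid u, \<epsilon> * w, \<epsilon> * (g_out \<gamma> v - u)))"

lemma layer_field_lipschitz:
  assumes \<gamma>: "0 < \<gamma>" "\<gamma> \<le> 1/100" and \<epsilon>: "0 < \<epsilon>" "\<epsilon> \<le> 1"
  shows "norm (layer_field \<gamma> \<epsilon> X - layer_field \<gamma> \<epsilon> X') \<le> 110 * norm (X - X')"
proof -
  obtain u y v w where X: "X = (u, y, v, w)" by (cases X)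
  obtain u' y' v' w' where X': "X' = (u', y', v', w')" by (cases X')
  let ?N = "norm (X - X')"
  have D: "X - X' = (u - u', y - y', v - v', w - w')" by (simp add: X X')
  note N = norm_fst_snd_le(1-4)[OF D]
  have FD: "layer_field \<gamma> \<epsilon> X - layer_field \<gamma> \<epsilon> X' =
      (y - y', (v - v') - (f_mid u - f_mid u'), \<epsilon> * (w - w'), \<epsilon> * ((g_out \<gamma> v - g_out \<gamma> v') - (u - u')))"
    by (simp add: layer_field_def X X' algebra_simps)
  have 1: "\<bar>(v - v') - (f_mid u - f_mid u')\<bar> \<le> 102 * ?N"
    using abs_triangle_ineq4[of "v - v'" "f_mid u - f_mid u'"] f_mid_lipschitz[of u u'] N by simp
  have "\<epsilon> * \<bar>w - w'\<bar> \<le> 1 * ?N" using \<epsilon> N by (intro mult_mono) auto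
  hence 2: "\<bar>\<epsilon> * (w - w')\<bar> \<le> ?N" using \<epsilon> by (simp add: abs_mult)
  have "\<bar>(g_out \<gamma> v - g_out \<gamma> v') - (u - u')\<bar> \<le> 2 * ?N"
  proof -
    have "\<bar>g_out \<gamma> v - g_out \<gamma> v'\<bar> \<le> ?N"
      by (rule order_trans[OF _ N(3)], rule order_trans[OF g_out_lipschitz[OF \<gamma>]]) simp
    thus ?thesis using abs_triangle_ineq4[of "g_out \<gamma> v - g_out \<gamma> v'" "u - u'"] N(1) by simp
  qed
  hence "\<epsilon> * \<bar>(g_out \<gamma> v - g_out \<gamma> v') - (u - u')\<bar> \<le> 1 * (2 * ?N)" using \<epsilon> by (intro mult_mono) auto
  hence 3: "\<bar>\<epsilon> * ((g_out \<gamma> v - g_out \<gamma> v') - (u - u'))\<bar> \<le> 2 * ?N" using \<epsilon> by (simp add: abs_mult)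
  show ?thesis
    using norm_fst_snd_le(5)[OF FD] 1 2 3 N(2) norm_ge_zero[of "X - X'"] by simp
qed

lemma layer_field_zero: "layer_field \<gamma> \<epsilon> 0 = 0"
  using f_mid_neg[of 0] by (simp add: layer_field_def zero_prod_def)

text \<open>In this time the speed \<open>jump / 8\<close> carries \<open>u\<close> over the distance \<open>1 > 2 * mid\<close>.\<close>

definition layer_time :: real where "layer_time = 8 / jump"

text \<open>For frozen \<open>v\<close> the energy \<open>y\<^sup>2 / 2 + F_mid u - u * v\<close> is conserved, so here it drifts by \<open>O(\<epsilon>)\<close> only. With the
  bound on the potential this gives a lower bound for \<open>y\<^sup>2\<close> as long as \<open>u \<le> 2 * mid\<close>. As \<open>y\<close> starts
  negative, it cannot change sign; so \<open>u\<close> keeps decreasing with at least the speed \<open>jump / 8\<close> and crosses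
  \<open>0\<close>.\<close>

lemma layer_properties:
  assumes X: "\<And>s. 0 \<le> s \<Longrightarrow> s \<le> layer_time \<Longrightarrow> (X has_vector_derivative layer_field \<gamma> \<epsilon> (X s)) (at s)"
    and X_eq: "X = (\<lambda>s. (u s, y s, v s, w s))" and init: "u 0 = 2 * mid" "y 0 \<le> - (jump / 4)" "v 0 = q"
    and R: "\<And>s. 0 \<le> s \<Longrightarrow> s \<le> layer_time \<Longrightarrow> norm (X s) \<le> R"
    and \<gamma>: "0 < \<gamma>" "\<gamma> \<le> 1/100" and \<epsilon>: "0 < \<epsilon>"
    and q: "\<bar>q - jump\<bar> \<le> jump\<^sup>2 / 128"
    and small: "\<epsilon> * (2 * (R + R\<^sup>2) * layer_time) \<le> jump\<^sup>2 / 128"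
    and s: "0 \<le> s" "s \<le> layer_time"
  defines "drift \<equiv> \<epsilon> * (2 * (R + R\<^sup>2) * layer_time)"
  shows layer_v: "\<bar>v s - q\<bar> \<le> drift" and layer_w: "\<bar>w s - w 0\<bar> \<le> drift"
    and layer_energy: "\<bar>((y s)\<^sup>2 / 2 + F_mid (u s) - u s * v s) - ((y 0)\<^sup>2 / 2 + F_mid (2 * mid) - 2 * mid * q)\<bar> \<le> drift"
    and layer_y: "y s \<le> - (jump / 8)"
    and layer_u_mono: "\<And>t. 0 \<le> t \<Longrightarrow> t \<le> s \<Longrightarrow> u s \<le> u t"
    and layer_exit: "u layer_time < 0"
proof -
  let ?S = layer_time
  have S: "?S > 0" using jump_bounds by (simp add: layer_time_def)
  have d: "(u has_real_derivative y s) (at s)" "(y has_real_derivative v s - f_mid (u s)) (at s)"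
    "(v has_real_derivative \<epsilon> * w s) (at s)" "(w has_real_derivative \<epsilon> * (g_out \<gamma> (v s) - u s)) (at s)"
    if s: "0 \<le> s" "s \<le> ?S" for s
  proof -
    have D: "((\<lambda>s. (u s, y s, v s, w s)) has_vector_derivative
        (y s, v s - f_mid (u s), \<epsilon> * w s, \<epsilon> * (g_out \<gamma> (v s) - u s))) (at s)"
      using X[OF s] by (simp add: X_eq layer_field_def)
    show "(u has_real_derivative y s) (at s)" "(y has_real_derivative v s - f_mid (u s)) (at s)"
      "(v has_real_derivative \<epsilon> * w s) (at s)" "(w has_real_derivative \<epsilon> * (g_out \<gamma> (v s) - u s)) (at s)"
      by (rule state_derivativeD[OF D])+
  qed
  have b: "\<bar>u s\<bar> \<le> R" "\<bar>v s\<bar> \<le> R" "\<bar>w s\<bar> \<le> R" if s: "0 \<le> s" "s \<le> ?S" for s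
    using norm_fst_snd_le[of "X s" "u s" "y s" "v s" "w s"] R[OF s] by (auto simp: X_eq)
  have R0: "R \<ge> 0" using b(1)[of 0] S by simp
  have dv: "\<bar>v s - q\<bar> \<le> \<epsilon> * R * ?S" if s: "0 \<le> s" "s \<le> ?S" for s
    unfolding init(3)[symmetric] by (rule abs_drift[OF d(3) _ s]) (use b(3) \<epsilon> in \<open>auto simp: abs_mult\<close>)
  have dw: "\<bar>w s - w 0\<bar> \<le> \<epsilon> * (2 * R) * ?S" if s: "0 \<le> s" "s \<le> ?S" for s
  proof (rule abs_drift[OF d(4) _ s])
    fix t assume t: "0 \<le> t" "t \<le> ?S"
    have "\<bar>g_out \<gamma> (v t) - u t\<bar> \<le> 2 * R"
      using g_out_abs[OF \<gamma>, of "v t"] b(1)[OF t] b(2)[OF t] R0 abs_triangle_ineq4[of "g_out \<gamma> (v t)" "u t"] by simp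
    thus "\<bar>\<epsilon> * (g_out \<gamma> (v t) - u t)\<bar> \<le> \<epsilon> * (2 * R)" using \<epsilon> by (simp add: abs_mult)
  qed
  define E where "E = (\<lambda>s. (y s)\<^sup>2 / 2 + F_mid (u s) - u s * v s)"
  have dE: "\<bar>E s - E 0\<bar> \<le> \<epsilon> * R\<^sup>2 * ?S" if s: "0 \<le> s" "s \<le> ?S" for s
  proof (rule abs_drift[OF _ _ s])
    fix t assume t: "0 \<le> t" "t \<le> ?S"
    show "(E has_real_derivative - (\<epsilon> * (u t * w t))) (at t)"
      unfolding E_def using t
      by (auto intro!: derivative_eq_intros d DERIV_chain2[OF F_mid(2)] simp: field_simps)
    have "\<bar>u t\<bar> * \<bar>w t\<bar> \<le> R * R" using b[OF t] R0 by (intro mult_mono) auto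
    thus "\<bar>- (\<epsilon> * (u t * w t))\<bar> \<le> \<epsilon> * R\<^sup>2" using \<epsilon> by (simp add: abs_mult power2_eq_square)
  qed
  have nn: "\<epsilon> * R * ?S \<ge> 0" "\<epsilon> * R\<^sup>2 * ?S \<ge> 0" using \<epsilon> R0 S by auto
  have dr: "drift = 2 * (\<epsilon> * R * ?S) + 2 * (\<epsilon> * R\<^sup>2 * ?S)" by (simp add: drift_def algebra_simps)
  show "\<bar>v s - q\<bar> \<le> drift" using dv[OF s] nn dr by simp
  show "\<bar>w s - w 0\<bar> \<le> drift" using dw[OF s] nn dr by simp
  show "\<bar>((y s)\<^sup>2 / 2 + F_mid (u s) - u s * v s) - ((y 0)\<^sup>2 / 2 + F_mid (2 * mid) - 2 * mid * q)\<bar> \<le> drift"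
    using dE[OF s] nn dr init by (simp add: E_def)
  \<comment> \<open>As long as \<open>u \<le> 2 * mid\<close>, the energy keeps the speed away from zero.\<close>
  have speed: "(y t)\<^sup>2 \<ge> (jump / 8)\<^sup>2" if t: "0 \<le> t" "t \<le> ?S" and ut: "u t \<le> 2 * mid" for t
  proof -
    have "\<bar>u t * (v t - q)\<bar> \<le> R * (\<epsilon> * R * ?S)" unfolding abs_mult using b(1)[OF t] dv[OF t] R0 by (intro mult_mono) auto
    hence 1: "u t * (v t - q) \<ge> - (\<epsilon> * R\<^sup>2 * ?S)" by (simp add: abs_le_iff power2_eq_square mult_ac)
    have 2: "E t \<ge> E 0 - \<epsilon> * R\<^sup>2 * ?S" using dE[OF t] by (simp add: abs_le_iff)
    have "(y t)\<^sup>2 / 2 = E t - (F_mid (u t) - u t * q) + u t * (v t - q)" by (simp add: E_def algebra_simps)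
    moreover have "E 0 = (y 0)\<^sup>2 / 2 + (F_mid (2 * mid) - 2 * mid * q)" by (simp add: E_def init)
    moreover have "2 * (\<epsilon> * R\<^sup>2 * ?S) \<le> jump\<^sup>2 / 128" using small nn dr unfolding drift_def by simp
    ultimately have 3: "(y t)\<^sup>2 / 2 \<ge> (y 0)\<^sup>2 / 2 - \<bar>q - jump\<bar> - q\<^sup>2 / 200 - jump\<^sup>2 / 128"
      using potential_bound[OF ut, of q] 1 2 by linarith
    have "(jump / 4)\<^sup>2 \<le> (- y 0)\<^sup>2" using init jump_bounds by (intro power_mono) auto
    hence 4: "(y 0)\<^sup>2 \<ge> jump\<^sup>2 / 16" by (simp add: power_divide)
    have "jump\<^sup>2 / 128 \<le> jump / 100" using jump_bounds by (simp add: power2_eq_square)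
    hence "\<bar>q\<bar> \<le> 11/10 * jump" using abs_le_D1[OF q] abs_le_D2[OF q] jump_bounds by (intro abs_leI) auto
    hence "\<bar>q\<bar>\<^sup>2 \<le> (11/10 * jump)\<^sup>2" by (intro power_mono) auto
    hence 5: "q\<^sup>2 \<le> 121/100 * jump\<^sup>2" by (simp add: power_mult_distrib power_divide)
    have "(jump / 8)\<^sup>2 = jump\<^sup>2 / 64" by (simp add: power_divide)
    thus ?thesis using 3 4 5 q zero_le_power2[of jump] by linarith
  qed
  have cy: "continuous_on {0..?S} y"
    by (intro continuous_at_imp_continuous_on ballI DERIV_isCont[OF d(2)]) auto
  have mono: "u b \<le> u a" if ab: "0 \<le> a" "a \<le> b" "b \<le> ?S" "\<And>t. a < t \<Longrightarrow> t < b \<Longrightarrow> y t \<le> 0" for a b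
  proof (cases "a = b")
    case False
    then obtain t where t: "a < t" "t < b" "u b - u a = (b - a) * y t"
      using MVT2[of a b u y] d ab by auto
    have "(b - a) * y t \<le> 0" using ab t by (intro mult_nonneg_nonpos) auto
    thus ?thesis using t by simp
  qed simp
  have neg: "y t < - (jump / 16)" if t: "0 \<le> t" "t \<le> ?S" for t
  proof (rule ccontr)
    assume "\<not> y t < - (jump / 16)"
    define T where "T = {0..?S} \<inter> y -` {- (jump / 16)..}"
    have "closed T" unfolding T_def by (intro continuous_closed_preimage[OF cy]) auto
    moreover have "bounded T" by (rule bounded_subset[OF bounded_closed_interval[of 0 ?S]]) (auto simp: T_def)
    ultimately have "compact T" by (simp add: compact_eq_bounded_closed)
    moreover have "T \<noteq> {}" using t \<open>\<not> y t < - (jump / 16)\<close> by (auto simp: T_def)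
    ultimately obtain m where m: "m \<in> T" "\<And>r. r \<in> T \<Longrightarrow> m \<le> r" using compact_attains_inf by metis
    have m': "0 \<le> m" "m \<le> ?S" "y m \<ge> - (jump / 16)" using m(1) by (auto simp: T_def)
    have before: "y r < - (jump / 16)" if "0 \<le> r" "r < m" for r
      using m(2)[of r] that m' by (force simp: T_def)
    have "y r \<le> 0" if "0 < r" "r < m" for r using before[of r] that jump_bounds by simp
    hence "u m \<le> u 0" using m' by (intro mono) auto
    hence sp: "(y m)\<^sup>2 \<ge> (jump / 8)\<^sup>2" using speed[of m] m' init by simp
    have "\<exists>r\<ge>0. r \<le> m \<and> y r = - (jump / 16)"
      by (rule IVT') (use init m' jump_bounds cy in \<open>auto intro: continuous_on_subset\<close>)
    then obtain r where "0 \<le> r" "r \<le> m" "y r = - (jump / 16)" by blast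
    hence "y m = - (jump / 16)" using before[of r] by (cases "r = m") auto
    hence "(jump / 16)\<^sup>2 \<ge> (jump / 8)\<^sup>2" using sp by simp
    thus False using jump_bounds by (simp add: power_divide)
  qed
  have anti: "u b \<le> u a" if "0 \<le> a" "a \<le> b" "b \<le> ?S" for a b
  proof (rule mono[OF that])
    fix t assume "a < t" "t < b"
    thus "y t \<le> 0" using neg[of t] that jump_bounds by simp
  qed
  have y8: "y t \<le> - (jump / 8)" if t: "0 \<le> t" "t \<le> ?S" for t
  proof -
    have "(- y t)\<^sup>2 \<ge> (jump / 8)\<^sup>2" using speed[OF t] anti[of 0 t] t init by simp
    hence "jump / 8 \<le> - y t" by (rule power2_le_imp_le) (use neg[OF t] jump_bounds in simp)
    thus ?thesis by simp
  qed
  show "y s \<le> - (jump / 8)" by (rule y8[OF s])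
  show "u s \<le> u t" if "0 \<le> t" "t \<le> s" for t using anti[OF that s(2)] .
  obtain t where t: "0 < t" "t < ?S" "u ?S - u 0 = (?S - 0) * y t"
    using MVT2[of 0 ?S u y] d S by auto
  have "?S * y t \<le> ?S * - (jump / 8)" using y8[of t] t S by (intro mult_left_mono) auto
  also have "\<dots> = - 1" using jump_bounds by (simp add: layer_time_def)
  finally show "u ?S < 0" using t init mid_bounds by simp
qed

end

lemma flow_continuous:
  fixes \<Phi> :: "'a::real_normed_vector \<Rightarrow> real \<Rightarrow> 'b::real_normed_vector"
  assumes lip: "\<And>a b s. 0 \<le> s \<Longrightarrow> norm (\<Phi> a s - \<Phi> b s) \<le> 2 * exp (2 * L * s) * norm (a - b)"
    and cont: "\<And>a s. 0 \<le> s \<Longrightarrow> isCont (\<Phi> a) s"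
  shows "continuous_on (UNIV \<times> {0..}) (\<lambda>(a, s). \<Phi> a s)"
  unfolding continuous_on_def
proof (intro ballI)
  fix x :: "'a \<times> real" assume "x \<in> UNIV \<times> {0..}"
  then obtain b t where x: "x = (b, t)" "t \<ge> 0" by auto
  let ?F = "at x within UNIV \<times> {0..}"
  have id: "(fst \<longlongrightarrow> b) ?F" "(snd \<longlongrightarrow> t) ?F"
    using tendsto_fst[OF tendsto_ident_at, of x] tendsto_snd[OF tendsto_ident_at, of x] x by auto
  have "((\<lambda>p. 2 * exp (2 * L * snd p) * norm (fst p - b)) \<longlongrightarrow> 2 * exp (2 * L * t) * norm (b - b)) ?F"
    by (intro tendsto_intros id)
  hence 1: "((\<lambda>p. 2 * exp (2 * L * snd p) * norm (fst p - b)) \<longlongrightarrow> 0) ?F" by simp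
  have ev: "\<forall>\<^sub>F p in ?F. norm (\<Phi> (fst p) (snd p) - \<Phi> b (snd p)) \<le> 2 * exp (2 * L * snd p) * norm (fst p - b)"
    unfolding eventually_at_filter by (auto intro!: lip always_eventually)
  have "((\<lambda>p. \<Phi> (fst p) (snd p) - \<Phi> b (snd p)) \<longlongrightarrow> 0) ?F"
    by (rule Lim_null_comparison[OF ev 1])
  moreover have "((\<lambda>p. \<Phi> b (snd p)) \<longlongrightarrow> \<Phi> b t) ?F"
    by (rule isCont_tendsto_compose[OF cont[OF x(2)] id(2)])
  ultimately have "((\<lambda>p. (\<Phi> (fst p) (snd p) - \<Phi> b (snd p)) + \<Phi> b (snd p)) \<longlongrightarrow> 0 + \<Phi> b t) ?F"
    by (rule tendsto_add)
  thus "((\<lambda>(a, s). \<Phi> a s) \<longlongrightarrow> (case x of (a, s) \<Rightarrow> \<Phi> a s)) ?F"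
    by (simp add: x case_prod_beta')
qed

section \<open>Matching\<close>

lemma square_le_perturbed:
  fixes X Y \<delta> :: real
  assumes "0 \<le> X" "X \<le> Y + \<delta>" "0 \<le> Y" "Y \<le> 1" "0 \<le> \<delta>"
  shows "X\<^sup>2 \<le> Y\<^sup>2 + 2 * \<delta> + \<delta>\<^sup>2"
proof -
  have "X\<^sup>2 \<le> (Y + \<delta>)\<^sup>2" using assms by (intro power_mono) auto
  also have "\<dots> = Y\<^sup>2 + 2 * (Y * \<delta>) + \<delta>\<^sup>2" by (simp add: power2_eq_square algebra_simps)
  also have "Y * \<delta> \<le> 1 * \<delta>" using assms by (intro mult_right_mono) auto
  finally show ?thesis by simp
qed

context cubic_parameter
begin

text \<open>Core, layer and tail fit together: the layer starts at the reflected data of the core and ends at those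
  of the tail.\<close>

definition matched_pieces :: "real \<Rightarrow> real \<Rightarrow> bool" where
  "matched_pieces \<gamma> \<epsilon> \<longleftrightarrow>
    (\<exists>l q S X ui ui1 vi vi1 q' uo uo1 vo vo1.
       inner_solution \<gamma> \<epsilon> l (2 * jump - q) ui ui1 vi vi1 \<and> 0 < l \<and> l \<le> 7/2 * jump \<and> 2 * jump - q \<in> pin_range \<and>
       outer_solution \<gamma> \<epsilon> q' uo uo1 vo vo1 \<and> q' \<in> pin_range \<and> 0 < S \<and>
       (\<forall>s. 0 \<le> s \<and> s \<le> S \<longrightarrow> (X has_vector_derivative layer_field \<gamma> \<epsilon> (X s)) (at s) \<and>
          0 \<le> fst (X s) \<and> fst (X s) \<le> 2 * mid \<and> \<bar>fst (snd (snd (X s)))\<bar> \<le> 1/10) \<and>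
       X 0 = (2 * mid, \<epsilon> * ui1 0 / l, q, vi1 0 / l) \<and> X S = (0, \<epsilon> * uo1 0, q', vo1 0))"

text \<open>The unknowns are the half length \<open>l\<close> of the core, the value \<open>q\<close> of \<open>v\<close> at the start of the layer and the
  duration \<open>S\<close> of the layer. Starting the layer at the data of the core, three equations remain at its
  end: \<open>v'\<close> agrees with the slope of the tail (\<open>f1\<close>), the layer energy agrees (\<open>f2\<close>) and \<open>u\<close> vanishes (\<open>f3\<close>).
  Each of them changes sign in one of the unknowns.
  \<^item> The slope of \<open>v\<close> produced by the core is about \<open>- l\<close>, that of the tail lies between negative constants,
    so \<open>f1\<close> is positive for small and negative for large \<open>l\<close>.
  \<^item> By the equal area rule the energies of core and tail side differ by about \<open>2 * mid * (jump - q)\<close>, and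
    by \<open>outer_inner_comparison\<close> the contribution of the slopes has the same sign up to \<open>O(\<epsilon>)\<close>.
  \<^item> \<open>u\<close> decreases from \<open>2 * mid\<close> to a negative value.
  
  Given \<open>u = 0\<close>, equality of the energies determines \<open>y\<close> up to sign, and neither the layer nor the tail allows a positive one.\<close>

theorem matching:
  assumes \<gamma>: "0 < \<gamma>" "\<gamma> \<le> 1/100"
  shows "\<exists>\<epsilon>0>0. \<epsilon>0 \<le> 1/100 \<and> (\<forall>\<epsilon>. 0 < \<epsilon> \<and> \<epsilon> \<le> \<epsilon>0 \<longrightarrow> matched_pieces \<gamma> \<epsilon>)"
proof -
  \<comment> \<open>\<open>\<eta>\<close> is the half width of the range of \<open>q\<close>; \<open>- c1\<close> bounds the slope of \<open>v\<close> in the tail from above; \<open>R\<close> bounds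
    the states of the layer, \<open>\<epsilon> * Dr\<close> their drift and \<open>\<epsilon> * C\<close> the error in the comparison of slopes.\<close>
  define \<eta> where "\<eta> = jump\<^sup>2 / 128"
  define c1 where "c1 = sqrt (2 * \<gamma>) / 2 * (19/20 * jump)"
  define l1 where "l1 = c1 / 4"
  define l2 where "l2 = 7/2 * jump"
  define R where "R = 2 * exp (2 * 110 * layer_time) * 4"
  define Dr where "Dr = 2 * (R + R\<^sup>2) * layer_time"
  define C where "C = 10 / l1"
  have j: "0 < jump" "jump < 1/36" by (rule jump_bounds)+
  have \<eta>: "0 < \<eta>" "\<eta> \<le> jump / 80"
    using j by (auto simp: \<eta>_def power2_eq_square)
  have c1: "0 < c1" using \<gamma> j by (simp add: c1_def)
  have "sqrt (2 * \<gamma>) \<le> sqrt 1" using \<gamma> by (intro real_sqrt_le_mono) auto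
  hence "c1 \<le> 1 / 2 * (19/20 * jump)" unfolding c1_def using j by (intro mult_right_mono) auto
  hence l12: "0 < l1" "l1 \<le> l2" using c1 j by (auto simp: l1_def l2_def)
  have LT: "layer_time > 0" using j by (simp add: layer_time_def)
  have R0: "R > 0" by (simp add: R_def)
  have Dr0: "Dr > 0" using R0 LT by (simp add: Dr_def add_pos_pos)
  have C0: "C > 0" using l12 by (simp add: C_def)
  define \<epsilon>0 where "\<epsilon>0 = Min {1/100, jump\<^sup>2, l1 / 2, \<eta> / 4 / Dr, c1 / 4 / Dr, jump / 10 / Dr, \<eta> / 8 / (C + C\<^sup>2)}"
  have \<epsilon>0: "\<epsilon>0 > 0" unfolding \<epsilon>0_def using j l12 \<eta> c1 Dr0 C0 by (auto simp: add_pos_pos)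
  have \<epsilon>0_le: "\<epsilon>0 \<le> x" if "x \<in> {1/100, jump\<^sup>2, l1 / 2, \<eta> / 4 / Dr, c1 / 4 / Dr, jump / 10 / Dr, \<eta> / 8 / (C + C\<^sup>2)}" for x
    unfolding \<epsilon>0_def by (rule Min_le) (use that in auto)
  have main: "matched_pieces \<gamma> \<epsilon>"
    if \<epsilon>: "0 < \<epsilon>" "\<epsilon> \<le> \<epsilon>0" for \<epsilon>
  proof -
    have "\<epsilon> \<le> 1/100" "\<epsilon> \<le> jump\<^sup>2" "\<epsilon> \<le> l1 / 2" "\<epsilon> \<le> \<eta> / 4 / Dr" "\<epsilon> \<le> c1 / 4 / Dr" "\<epsilon> \<le> jump / 10 / Dr"
      "\<epsilon> \<le> \<eta> / 8 / (C + C\<^sup>2)"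
      by (rule order_trans[OF \<epsilon>(2) \<epsilon>0_le], blast)+
    hence e: "\<epsilon> \<le> 1/100" "\<epsilon> \<le> jump\<^sup>2" "2 * \<epsilon> \<le> l1" "\<epsilon> * Dr \<le> \<eta> / 4" "\<epsilon> * Dr \<le> c1 / 4" "\<epsilon> * Dr \<le> jump / 10"
      "\<epsilon> * (C + C\<^sup>2) \<le> \<eta> / 8"
      using Dr0 C0 add_pos_pos[of C "C\<^sup>2"] by (simp_all add: pos_le_divide_eq algebra_simps)
    obtain Ao Bo where o: "\<And>q. q \<in> pin_range \<Longrightarrow> \<exists>u u1 v v1. outer_solution \<gamma> \<epsilon> q u u1 v v1 \<and> Ao q = \<epsilon> * u1 0 \<and> Bo q = v1 0"
      and co: "continuous_on pin_range Ao" "continuous_on pin_range Bo"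
      using outer_slopes[OF \<gamma> \<epsilon>(1) e(1)] by blast
    obtain Ai Bi where i: "\<And>l q. (l, q) \<in> {l1..7/2 * jump} \<times> pin_range \<Longrightarrow>
        \<exists>u u1 v v1. inner_solution \<gamma> \<epsilon> l q u u1 v v1 \<and> Ai (l, q) = \<epsilon> * u1 0 / l \<and> Bi (l, q) = v1 0 / l"
      and ci: "continuous_on ({l1..7/2 * jump} \<times> pin_range) Ai" "continuous_on ({l1..7/2 * jump} \<times> pin_range) Bi"
      using inner_slopes[OF \<gamma> \<epsilon>(1) e(1) l12(1)] by fast
    have "\<epsilon> \<le> 1" using e by simp
    obtain \<Phi> where \<Phi>: "\<And>a. \<Phi> a 0 = a"
      "\<And>a s. 0 \<le> s \<Longrightarrow> (\<Phi> a has_vector_derivative layer_field \<gamma> \<epsilon> (\<Phi> a s)) (at s)"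
      "\<And>a b s. 0 \<le> s \<Longrightarrow> norm (\<Phi> a s - \<Phi> b s) \<le> 2 * exp (2 * 110 * s) * norm (a - b)"
      "\<And>a s. 0 \<le> s \<Longrightarrow> norm (\<Phi> a s) \<le> 2 * exp (2 * 110 * s) * (norm a + norm (layer_field \<gamma> \<epsilon> 0) / 110)"
      using lipschitz_flow[OF layer_field_lipschitz[OF \<gamma> \<epsilon>(1) \<open>\<epsilon> \<le> 1\<close>] zero_less_numeral] by blast
    define B where "B = {l1..l2} \<times> {jump - \<eta>..jump + \<eta>} \<times> {0..layer_time}"
    define init :: "real \<times> real \<times> real \<Rightarrow> state" where
      "init = (\<lambda>p. (2 * mid, Ai (fst p, 2 * jump - fst (snd p)), fst (snd p), Bi (fst p, 2 * jump - fst (snd p))))"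
    define us where "us = (\<lambda>p s. fst (\<Phi> (init p) s))"
    define ys where "ys = (\<lambda>p s. fst (snd (\<Phi> (init p) s)))"
    define vs where "vs = (\<lambda>p s. fst (snd (snd (\<Phi> (init p) s))))"
    define ws where "ws = (\<lambda>p s. snd (snd (snd (\<Phi> (init p) s))))"
    have X_eq: "\<Phi> (init p) = (\<lambda>s. (us p s, ys p s, vs p s, ws p s))" for p
      by (simp add: us_def ys_def vs_def ws_def)
    have inQ: "2 * jump - q \<in> pin_range" "q \<in> pin_range" if "q \<in> {jump - \<eta>..jump + \<eta>}" for q
      using that \<eta> j by (auto simp: pin_range_def)
    have Ai_facts: "Ai (l, q) \<le> - (jump / 4)" "\<bar>Ai (l, q)\<bar> \<le> 1" "- (12/10) * l \<le> Bi (l, q)" "Bi (l, q) \<le> - (88/100) * l"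
      if l: "l \<in> {l1..l2}" and q: "q \<in> pin_range" for l q
    proof -
      obtain u u1 v v1 where s: "inner_solution \<gamma> \<epsilon> l q u u1 v v1" "Ai (l, q) = \<epsilon> * u1 0 / l" "Bi (l, q) = v1 0 / l"
        using i[of l q] l q by (auto simp: l2_def)
      have q': "19/20 * jump \<le> q" "q \<le> 21/20 * jump" using q by (auto simp: pin_range_def)
      have l': "0 < l" "l \<le> 7/2 * jump" "2 * \<epsilon> \<le> l" using l l12 e by (auto simp: l2_def)
      show "Ai (l, q) \<le> - (jump / 4)" "\<bar>Ai (l, q)\<bar> \<le> 1"
        using inner_slope_bounds[OF s(1) \<gamma> \<epsilon>(1) e(1) q' l'(3,2)] s(2) by auto
      show "- (12/10) * l \<le> Bi (l, q)" "Bi (l, q) \<le> - (88/100) * l"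
        using inner_v1_lower[OF s(1) \<gamma> \<epsilon>(1) e(1) q' l'(1,2)] inner_v1_upper[OF s(1) \<gamma> \<epsilon>(1) e(1) q' l'(1,2)]
        unfolding s(3) pos_le_divide_eq[OF l'(1)] pos_divide_le_eq[OF l'(1)] by (simp_all add: power2_eq_square)
    qed
    have Ao_facts: "Ao q \<le> 0" "\<bar>Ao q\<bar> \<le> 1" "Bo q \<le> - c1" "- 27/10 * q \<le> Bo q" if q: "q \<in> pin_range" for q
    proof -
      obtain u u1 v v1 where s: "outer_solution \<gamma> \<epsilon> q u u1 v v1" "Ao q = \<epsilon> * u1 0" "Bo q = v1 0" using o[OF q] by blast
      have q': "19/20 * jump \<le> q" "q \<le> 21/20 * jump" using q by (auto simp: pin_range_def)
      show "Ao q \<le> 0" "\<bar>Ao q\<bar> \<le> 1" using outer_slope_bounds[OF s(1) \<gamma> \<epsilon>(1) e(1,2) q'] s(2) by auto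
      have "c1 \<le> sqrt (2 * \<gamma>) / 2 * q" unfolding c1_def using q' \<gamma> by (intro mult_left_mono) auto
      moreover have "Bo q \<le> - (sqrt (2 * \<gamma>) / 2 * q)"
        using outer_v1_upper[OF s(1) \<gamma> \<epsilon>(1) e(1) q'] unfolding s(3) by (simp only: mult_minus_left)
      ultimately show "Bo q \<le> - c1" by linarith
      show "- 27/10 * q \<le> Bo q" using outer_v1_lower[OF s(1) \<gamma> \<epsilon>(1) e(1) q'] s(3) by simp
    qed
    have compare: "qo \<ge> qi \<Longrightarrow> Ao qo \<le> Ai (l, qi) + \<epsilon> * C" "qi \<ge> qo \<Longrightarrow> Ai (l, qi) \<le> Ao qo + \<epsilon> * C"
      if l: "l \<in> {l1..l2}" and qs: "qi \<in> pin_range" "qo \<in> pin_range" for l qi qo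
    proof -
      obtain u u1 v v1 where s: "inner_solution \<gamma> \<epsilon> l qi u u1 v v1" "Ai (l, qi) = \<epsilon> * u1 0 / l"
        using i[of l qi] l qs by (auto simp: l2_def)
      obtain u' u1' v' v1' where s': "outer_solution \<gamma> \<epsilon> qo u' u1' v' v1'" "Ao qo = \<epsilon> * u1' 0" using o[OF qs(2)] by blast
      have l': "0 < l" "l \<le> 7/2 * jump" using l l12 by (auto simp: l2_def)
      have q': "19/20 * jump \<le> qi" "qi \<le> 21/20 * jump" "19/20 * jump \<le> qo" "qo \<le> 21/20 * jump" using qs by (auto simp: pin_range_def)
      note c = outer_inner_comparison[OF s'(1) s(1) \<gamma> \<epsilon>(1) e(1) q'(3,4,1,2) l']
      have "\<epsilon> * (10 / l) \<le> \<epsilon> * C" unfolding C_def using \<epsilon> l l12 by (intro mult_left_mono divide_left_mono) auto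
      thus "qo \<ge> qi \<Longrightarrow> Ao qo \<le> Ai (l, qi) + \<epsilon> * C" "qi \<ge> qo \<Longrightarrow> Ai (l, qi) \<le> Ao qo + \<epsilon> * C"
        using c s(2) s'(2) by auto
    qed
    have layer: "\<bar>vs p s - fst (snd p)\<bar> \<le> \<epsilon> * Dr" "\<bar>ws p s - Bi (fst p, 2 * jump - fst (snd p))\<bar> \<le> \<epsilon> * Dr"
      "\<bar>((ys p s)\<^sup>2 / 2 + F_mid (us p s) - us p s * vs p s) -
        ((Ai (fst p, 2 * jump - fst (snd p)))\<^sup>2 / 2 + F_mid (2 * mid) - 2 * mid * fst (snd p))\<bar> \<le> \<epsilon> * Dr"
      "ys p s \<le> - (jump / 8)" "\<And>t. 0 \<le> t \<Longrightarrow> t \<le> s \<Longrightarrow> us p s \<le> us p t" "us p layer_time < 0" "us p 0 = 2 * mid"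
      if p: "fst p \<in> {l1..l2}" "fst (snd p) \<in> {jump - \<eta>..jump + \<eta>}" and s: "0 \<le> s" "s \<le> layer_time" for p s
    proof -
      let ?q = "fst (snd p)"
      let ?a = "Ai (fst p, 2 * jump - ?q)" and ?b = "Bi (fst p, 2 * jump - ?q)"
      note A = Ai_facts[OF p(1) inQ(1)[OF p(2)]]
      have i0: "us p 0 = 2 * mid" "ys p 0 = ?a" "vs p 0 = ?q" "ws p 0 = ?b"
        by (simp_all add: us_def ys_def vs_def ws_def \<Phi>(1) init_def)
      have y0: "ys p 0 \<le> - (jump / 4)" using A(1) i0 by simp
      have "\<bar>?b\<bar> \<le> 1" using A(3,4) p(1) j l12 by (intro abs_leI) (auto simp: l2_def)
      moreover have "\<bar>?q\<bar> \<le> 1" using p(2) \<eta> j by (intro abs_leI) auto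
      moreover have "\<bar>2 * mid\<bar> \<le> 1" using mid_bounds by simp
      ultimately have nI: "norm (init p) \<le> 4" using norm_fst_snd_le(5)[of "init p"] A(2) by (simp add: init_def)
      have bd: "norm (\<Phi> (init p) t) \<le> R" if t: "0 \<le> t" "t \<le> layer_time" for t
      proof -
        have "norm (\<Phi> (init p) t) \<le> 2 * exp (2 * 110 * t) * norm (init p)"
          using \<Phi>(4)[OF t(1), of "init p"] by (simp add: layer_field_zero)
        also have "\<dots> \<le> 2 * exp (2 * 110 * layer_time) * 4" using nI t by (intro mult_mono) auto
        finally show ?thesis by (simp add: R_def)
      qed
      have qj: "\<bar>?q - jump\<bar> \<le> jump\<^sup>2 / 128" using p(2) by (intro abs_leI) (auto simp: \<eta>_def)
      have "\<epsilon> * Dr \<le> \<eta>" using e(4) \<eta> by simp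
      hence small: "\<epsilon> * (2 * (R + R\<^sup>2) * layer_time) \<le> jump\<^sup>2 / 128" by (simp only: Dr_def \<eta>_def)
      note L = layer_properties[OF \<Phi>(2) X_eq i0(1) y0 i0(3) bd \<gamma> \<epsilon>(1) qj small s, unfolded Dr_def[symmetric] i0]
      show "\<bar>vs p s - ?q\<bar> \<le> \<epsilon> * Dr" "\<bar>ws p s - ?b\<bar> \<le> \<epsilon> * Dr"
        "\<bar>((ys p s)\<^sup>2 / 2 + F_mid (us p s) - us p s * vs p s) - (?a\<^sup>2 / 2 + F_mid (2 * mid) - 2 * mid * ?q)\<bar> \<le> \<epsilon> * Dr"
        "ys p s \<le> - (jump / 8)" "\<And>t. 0 \<le> t \<Longrightarrow> t \<le> s \<Longrightarrow> us p s \<le> us p t" "us p layer_time < 0"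
        using L by auto
      show "us p 0 = 2 * mid" by (rule i0)
    qed
    have BD: "fst p \<in> {l1..l2}" "fst (snd p) \<in> {jump - \<eta>..jump + \<eta>}" "0 \<le> snd (snd p)" "snd (snd p) \<le> layer_time"
      if "p \<in> B" for p using that by (auto simp: B_def)
    have vQ: "vs p s \<in> pin_range" if "fst p \<in> {l1..l2}" "fst (snd p) \<in> {jump - \<eta>..jump + \<eta>}" "0 \<le> s" "s \<le> layer_time" for p s
      using abs_le_D1[OF layer(1)[OF that]] abs_le_D2[OF layer(1)[OF that]] that(2) e(4) \<eta> j by (auto simp: pin_range_def)
    define f1 where "f1 = (\<lambda>p. ws p (snd (snd p)) - Bo (vs p (snd (snd p))))"
    define f2 where "f2 = (\<lambda>p. (ys p (snd (snd p)))\<^sup>2 / 2 + F_mid (us p (snd (snd p))) - us p (snd (snd p)) * vs p (snd (snd p))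
      - (Ao (vs p (snd (snd p))))\<^sup>2 / 2)"
    define f3 where "f3 = (\<lambda>p. us p (snd (snd p)))"
    have cst: "continuous_on B (\<lambda>p. \<Phi> (init p) (snd (snd p)))"
    proof -
      have g: "continuous_on B (\<lambda>p. (fst p, 2 * jump - fst (snd p)))" by (intro continuous_intros)
      have im: "(\<lambda>p. (fst p, 2 * jump - fst (snd p))) ` B \<subseteq> {l1..7/2 * jump} \<times> pin_range"
      proof (rule image_subsetI)
        fix p assume "p \<in> B"
        note b = BD[OF this]
        show "(fst p, 2 * jump - fst (snd p)) \<in> {l1..7/2 * jump} \<times> pin_range"
          using b(1) inQ(1)[OF b(2)] unfolding l2_def by blast
      qed
      have "continuous_on B init" unfolding init_def
        by (intro continuous_on_Pair continuous_on_const continuous_on_compose2[OF ci(1) g im]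
            continuous_on_compose2[OF ci(2) g im] continuous_on_fst continuous_on_snd continuous_on_id)
      hence "continuous_on B (\<lambda>p. (init p, snd (snd p)))"
        by (intro continuous_on_Pair continuous_on_snd continuous_on_id)
      moreover have "isCont (\<Phi> a) s" if "0 \<le> s" for a s
        using \<Phi>(2)[OF that] by (rule has_vector_derivative_continuous)
      ultimately have "continuous_on B (\<lambda>p. case (init p, snd (snd p)) of (a, s) \<Rightarrow> \<Phi> a s)"
        by (intro continuous_on_compose2[OF flow_continuous[OF \<Phi>(3)]]) (use BD in auto)
      thus ?thesis by simp
    qed
    have cu: "continuous_on B (\<lambda>p. us p (snd (snd p)))" and cy: "continuous_on B (\<lambda>p. ys p (snd (snd p)))"
      and cv: "continuous_on B (\<lambda>p. vs p (snd (snd p)))" and cw: "continuous_on B (\<lambda>p. ws p (snd (snd p)))"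
      unfolding us_def ys_def vs_def ws_def by (intro continuous_on_fst continuous_on_snd cst)+
    have vB: "(\<lambda>p. vs p (snd (snd p))) ` B \<subseteq> pin_range" using vQ BD by blast
    have cF: "continuous_on B (\<lambda>p. F_mid (us p (snd (snd p))))"
    proof (rule continuous_on_compose2[OF _ cu])
      show "continuous_on UNIV F_mid" by (intro continuous_at_imp_continuous_on ballI DERIV_isCont[OF F_mid(2)])
    qed auto
    note cA = continuous_on_compose2[OF co(1) cv vB] and cB = continuous_on_compose2[OF co(2) cv vB]
    have cf: "continuous_on B f1" "continuous_on B f2" "continuous_on B f3"
      unfolding f1_def f2_def f3_def by (intro continuous_intros cu cy cv cw cF cA cB; simp)+
    \<comment> \<open>At \<open>q = jump \<plusminus> \<eta>\<close> the energy \<open>2 * mid * \<eta>\<close> dominates the difference of the two boundary layers.\<close>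
    have sq: "X\<^sup>2 / 2 \<le> Y\<^sup>2 / 2 + \<eta> / 8" if "X \<le> 0" "Y \<le> 0" "\<bar>Y\<bar> \<le> 1" "Y \<le> X + \<epsilon> * C" for X Y :: real
    proof -
      have "(- X)\<^sup>2 \<le> (- Y)\<^sup>2 + 2 * (\<epsilon> * C) + (\<epsilon> * C)\<^sup>2"
        by (rule square_le_perturbed) (use that \<epsilon> C0 in auto)
      moreover have "(\<epsilon> * C)\<^sup>2 \<le> \<epsilon> * C\<^sup>2"
      proof -
        have "\<epsilon>\<^sup>2 \<le> \<epsilon>" using \<epsilon> \<open>\<epsilon> \<le> 1\<close> by (simp add: power2_eq_square mult_left_le)
        thus ?thesis unfolding power_mult_distrib by (rule mult_right_mono) simp
      qed
      moreover have "2 * (\<epsilon> * C) + \<epsilon> * C\<^sup>2 \<le> 2 * (\<epsilon> * (C + C\<^sup>2))" using \<epsilon> by (simp add: distrib_left)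
      ultimately show ?thesis using e(7) by simp
    qed
    have "\<exists>l\<in>{l1..l2}. \<exists>q\<in>{jump - \<eta>..jump + \<eta>}. \<exists>S\<in>{0..layer_time}. f1 (l, q, S) = 0 \<and> f2 (l, q, S) = 0 \<and> f3 (l, q, S) = 0"
    proof (rule poincare_miranda_3[OF _ _ _ cf[unfolded B_def]])
      show "l1 \<le> l2" "jump - \<eta> \<le> jump + \<eta>" "0 \<le> layer_time" using l12 \<eta> LT by auto
    next
      fix q S assume q: "q \<in> {jump - \<eta>..jump + \<eta>}" and S: "S \<in> {0..layer_time}"
      have l1I: "l1 \<in> {l1..l2}" and l2I: "l2 \<in> {l1..l2}" using l12 by auto
      have "f1 (l1, q, S) > 0"
      proof -
        have L: "\<bar>ws (l1, q, S) S - Bi (l1, 2 * jump - q)\<bar> \<le> \<epsilon> * Dr" "vs (l1, q, S) S \<in> pin_range"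
          using layer(2)[of "(l1, q, S)" S] vQ[of "(l1, q, S)" S] q S l1I by auto
        show ?thesis using abs_le_D2[OF L(1)] Ao_facts(3)[OF L(2)] Ai_facts(3)[OF l1I inQ(1)[OF q]] e(5) c1
          by (simp add: f1_def l1_def)
      qed
      moreover have "f1 (l2, q, S) < 0"
      proof -
        have L: "\<bar>ws (l2, q, S) S - Bi (l2, 2 * jump - q)\<bar> \<le> \<epsilon> * Dr" "vs (l2, q, S) S \<in> pin_range"
          using layer(2)[of "(l2, q, S)" S] vQ[of "(l2, q, S)" S] q S l2I by auto
        have "vs (l2, q, S) S \<le> 21/20 * jump" using L(2) by (simp add: pin_range_def)
        thus ?thesis using abs_le_D1[OF L(1)] Ao_facts(4)[OF L(2)] Ai_facts(4)[OF l2I inQ(1)[OF q]] e(6) j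
          by (simp add: f1_def l2_def)
      qed
      ultimately show "f1 (l1, q, S) > 0 \<and> f1 (l2, q, S) < 0" by simp
    next
      fix l S assume l: "l \<in> {l1..l2}" and S: "S \<in> {0..layer_time}"
      have m: "8/9 * \<eta> \<le> 2 * mid * \<eta>" using mid_bounds \<eta> by (intro mult_right_mono) auto
      have "f2 (l, jump - \<eta>, S) > 0"
      proof -
        let ?p = "(l, jump - \<eta>, S)"
        have q: "jump - \<eta> \<in> {jump - \<eta>..jump + \<eta>}" using \<eta> by simp
        have L: "\<bar>vs ?p S - (jump - \<eta>)\<bar> \<le> \<epsilon> * Dr" "vs ?p S \<in> pin_range" "\<bar>((ys ?p S)\<^sup>2 / 2 + F_mid (us ?p S) - us ?p S * vs ?p S) -
            ((Ai (l, jump + \<eta>))\<^sup>2 / 2 + F_mid (2 * mid) - 2 * mid * (jump - \<eta>))\<bar> \<le> \<epsilon> * Dr"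
          using layer(1,3)[of ?p S] vQ[of ?p S] q S l by (auto simp: algebra_simps)
        have qi: "jump + \<eta> \<in> pin_range" using inQ(1)[OF q] by (simp add: algebra_simps)
        have "vs ?p S \<le> jump + \<eta>" using abs_le_D1[OF L(1)] e(4) \<eta> by simp
        from compare(2)[OF l qi L(2) this]
        have "(Ao (vs ?p S))\<^sup>2 / 2 \<le> (Ai (l, jump + \<eta>))\<^sup>2 / 2 + \<eta> / 8"
          using Ai_facts(1,2)[OF l qi] Ao_facts(1)[OF L(2)] j by (intro sq) auto
        moreover have "F_mid (2 * mid) - 2 * mid * (jump - \<eta>) = 2 * mid * \<eta>" unfolding F_mid_two_mid by (simp add: algebra_simps)
        ultimately show ?thesis using abs_le_D2[OF L(3)] e(4) m \<eta>(1)
          unfolding f2_def fst_conv snd_conv by linarith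
      qed
      moreover have "f2 (l, jump + \<eta>, S) < 0"
      proof -
        let ?p = "(l, jump + \<eta>, S)"
        have q: "jump + \<eta> \<in> {jump - \<eta>..jump + \<eta>}" using \<eta> by simp
        have L: "\<bar>vs ?p S - (jump + \<eta>)\<bar> \<le> \<epsilon> * Dr" "vs ?p S \<in> pin_range" "\<bar>((ys ?p S)\<^sup>2 / 2 + F_mid (us ?p S) - us ?p S * vs ?p S) -
            ((Ai (l, jump - \<eta>))\<^sup>2 / 2 + F_mid (2 * mid) - 2 * mid * (jump + \<eta>))\<bar> \<le> \<epsilon> * Dr"
          using layer(1,3)[of ?p S] vQ[of ?p S] q S l by (auto simp: algebra_simps)
        have qi: "jump - \<eta> \<in> pin_range" using inQ(1)[OF q] by (simp add: algebra_simps)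
        have "vs ?p S \<ge> jump - \<eta>" using abs_le_D2[OF L(1)] e(4) \<eta> by simp
        from compare(1)[OF l qi L(2) this]
        have "(Ai (l, jump - \<eta>))\<^sup>2 / 2 \<le> (Ao (vs ?p S))\<^sup>2 / 2 + \<eta> / 8"
          using Ai_facts(1,2)[OF l qi] Ao_facts(1,2)[OF L(2)] j by (intro sq) auto
        moreover have "F_mid (2 * mid) - 2 * mid * (jump + \<eta>) = - (2 * mid * \<eta>)" unfolding F_mid_two_mid by (simp add: algebra_simps)
        ultimately show ?thesis using abs_le_D1[OF L(3)] e(4) m \<eta>(1)
          unfolding f2_def fst_conv snd_conv by linarith
      qed
      ultimately show "f2 (l, jump - \<eta>, S) > 0 \<and> f2 (l, jump + \<eta>, S) < 0" by simp
    next
      fix l q assume l: "l \<in> {l1..l2}" and q: "q \<in> {jump - \<eta>..jump + \<eta>}"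
      have "us (l, q, 0) 0 = 2 * mid" using layer(7)[of "(l, q, 0)" 0] l q LT by auto
      moreover have "us (l, q, layer_time) layer_time < 0" using layer(6)[of "(l, q, layer_time)" 0] l q LT by auto
      ultimately show "f3 (l, q, 0) > 0 \<and> f3 (l, q, layer_time) < 0" using mid_bounds by (simp add: f3_def)
    qed
    then obtain l q S where lqS: "l \<in> {l1..l2}" "q \<in> {jump - \<eta>..jump + \<eta>}" "S \<in> {0..layer_time}"
      "f1 (l, q, S) = 0" "f2 (l, q, S) = 0" "f3 (l, q, S) = 0" by blast
    define p where "p = (l, q, S)"
    have pp: "fst p \<in> {l1..l2}" "fst (snd p) \<in> {jump - \<eta>..jump + \<eta>}" using lqS by (auto simp: p_def)
    have S: "0 \<le> S" "S \<le> layer_time" using lqS by auto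
    have u0: "us p S = 0" using lqS(6) by (simp add: f3_def p_def)
    have "S \<noteq> 0" using u0 layer(7)[OF pp order_refl] LT mid_bounds by auto
    hence S0: "S > 0" using S by simp
    have vS: "vs p S \<in> pin_range" by (rule vQ[OF pp S])
    have "(ys p S)\<^sup>2 = (Ao (vs p S))\<^sup>2" using lqS(5) u0 by (simp add: f2_def p_def F_mid)
    moreover have "ys p S < 0" using layer(4)[OF pp S] j by simp
    moreover have "Ao (vs p S) \<le> 0" by (rule Ao_facts(1)[OF vS])
    ultimately have yS: "ys p S = Ao (vs p S)" by (auto simp: power2_eq_iff)
    have wS: "ws p S = Bo (vs p S)" using lqS(4) by (simp add: f1_def p_def)
    obtain uo uo1 vo vo1 where so: "outer_solution \<gamma> \<epsilon> (vs p S) uo uo1 vo vo1" "Ao (vs p S) = \<epsilon> * uo1 0" "Bo (vs p S) = vo1 0"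
      using o[OF vS] by blast
    have qQ: "2 * jump - q \<in> pin_range" by (rule inQ(1)[OF lqS(2)])
    obtain ui ui1 vi vi1 where si: "inner_solution \<gamma> \<epsilon> l (2 * jump - q) ui ui1 vi vi1"
      "Ai (l, 2 * jump - q) = \<epsilon> * ui1 0 / l" "Bi (l, 2 * jump - q) = vi1 0 / l"
      using i[of l "2 * jump - q"] lqS(1) qQ by (auto simp: l2_def)
    have path: "(\<Phi> (init p) has_vector_derivative layer_field \<gamma> \<epsilon> (\<Phi> (init p) s)) (at s) \<and>
          0 \<le> fst (\<Phi> (init p) s) \<and> fst (\<Phi> (init p) s) \<le> 2 * mid \<and> \<bar>fst (snd (snd (\<Phi> (init p) s)))\<bar> \<le> 1/10"
      if s: "0 \<le> s" "s \<le> S" for s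
    proof -
      have s': "s \<le> layer_time" using s S by simp
      have "us p S \<le> us p s" by (rule layer(5)[OF pp S s])
      moreover have "us p s \<le> us p 0" by (rule layer(5)[OF pp s(1) s']) (use s in auto)
      moreover have "us p 0 = 2 * mid" by (rule layer(7)[OF pp s(1) s'])
      moreover have "vs p s \<in> pin_range" by (rule vQ[OF pp s(1) s'])
      hence "\<bar>vs p s\<bar> \<le> 1/10" using j by (auto simp: pin_range_def)
      ultimately show ?thesis using \<Phi>(2)[OF s(1)] u0 by (simp add: us_def vs_def)
    qed
    have X0: "\<Phi> (init p) 0 = (2 * mid, \<epsilon> * ui1 0 / l, q, vi1 0 / l)"
      using si by (simp add: \<Phi>(1) init_def p_def)
    have XS: "\<Phi> (init p) S = (0, \<epsilon> * uo1 0, vs p S, vo1 0)"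
      using u0 yS wS so by (simp add: X_eq)
    have l: "0 < l" "l \<le> 7/2 * jump" using lqS(1) l12 by (auto simp: l2_def)
    show ?thesis unfolding matched_pieces_def using si(1) l qQ so(1) vS S0 path X0 XS by blast
  qed
  have "\<epsilon>0 \<le> 1/100" by (rule \<epsilon>0_le) blast
  thus ?thesis
    by (rule_tac x=\<epsilon>0 in exI, intro conjI \<epsilon>0)
      (assumption, rule allI, rule impI, rule main, (erule conjE, assumption)+)
qed

end

section \<open>From a half orbit to a pulse\<close>

lemma DERIV_reflect_shift:
  fixes z :: "real \<Rightarrow> real"
  assumes "(z has_real_derivative D) (at (c - x))"
  shows "((\<lambda>x. z (c - x)) has_real_derivative - D) (at x)"
proof -
  have "((\<lambda>x. c - x) has_real_derivative - 1) (at x)" by (auto intro!: derivative_eq_intros)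
  thus ?thesis using DERIV_chain2[of z D "\<lambda>x. c - x" x "- 1"] assms by simp
qed

lemma DERIV_affine:
  fixes z :: "real \<Rightarrow> real"
  assumes "(z has_real_derivative D) (at ((x - c) / \<epsilon>))" "\<epsilon> \<noteq> 0"
  shows "((\<lambda>x. z ((x - c) / \<epsilon>)) has_real_derivative D / \<epsilon>) (at x)"
proof -
  have "((\<lambda>x. (x - c) / \<epsilon>) has_real_derivative 1 / \<epsilon>) (at x)" using assms(2) by (auto intro!: derivative_eq_intros)
  thus ?thesis using DERIV_chain2[of z D "\<lambda>x. (x - c) / \<epsilon>" x "1 / \<epsilon>"] assms by simp
qed

text \<open>Since \<open>u'\<close> and \<open>v'\<close> vanish at \<open>0\<close>, the even reflection continues the orbit. A constant pulse would
  be zero by the decay, against the value of \<open>v\<close> at \<open>m\<close>.\<close>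

theorem pulse_of_half_orbit:
  assumes X: "orbit_on \<beta> \<gamma> d {0..} X" and d: "d \<noteq> 0"
    and X0: "fst (snd (X 0)) = 0" "snd (snd (snd (X 0))) = 0"
    and c: "c > 0" and decay: "\<And>x. x \<ge> m \<Longrightarrow> \<bar>fst (X x)\<bar> \<le> C * exp (- c * x) \<and> \<bar>fst (snd (snd (X x)))\<bar> \<le> C * exp (- c * x)"
    and m: "m > 0" "fst (snd (snd (X m))) \<noteq> 0"
  shows "\<exists>u v. standing_pulse \<beta> \<gamma> d u v \<and> smooth_on_pos u \<and> smooth_on_pos v \<and> exp_decaying u \<and> exp_decaying v"
proof -
  define Y where "Y = (\<lambda>x. if x \<le> 0 then reflect (X (- x)) else X x)"
  have rfl: "reflect s = (fst s, - fst (snd s), fst (snd (snd s)), - snd (snd (snd s)))" for s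
    by (cases s) (simp add: reflect_def)
  have "reflect (X (- 0)) = X 0" using X0 by (simp add: rfl prod_eq_iff)
  hence orb: "orbit_on \<beta> \<gamma> d UNIV Y"
    unfolding Y_def by (intro orbit_on_glue[OF orbit_on_reflect[OF X] X]) auto
  define u where "u = (\<lambda>x. fst (Y x))"
  define p where "p = (\<lambda>x. fst (snd (Y x)))"
  define v where "v = (\<lambda>x. fst (snd (snd (Y x))))"
  define w where "w = (\<lambda>x. snd (snd (snd (Y x))))"
  have Y_eq: "Y = (\<lambda>x. (u x, p x, v x, w x))" by (simp add: u_def p_def v_def w_def)
  note D = orbit_onD[OF orb UNIV_I Y_eq]
  have du: "deriv u = p" "deriv p = (\<lambda>x. (v x - cubic \<beta> (u x)) / d)"
    and dv: "deriv v = w" "deriv w = (\<lambda>x. \<gamma> * v x + v x ^ 3 - u x)"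
    using D by (auto intro!: DERIV_imp_deriv)
  have sol: "is_solution \<beta> \<gamma> d u v"
  proof -
    have "u field_differentiable at x" "p field_differentiable at x"
      "v field_differentiable at x" "w field_differentiable at x" for x
      using D[of x] unfolding field_differentiable_def by blast+
    thus ?thesis using d unfolding is_solution_def twice_differentiable_def du dv by simp
  qed
  have uX: "u x = fst (X \<bar>x\<bar>)" "v x = fst (snd (snd (X \<bar>x\<bar>)))" for x
    by (cases "x \<le> 0"; simp add: u_def v_def Y_def rfl)+
  have even: "u (- x) = u x \<and> v (- x) = v x" for x
    by (simp add: uX)
  have bnd: "norm (u x) \<le> C * exp (- c * \<bar>x\<bar>)" "norm (v x) \<le> C * exp (- c * \<bar>x\<bar>)" if "\<bar>x\<bar> \<ge> m" for x
    using decay[OF that] by (auto simp: uX)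
  have ev: "\<forall>\<^sub>F x in at_infinity. \<bar>x :: real\<bar> \<ge> m" by (auto simp: eventually_at_infinity)
  have lim: "((\<lambda>x::real. C * exp (- c * \<bar>x\<bar>)) \<longlongrightarrow> 0) at_infinity"
  proof -
    have "filterlim (\<lambda>x::real. \<bar>x\<bar>) at_top at_infinity"
      by (rule filterlim_cong[THEN iffD1, OF refl refl _ filterlim_norm_at_top]) simp
    hence "filterlim (\<lambda>x::real. c * \<bar>x\<bar>) at_top at_infinity"
      using c by (intro filterlim_tendsto_pos_mult_at_top[OF tendsto_const])
    hence "filterlim (\<lambda>x::real. - (c * \<bar>x\<bar>)) at_bot at_infinity" by (simp add: filterlim_uminus_at_top)
    hence "((\<lambda>x::real. exp (- (c * \<bar>x\<bar>))) \<longlongrightarrow> 0) at_infinity" by (rule filterlim_compose[OF exp_at_bot])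
    from tendsto_mult_right_zero[OF this, of C] show ?thesis by simp
  qed
  have "(u \<longlongrightarrow> 0) at_infinity" "(v \<longlongrightarrow> 0) at_infinity"
    by (rule Lim_null_comparison[OF _ lim], use bnd ev in \<open>auto elim!: eventually_mono\<close>)+
  hence lim0: "((\<lambda>x. (u x, v x)) \<longlongrightarrow> (0, 0)) at_infinity" by (rule tendsto_Pair)
  have nonconst: "\<not> (\<lambda>x. (u x, v x)) constant_on UNIV"
  proof
    assume "(\<lambda>x. (u x, v x)) constant_on UNIV"
    then obtain a where a: "\<And>x. (u x, v x) = a" by (auto simp: constant_on_def)
    hence "((\<lambda>x::real. a) \<longlongrightarrow> (0, 0)) at_infinity" using lim0 by simp
    hence "a = (0, 0)" using tendsto_unique[OF trivial_limit_at_infinity tendsto_const] by metis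
    hence "v m = 0" using a[of m] by simp
    thus False using m by (simp add: uX)
  qed
  have "exp_decaying z" if "\<And>x. x \<ge> m \<Longrightarrow> norm (z x) \<le> C * exp (- c * \<bar>x\<bar>)" for z
    unfolding exp_decaying_def
  proof (intro exI[of _ c] conjI c bigoI[where c=C] eventually_mono[OF eventually_ge_at_top[of m]])
    fix x assume "m \<le> x"
    thus "norm (z x) \<le> C * norm (exp (- c * x))" using that[of x] m(1) by simp
  qed
  note decaying = this
  have "exp_decaying u" "exp_decaying v" by (rule decaying, rule bnd, use m(1) in simp)+
  moreover note orbit_smooth[OF orb[unfolded Y_eq]]
  ultimately show ?thesis using sol nonconst even lim0 unfolding standing_pulse_def
    by (intro exI[of _ u] exI[of _ v]) simp
qed

context cubic_parameter
begin

text \<open>By the symmetry of the cubic, reflecting an inner solution back gives an orbit along the right branch. The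
  a priori ranges put \<open>u\<close> and \<open>v\<close> where the modified nonlinearities agree with the original ones; the same
  holds for the other two pieces.\<close>

lemma inner_orbit:
  assumes s: "inner_solution \<gamma> \<epsilon> l q u u1 v v1" and \<gamma>: "0 < \<gamma>" "\<gamma> \<le> 1/100"
    and \<epsilon>: "0 < \<epsilon>" "\<epsilon> \<le> 1/100" and q: "q \<in> pin_range" and l: "0 < l" "l \<le> 7/2 * jump"
  shows "orbit_on \<beta> \<gamma> (\<epsilon>\<^sup>2) {0..l}
    (\<lambda>x. (2 * mid - u ((l - x) / l), u1 ((l - x) / l) / l, 2 * jump - v ((l - x) / l), v1 ((l - x) / l) / l))"
proof (rule orbit_onI)
  fix x assume "x \<in> {0..l}"
  hence y: "l - x \<in> {0..l}" and t: "0 \<le> (l - x) / l" "(l - x) / l \<le> 1" using l by auto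
  have q': "19/20 * jump \<le> q" "q \<le> 21/20 * jump" using q by (auto simp: pin_range_def)
  note D1 = inner_rescale(1)[OF s l(1), unfolded deriv2_on_def, rule_format, OF y]
  note D2 = inner_rescale(2)[OF s l(1), unfolded deriv2_on_def, rule_format, OF y]
  let ?t = "(l - x) / l"
  have ur: "lo \<le> u ?t" "u ?t \<le> 0" and vr: "jump / 2 \<le> v ?t" "v ?t \<le> q"
    using inner_u_range[OF s \<gamma> \<epsilon> q' l t] inner_v_range[OF s \<gamma> \<epsilon> q' l t] by auto
  have f: "f_left (u ?t) = 2 * jump - cubic \<beta> (2 * mid - u ?t)" using ur by (simp add: f_left_eq cubic_odd)
  have g: "g_in \<gamma> (v ?t) = 2 * mid - (\<gamma> * (2 * jump - v ?t) + (2 * jump - v ?t) ^ 3)"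
    unfolding g_in_def using vr q' jump_bounds by (subst g_out_eq) (auto intro!: abs_leI)
  have alg: "- (1 / e * (a - (2 * j - c))) = (2 * j - a - c) / e" for e a j c :: real
    by (simp add: diff_divide_distrib add_divide_distrib right_diff_distrib)
  show "((\<lambda>x. 2 * mid - u ((l - x) / l)) has_real_derivative u1 ?t / l) (at x)"
    using DERIV_diff[OF DERIV_const[of "2 * mid"] DERIV_reflect_shift[OF conjunct1[OF D1]]] by simp
  show "((\<lambda>x. u1 ((l - x) / l) / l) has_real_derivative (2 * jump - v ?t - cubic \<beta> (2 * mid - u ?t)) / \<epsilon>\<^sup>2) (at x)"
    by (rule DERIV_cong[OF DERIV_reflect_shift[OF conjunct2[OF D1]]]) (simp only: f alg)
  show "((\<lambda>x. 2 * jump - v ((l - x) / l)) has_real_derivative v1 ?t / l) (at x)"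
    using DERIV_diff[OF DERIV_const[of "2 * jump"] DERIV_reflect_shift[OF conjunct1[OF D2]]] by simp
  show "((\<lambda>x. v1 ((l - x) / l) / l) has_real_derivative
      \<gamma> * (2 * jump - v ?t) + (2 * jump - v ?t) ^ 3 - (2 * mid - u ?t)) (at x)"
    using DERIV_reflect_shift[OF conjunct2[OF D2], unfolded g minus_diff_eq]
    by (rule DERIV_cong) (simp only: algebra_simps)
qed

lemma layer_orbit:
  assumes X: "\<And>s. 0 \<le> s \<Longrightarrow> s \<le> S \<Longrightarrow> (X has_vector_derivative layer_field \<gamma> \<epsilon> (X s)) (at s) \<and>
      0 \<le> fst (X s) \<and> fst (X s) \<le> 2 * mid \<and> \<bar>fst (snd (snd (X s)))\<bar> \<le> 1/10"
    and \<epsilon>: "\<epsilon> > 0"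
  shows "orbit_on \<beta> \<gamma> (\<epsilon>\<^sup>2) {l..l + \<epsilon> * S}
    (\<lambda>x. (fst (X ((x - l) / \<epsilon>)), fst (snd (X ((x - l) / \<epsilon>))) / \<epsilon>,
      fst (snd (snd (X ((x - l) / \<epsilon>)))), snd (snd (snd (X ((x - l) / \<epsilon>))))))"
proof (rule orbit_onI)
  fix x assume x: "x \<in> {l..l + \<epsilon> * S}"
  let ?s = "(x - l) / \<epsilon>"
  have s: "0 \<le> ?s" "?s \<le> S" using x \<epsilon> by (auto simp: field_simps)
  define u y v w where "u = (\<lambda>s. fst (X s))" and "y = (\<lambda>s. fst (snd (X s)))"
    and "v = (\<lambda>s. fst (snd (snd (X s))))" and "w = (\<lambda>s. snd (snd (snd (X s))))"
  note Xs = X[OF s]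
  have D: "((\<lambda>s. (u s, y s, v s, w s)) has_vector_derivative (y ?s, v ?s - f_mid (u ?s), \<epsilon> * w ?s, \<epsilon> * (g_out \<gamma> (v ?s) - u ?s))) (at ?s)"
    using Xs by (simp add: layer_field_def u_def y_def v_def w_def case_prod_beta')
  have f: "f_mid (u ?s) = cubic \<beta> (u ?s)" using Xs by (intro f_mid_eq) (auto simp: u_def)
  have g: "g_out \<gamma> (v ?s) = \<gamma> * v ?s + v ?s ^ 3" using Xs by (intro g_out_eq) (auto simp: v_def)
  have d: "(u has_real_derivative y ?s) (at ?s)" "(y has_real_derivative v ?s - cubic \<beta> (u ?s)) (at ?s)"
    "(v has_real_derivative \<epsilon> * w ?s) (at ?s)" "(w has_real_derivative \<epsilon> * (\<gamma> * v ?s + v ?s ^ 3 - u ?s)) (at ?s)"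
    unfolding f[symmetric] g[symmetric]
    by (rule state_derivativeD[OF D])+
  have \<epsilon>0: "\<epsilon> \<noteq> 0" using \<epsilon> by simp
  show "((\<lambda>x. fst (X ((x - l) / \<epsilon>))) has_real_derivative fst (snd (X ?s)) / \<epsilon>) (at x)"
    using DERIV_affine[OF d(1) \<epsilon>0] by (simp add: u_def y_def)
  show "((\<lambda>x. fst (snd (X ((x - l) / \<epsilon>))) / \<epsilon>) has_real_derivative
      (fst (snd (snd (X ?s))) - cubic \<beta> (fst (X ?s))) / \<epsilon>\<^sup>2) (at x)"
    using DERIV_cdivide[OF DERIV_affine[OF d(2) \<epsilon>0], of \<epsilon>] by (simp add: u_def y_def v_def power2_eq_square)
  show "((\<lambda>x. fst (snd (snd (X ((x - l) / \<epsilon>))))) has_real_derivative snd (snd (snd (X ?s)))) (at x)"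
    using DERIV_affine[OF d(3) \<epsilon>0] \<epsilon>0 by (simp add: v_def w_def)
  show "((\<lambda>x. snd (snd (snd (X ((x - l) / \<epsilon>))))) has_real_derivative
      \<gamma> * fst (snd (snd (X ?s))) + fst (snd (snd (X ?s))) ^ 3 - fst (X ?s)) (at x)"
    using DERIV_affine[OF d(4) \<epsilon>0] \<epsilon>0 by (simp add: u_def v_def w_def)
qed

lemma outer_orbit:
  assumes s: "outer_solution \<gamma> \<epsilon> q u u1 v v1" and \<gamma>: "0 < \<gamma>" "\<gamma> \<le> 1/100"
    and \<epsilon>: "0 < \<epsilon>" "\<epsilon> \<le> 1/100" and q: "q \<in> pin_range"
  shows "orbit_on \<beta> \<gamma> (\<epsilon>\<^sup>2) {m..} (\<lambda>x. (u (x - m), u1 (x - m), v (x - m), v1 (x - m)))"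
proof (rule orbit_onI)
  fix x assume "x \<in> {m..}"
  hence y: "x - m \<in> domain Unbounded" and y0: "x - m \<ge> 0" by auto
  note S = half_solutionD[OF s[unfolded outer_solution_def]]
  have q': "19/20 * jump \<le> q" "q \<le> 21/20 * jump" using q by (auto simp: pin_range_def)
  have f: "f_left (u (x - m)) = cubic \<beta> (u (x - m))"
    using outer_u_range[OF s \<gamma> \<epsilon> q' y0] by (intro f_left_eq) auto
  have g: "g_out \<gamma> (v (x - m)) = \<gamma> * v (x - m) + v (x - m) ^ 3"
    using outer_v_abs[OF s \<gamma> \<epsilon> q' y0] q' jump_bounds by (intro g_out_eq) auto
  note D1 = S(1)[unfolded deriv2_on_def, rule_format, OF y]
  note D2 = S(4)[unfolded deriv2_on_def, rule_format, OF y]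
  have sh: "((\<lambda>x. z (x - m)) has_real_derivative D) (at x)" if "(z has_real_derivative D) (at (x - m))" for z D
    using DERIV_affine[of z D x m 1] that by simp
  show "((\<lambda>x. u (x - m)) has_real_derivative u1 (x - m)) (at x)" by (rule sh[OF conjunct1[OF D1]])
  show "((\<lambda>x. v (x - m)) has_real_derivative v1 (x - m)) (at x)" by (rule sh[OF conjunct1[OF D2]])
  show "((\<lambda>x. u1 (x - m)) has_real_derivative (v (x - m) - cubic \<beta> (u (x - m))) / \<epsilon>\<^sup>2) (at x)"
    using sh[OF conjunct2[OF D1]] f by simp
  show "((\<lambda>x. v1 (x - m)) has_real_derivative \<gamma> * v (x - m) + v (x - m) ^ 3 - u (x - m)) (at x)"
    using sh[OF conjunct2[OF D2]] g by simp
qed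

theorem pulse_exists:
  assumes \<gamma>: "0 < \<gamma>" "\<gamma> \<le> 1/100"
  shows "\<exists>d1>0. \<forall>d. 0 < d \<and> d < d1 \<longrightarrow>
    (\<exists>u v. standing_pulse \<beta> \<gamma> d u v \<and> smooth_on_pos u \<and> smooth_on_pos v \<and> exp_decaying u \<and> exp_decaying v)"
proof -
  obtain \<epsilon>0 where \<epsilon>0: "\<epsilon>0 > 0" "\<epsilon>0 \<le> 1/100" and match: "\<And>\<epsilon>. 0 < \<epsilon> \<Longrightarrow> \<epsilon> \<le> \<epsilon>0 \<Longrightarrow> matched_pieces \<gamma> \<epsilon>"
    using matching[OF \<gamma>] by blast
  have "\<exists>u v. standing_pulse \<beta> \<gamma> d u v \<and> smooth_on_pos u \<and> smooth_on_pos v \<and> exp_decaying u \<and> exp_decaying v"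
    if d: "0 < d" "d < \<epsilon>0\<^sup>2" for d
  proof -
    define \<epsilon> where "\<epsilon> = sqrt d"
    have \<epsilon>: "0 < \<epsilon>" "\<epsilon> \<le> \<epsilon>0" "\<epsilon>\<^sup>2 = d"
      using d \<epsilon>0 by (auto simp: \<epsilon>_def real_le_lsqrt)
    have \<epsilon>': "\<epsilon> \<le> 1/100" using \<epsilon> \<epsilon>0 by simp
    obtain l q S X ui ui1 vi vi1 q' uo uo1 vo vo1 where
      i: "inner_solution \<gamma> \<epsilon> l (2 * jump - q) ui ui1 vi vi1" "0 < l" "l \<le> 7/2 * jump" "2 * jump - q \<in> pin_range"
      and o: "outer_solution \<gamma> \<epsilon> q' uo uo1 vo vo1" "q' \<in> pin_range" and S: "0 < S"
      and path: "\<forall>s. 0 \<le> s \<and> s \<le> S \<longrightarrow> (X has_vector_derivative layer_field \<gamma> \<epsilon> (X s)) (at s) \<and>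
          0 \<le> fst (X s) \<and> fst (X s) \<le> 2 * mid \<and> \<bar>fst (snd (snd (X s)))\<bar> \<le> 1/10"
      and ends: "X 0 = (2 * mid, \<epsilon> * ui1 0 / l, q, vi1 0 / l)" "X S = (0, \<epsilon> * uo1 0, q', vo1 0)"
      using match[OF \<epsilon>(1,2)] unfolding matched_pieces_def by (elim exE conjE) (rule that, assumption+)
    define m where "m = l + \<epsilon> * S"
    have m: "m > l" "m > 0" using i \<epsilon> S by (auto simp: m_def add_pos_pos)
    define XI where "XI = (\<lambda>x. (2 * mid - ui ((l - x) / l), ui1 ((l - x) / l) / l, 2 * jump - vi ((l - x) / l), vi1 ((l - x) / l) / l))"
    define XL where "XL = (\<lambda>x. (fst (X ((x - l) / \<epsilon>)), fst (snd (X ((x - l) / \<epsilon>))) / \<epsilon>,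
      fst (snd (snd (X ((x - l) / \<epsilon>)))), snd (snd (snd (X ((x - l) / \<epsilon>))))))"
    define XO where "XO = (\<lambda>x. (uo (x - m), uo1 (x - m), vo (x - m), vo1 (x - m)))"
    note Si = half_solutionD[OF i(1)[unfolded inner_solution_def]]
    note So = half_solutionD[OF o(1)[unfolded outer_solution_def]]
    have oI: "orbit_on \<beta> \<gamma> (\<epsilon>\<^sup>2) {0..l} XI"
      unfolding XI_def by (rule inner_orbit[OF i(1) \<gamma> \<epsilon>(1) \<epsilon>' i(4,2,3)])
    have oL: "orbit_on \<beta> \<gamma> (\<epsilon>\<^sup>2) {l..m} XL"
      unfolding XL_def m_def by (rule layer_orbit[OF path[rule_format, OF conjI] \<epsilon>(1)])
    have oO: "orbit_on \<beta> \<gamma> (\<epsilon>\<^sup>2) {m..} XO"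
      unfolding XO_def by (rule outer_orbit[OF o(1) \<gamma> \<epsilon>(1) \<epsilon>' o(2)])
    define Y where "Y = (\<lambda>x. if x \<le> l then XI x else XL x)"
    have jl: "XI l = XL l" using i(2) \<epsilon> ends(1) Si(3,6) by (simp add: XI_def XL_def)
    have oY: "orbit_on \<beta> \<gamma> (\<epsilon>\<^sup>2) {0..m} Y"
      unfolding Y_def by (rule orbit_on_glue[OF oI oL jl]) auto
    have jm: "Y m = XO m" using m \<epsilon> ends(2) So(3,6) by (simp add: Y_def XL_def XO_def m_def)
    define Z where "Z = (\<lambda>x. if x \<le> m then Y x else XO x)"
    have oZ: "orbit_on \<beta> \<gamma> (\<epsilon>\<^sup>2) {0..} Z"
      unfolding Z_def by (rule orbit_on_glue[OF oY oO jm]) auto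
    have ZO: "Z x = XO x" if "x \<ge> m" for x using that jm by (cases "x = m") (auto simp: Z_def)
    have q': "19/20 * jump \<le> q'" "q' \<le> 21/20 * jump" using o(2) by (auto simp: pin_range_def)
    have q0: "q' > 0" using q' jump_bounds by simp
    \<comment> \<open>The energy decays like \<open>exp (- 2 * c * (x - m))\<close>, hence \<open>u\<close> and \<open>v\<close> like its square root; the factor
      \<open>exp (c * m)\<close> undoes the shift by \<open>m\<close>.\<close>
    define c where "c = sqrt (2 * \<gamma>) / 2"
    define C where "C = q' / \<epsilon> * exp (c * m)"
    have c0: "c > 0" using \<gamma> by (simp add: c_def)
    have decay: "\<bar>fst (Z x)\<bar> \<le> C * exp (- c * x) \<and> \<bar>fst (snd (snd (Z x)))\<bar> \<le> C * exp (- c * x)" if x: "x \<ge> m" for x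
    proof -
      let ?y = "x - m"
      have y: "?y \<ge> 0" using x by simp
      define E where "E = q' * exp (- c * ?y)"
      have E: "E > 0" using q0 by (simp add: E_def)
      have "exp (- sqrt (2 * \<gamma>) * ?y) = (exp (- c * ?y))\<^sup>2"
        by (simp add: c_def power2_eq_square field_simps flip: exp_add)
      hence en: "(vo ?y)\<^sup>2 + \<epsilon>\<^sup>2 * (uo ?y)\<^sup>2 \<le> E\<^sup>2"
        using outer_decay[OF o(1) \<gamma> \<epsilon>(1) \<epsilon>' q' y] by (simp add: E_def power_mult_distrib)
      have "(vo ?y)\<^sup>2 \<le> E\<^sup>2" by (rule order_trans[OF _ en]) simp
      hence v: "\<bar>vo ?y\<bar> \<le> E" using E by (simp add: abs_le_square_iff[symmetric])
      have "(\<epsilon> * uo ?y)\<^sup>2 \<le> E\<^sup>2" unfolding power_mult_distrib by (rule order_trans[OF _ en]) simp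
      hence "\<bar>\<epsilon> * uo ?y\<bar> \<le> E" using E by (simp add: abs_le_square_iff[symmetric])
      hence u: "\<bar>uo ?y\<bar> \<le> E / \<epsilon>" using \<epsilon> by (simp add: abs_mult field_simps)
      have EC: "E / \<epsilon> = C * exp (- c * x)" by (simp add: E_def C_def algebra_simps flip: exp_add)
      have "E \<le> E / \<epsilon>" using E \<epsilon> \<epsilon>' by (simp add: field_simps)
      thus ?thesis using u v EC by (simp add: ZO[OF x] XO_def)
    qed
    have Z0: "Z 0 = XI 0" using m i(2) by (simp add: Z_def Y_def)
    show ?thesis
    proof (rule pulse_of_half_orbit[OF oZ[unfolded \<epsilon>(3)] _ _ _ c0 decay m(2)])
      show "fst (snd (Z 0)) = 0" "snd (snd (snd (Z 0))) = 0"
        using Si(2,5) i(2) by (simp_all add: Z0 XI_def)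
      show "fst (snd (snd (Z m))) \<noteq> 0" using So(6) q0 by (simp add: ZO XO_def)
    qed (use d in auto)
  qed
  thus ?thesis using \<epsilon>0 by (intro exI[of _ "\<epsilon>0\<^sup>2"]) auto
qed

end

theorem theorem1p1:
  fixes \<beta> :: real
  assumes "1/3 < \<beta>" and "\<beta> < 1/2"
  shows "\<exists>\<gamma>1>0. \<exists>d1 :: real \<Rightarrow> real.
           (\<forall>\<gamma>. 0 < \<gamma> \<and> \<gamma> \<le> \<gamma>1 \<longrightarrow> d1 \<gamma> > 0) \<and>
           (\<forall>\<gamma> d. 0 < \<gamma> \<and> \<gamma> < \<gamma>1 \<and> 0 < d \<and> d < d1 \<gamma> \<longrightarrow>
              (\<exists>u0 v0. standing_pulse \<beta> \<gamma> d u0 v0 \<and>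
                 smooth_on_pos u0 \<and> smooth_on_pos v0 \<and>
                 exp_decaying u0 \<and> exp_decaying v0))"
proof -
  interpret cubic_parameter \<beta> using assms by unfold_locales
  define P where "P = (\<lambda>\<gamma> d1. d1 > 0 \<and> (\<forall>d. 0 < d \<and> d < d1 \<longrightarrow>
    (\<exists>u v. standing_pulse \<beta> \<gamma> d u v \<and> smooth_on_pos u \<and> smooth_on_pos v \<and> exp_decaying u \<and> exp_decaying v)))"
  define d1 where "d1 = (\<lambda>\<gamma>. SOME d1. P \<gamma> d1)"
  have "P \<gamma> (d1 \<gamma>)" if "0 < \<gamma>" "\<gamma> \<le> 1/100" for \<gamma>
    unfolding d1_def by (rule someI_ex) (use pulse_exists[OF that] in \<open>simp add: P_def\<close>)
  thus ?thesis
    unfolding P_def by (intro exI[of _ "1/100::real"] conjI exI[of _ d1]) auto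
qed

end
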